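(* Let $(u_h,p_h,\lambda_h)$ be the solution of Problem $\mathrm{VE}_h$, and let $(u_h^{(k)},p_h^{(k)},\lambda_h^{(k)})_{k\ge1}$ be generated as follows: choose an arbitrary $\lambda_h^{(1)}\in\tilde\Lambda_h$ and $\rho>0$, and for $k=1,2,\dots$: Step 1. With $\lambda_h^{(k)}$ known, determine $(u_h^{(k)},p_h^{(k)})\in V_{nh}\times\mathring Q_h$ by $$a(u_h^{(k)},v_h)+b(v_h,p_h^{(k)})=(f,v_h)_{L^2(\Omega)^2}-(v_{h\tau},\lambda_h^{(k)})_{\Lambda_h}\quad(\forall v_h\in V_{nh}),\qquad b(u_h^{(k)},q_h)=0\quad(\forall q_h\in\mathring Q_h).$$ Step 2. Put $\lambda_h^{(k+1)}=\mathrm{Proj}_{\tilde\Lambda_h}(\lambda_h^{(k)}+\rho u_{h\tau}^{(k)})\in\tilde\Lambda_h$. Then there exists a constant $\rho_0>0$ independent of $h$ such that if $0<\rho<\rho_0$, the iterative solution $(u_h^{(k)},p_h^{(k)},\lambda_h^{(k)})$ converges to $(u_h,p_h,\lambda_h)$ in $H^1(\Omega)^2\times L^2(\Omega)\times\Lambda_h$ as $k\to\infty$.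
   Context: Geometry. $\Omega\subset\mathbf R^2$ is a bounded polygonal domain with boundary $\Gamma=\partial\Omega=\overline\Gamma_0\cup\overline\Gamma_1$, where $\Gamma_0,\Gamma_1$ are disjoint nonempty relatively open subsets of $\Gamma$ and $\overline\Gamma_1$ is exactly one whole side of the polygon, with endpoints $M_1,M_{m+1}$. On $\Gamma_1$, $n=(n_1,n_2)$ is the (constant) outer unit normal and $\tau=(n_2,-n_1)$; for a vector field $v$, $v_n=v\cdot n$, $v_\tau=v\cdot\tau$ on $\Gamma_1$ (and $v_{hn}$, $v_{h\tau}$ for $v_h$). Data. $\nu>0$, $f\in L^2(\Omega)^2$, $g\in C^0(\overline\Gamma_1)$ with $g>0$ on $\Gamma_1$. Mesh. $\{\mathscr T_h\}_h$ is a family of triangulations of $\overline\Omega$, $h$ being the length of the greatest side, such that: two distinct triangles meet in a side, a node or $\emptyset$; the triangles cover $\overline\Omega$ and the boundary vertices belong to $\Gamma$; for some constants $K,K'>0$ independent of $h$ each triangle contains a circle of radius $Kh$ and is contained in a circle of radius $K'h$; each triangle has at least one vertex not on $\Gamma$. $\Sigma_h$ is the set of all vertices and all midpoints of sides of triangles. $\Gamma_{0,h}=\overline\Gamma_0\cap\Sigma_h$, $\overline\Gamma_1\cap\Sigma_h=\{M_1,M_{3/2},M_2,\dots,M_{m+1/2},M_{m+1}\}$, where $M_1,\dots,M_{m+1}$ are the vertices on $\overline\Gamma_1$ in order along $\overline\Gamma_1$ ($m$ depends on $h$) and $M_{i+1/2}$ is the midpoint of $e_i=[M_i,M_{i+1}]$,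 of length $|e_i|$; $\mathring\Gamma_{1,h}=\Gamma_1\cap\Sigma_h$. Spaces ($\mathscr P_k$ = polynomials of degree $\le k$). $V_h=\{v_h\in C^0(\overline\Omega)^2: v_h|_T\in\mathscr P_2(T)^2\ \forall T\in\mathscr T_h\}$, $Q_h=\{q_h\in C^0(\overline\Omega): q_h|_T\in\mathscr P_1(T)\ \forall T\in\mathscr T_h\}$, $\mathring Q_h=\{q_h\in Q_h:\int_\Omega q_h\,dx=0\}$, $V_{nh}=\{v_h\in V_h: v_h(M)=0\ \forall M\in\Gamma_{0,h},\ v_{hn}(M)=0\ \forall M\in\mathring\Gamma_{1,h}\}$. $\Lambda_h=\{\mu_h\in C^0(\overline\Gamma_1):\mu_h|_{e_i}\in\mathscr P_2(e_i)\ (1\le i\le m),\ \mu_h(M_1)=\mu_h(M_{m+1})=0\}$ is a Hilbert space with inner product (writing $g_i=g(M_i)$, $\lambda_{h,i}=\lambda_h(M_i)$, etc., also for half-integer indices) $$(\lambda_h,\mu_h)_{\Lambda_h}=\frac16\sum_{i=1}^m|e_i|\big(g_i\lambda_{h,i}\mu_{h,i}+4g_{i+\frac12}\lambda_{h,i+\frac12}\mu_{h,i+\frac12}+g_{i+1}\lambda_{h,i+1}\mu_{h,i+1}\big).$$ $\tilde\Lambda_h=\{\mu_h\in\Lambda_h:|\mu_h(M)|\le1\ \forall M\in\mathring\Gamma_{1,h}\}$, and $\mathrm{Proj}_{\tilde\Lambda_h}:\Lambda_h\to\tilde\Lambda_h$ is the orthogonal projection onto this closed convex set in $\Lambda_h$;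 explicitly, $\mathrm{Proj}_{\tilde\Lambda_h}(\mu_h)$ is obtained by truncating each nodal value $\mu_h(M)$ to $[-1,1]$. Forms. $a(u,v)=2\nu\sum_{i,j=1}^2\int_\Omega e_{ij}(u)e_{ij}(v)\,dx$ with $e_{ij}(u)=\frac12(\partial u_i/\partial x_j+\partial u_j/\partial x_i)$; $b(v,q)=-\int_\Omega(\mathrm{div}\,v)q\,dx$. Problem $\mathrm{VE}_h$: find $(u_h,p_h,\lambda_h)\in V_{nh}\times\mathring Q_h\times\tilde\Lambda_h$ with $a(u_h,v_h)+b(v_h,p_h)+(v_{h\tau},\lambda_h)_{\Lambda_h}=(f,v_h)_{L^2(\Omega)^2}$ for all $v_h\in V_{nh}$, $b(u_h,q_h)=0$ for all $q_h\in\mathring Q_h$, and $(u_{h\tau},\mu_h-\lambda_h)_{\Lambda_h}\le0$ for all $\mu_h\in\tilde\Lambda_h$. It has a unique solution. *)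

theory Defs
  imports "HOL-Analysis.Analysis"
begin

type_synonym pt = "real ^ 2"
type_synonym vfield = "pt \<Rightarrow> pt"
type_synonym sfield = "pt \<Rightarrow> real"

section \<open>Polygonal domains and triangulations\<close>

(* SS is the set of sides (closed segments). As a family of 1-simplices, "triangulation" says
   that two distinct sides meet at most in a common endpoint. Each corner lies on exactly two
   sides, which are not aligned, and interior (closure \<Omega>) = \<Omega> excludes slits; hence \<Omega> is a
   Lipschitz polygon. Holes are allowed. *)
definition polygonal_domain :: "pt set \<Rightarrow> pt set set \<Rightarrow> bool" where
  "polygonal_domain \<Omega> SS \<longleftrightarrow>
     open \<Omega> \<and> connected \<Omega> \<and> bounded \<Omega> \<and> \<Omega> \<noteq> {} \<and> interior (closure \<Omega>) = \<Omega> \<and>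
     frontier \<Omega> = \<Union>SS \<and> triangulation SS \<and> (\<forall>s\<in>SS. 1 simplex s) \<and>
     (\<forall>s\<in>SS. \<forall>v. v extreme_point_of s \<longrightarrow> card {t\<in>SS. v extreme_point_of t} = 2) \<and>
     (\<forall>s\<in>SS. \<forall>t\<in>SS. s \<noteq> t \<and> s \<inter> t \<noteq> {} \<longrightarrow> \<not> collinear (s \<union> t))"

definition outer_unit_normal :: "pt set \<Rightarrow> pt set \<Rightarrow> pt \<Rightarrow> bool" where
  "outer_unit_normal \<Omega> \<Gamma>1 n \<longleftrightarrow>
     norm n = 1 \<and> (\<forall>x\<in>\<Gamma>1. \<forall>y\<in>\<Gamma>1. n \<bullet> (y - x) = 0) \<and>
     (\<forall>x\<in>\<Gamma>1. \<exists>\<epsilon>>0. \<forall>t. 0 < t \<and> t < \<epsilon> \<longrightarrow>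
         x - t *\<^sub>R n \<in> \<Omega> \<and> x + t *\<^sub>R n \<notin> closure \<Omega>)"

definition tangent :: "pt \<Rightarrow> pt" where
  "tangent n = vector [n $ 2, - (n $ 1)]"

definition mesh_vertices :: "pt set set \<Rightarrow> pt set" where
  "mesh_vertices \<T> = {v. \<exists>T\<in>\<T>. v extreme_point_of T}"

definition mesh_nodes :: "pt set set \<Rightarrow> pt set" where
  "mesh_nodes \<T> = mesh_vertices \<T> \<union>
     {midpoint a b | a b. \<exists>T\<in>\<T>. closed_segment a b edge_of T}"

definition mesh_size :: "pt set set \<Rightarrow> real" where
  "mesh_size \<T> = Max {dist a b | a b. \<exists>T\<in>\<T>. closed_segment a b edge_of T}"

definition admissible_mesh :: "pt set \<Rightarrow> real \<Rightarrow> real \<Rightarrow> real \<Rightarrow> pt set set \<Rightarrow> bool" where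
  "admissible_mesh \<Omega> K K' h \<T> \<longleftrightarrow>
     triangulation \<T> \<and> (\<forall>T\<in>\<T>. 2 simplex T) \<and> mesh_size \<T> = h \<and>
     \<Union>\<T> = closure \<Omega> \<and>
     (\<forall>v\<in>mesh_vertices \<T>. v \<in> frontier (\<Union>\<T>) \<longrightarrow> v \<in> frontier \<Omega>) \<and>
     (\<forall>T\<in>\<T>. (\<exists>c. cball c (K * h) \<subseteq> T) \<and> (\<exists>c. T \<subseteq> cball c (K' * h))) \<and>
     (\<forall>T\<in>\<T>. \<exists>v. v extreme_point_of T \<and> v \<notin> frontier \<Omega>)"

(* M 1, ..., M (m+1) are the vertices on closure \<Gamma>1 in order, from one endpoint to the other;
   the half-integer node M_{i+1/2} is midpoint (M i) (M (i+1)). *)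
definition boundary_enumeration :: "pt set \<Rightarrow> pt set set \<Rightarrow> nat \<Rightarrow> (nat \<Rightarrow> pt) \<Rightarrow> bool" where
  "boundary_enumeration \<Gamma>1 \<T> m M \<longleftrightarrow>
     M ` {1..m+1} = mesh_vertices \<T> \<inter> closure \<Gamma>1 \<and>
     closure \<Gamma>1 = closed_segment (M 1) (M (m+1)) \<and>
     (\<forall>i\<in>{1..m+1}. \<forall>j\<in>{1..m+1}. i < j \<longrightarrow> dist (M 1) (M i) < dist (M 1) (M j))"

section \<open>Finite element spaces\<close>

(* A function on a set S is represented by a total function; its values off S are irrelevant. *)
definition is_poly_on :: "nat \<Rightarrow> pt set \<Rightarrow> sfield \<Rightarrow> bool" where
  "is_poly_on k S w \<longleftrightarrow>
     (\<exists>c :: nat \<Rightarrow> nat \<Rightarrow> real. \<forall>x\<in>S. w x = (\<Sum>i\<le>k. \<Sum>j\<le>k-i. c i j * (x $ 1) ^ i * (x $ 2) ^ j))"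

definition V_space :: "pt set \<Rightarrow> pt set set \<Rightarrow> vfield set" where
  "V_space \<Omega> \<T> =
     {v. continuous_on (closure \<Omega>) v \<and> (\<forall>T\<in>\<T>. \<forall>i. is_poly_on 2 T (\<lambda>x. v x $ i))}"

definition Q_space :: "pt set \<Rightarrow> pt set set \<Rightarrow> sfield set" where
  "Q_space \<Omega> \<T> = {q. continuous_on (closure \<Omega>) q \<and> (\<forall>T\<in>\<T>. is_poly_on 1 T q)}"

definition Q0_space :: "pt set \<Rightarrow> pt set set \<Rightarrow> sfield set" where
  "Q0_space \<Omega> \<T> = {q \<in> Q_space \<Omega> \<T>. (LINT x:\<Omega>|lebesgue. q x) = 0}"

definition Vn_space :: "pt set \<Rightarrow> pt set \<Rightarrow> pt set \<Rightarrow> pt \<Rightarrow> pt set set \<Rightarrow> vfield set" where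
  "Vn_space \<Omega> \<Gamma>0 \<Gamma>1 n \<T> =
     {v \<in> V_space \<Omega> \<T>. (\<forall>x\<in>closure \<Gamma>0 \<inter> mesh_nodes \<T>. v x = 0) \<and>
                       (\<forall>x\<in>\<Gamma>1 \<inter> mesh_nodes \<T>. v x \<bullet> n = 0)}"

definition Lam_space :: "pt set \<Rightarrow> nat \<Rightarrow> (nat \<Rightarrow> pt) \<Rightarrow> sfield set" where
  "Lam_space \<Gamma>1 m M =
     {\<mu>. continuous_on (closure \<Gamma>1) \<mu> \<and>
          (\<forall>i\<in>{1..m}. is_poly_on 2 (closed_segment (M i) (M (i+1))) \<mu>) \<and>
          \<mu> (M 1) = 0 \<and> \<mu> (M (m+1)) = 0}"

definition Lam_inner :: "sfield \<Rightarrow> nat \<Rightarrow> (nat \<Rightarrow> pt) \<Rightarrow> sfield \<Rightarrow> sfield \<Rightarrow> real" where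
  "Lam_inner g m M l \<mu> = 1/6 * (\<Sum>i=1..m. dist (M i) (M (i+1)) *
      (let c = midpoint (M i) (M (i+1)) in
         g (M i) * l (M i) * \<mu> (M i) + 4 * g c * l c * \<mu> c
         + g (M (i+1)) * l (M (i+1)) * \<mu> (M (i+1))))"

definition Lam_norm :: "sfield \<Rightarrow> nat \<Rightarrow> (nat \<Rightarrow> pt) \<Rightarrow> sfield \<Rightarrow> real" where
  "Lam_norm g m M \<mu> = sqrt (Lam_inner g m M \<mu> \<mu>)"

definition Lam_tilde :: "pt set \<Rightarrow> pt set set \<Rightarrow> nat \<Rightarrow> (nat \<Rightarrow> pt) \<Rightarrow> sfield set" where
  "Lam_tilde \<Gamma>1 \<T> m M =
     {\<mu> \<in> Lam_space \<Gamma>1 m M. \<forall>x\<in>\<Gamma>1 \<inter> mesh_nodes \<T>. \<bar>\<mu> x\<bar> \<le> 1}"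

(* \<pi> represents Proj \<xi>: the element of the convex set nearest to \<xi> in the Lam_norm. A relation,
   because elements of Lam_space are represented by total functions. *)
definition is_Lam_proj ::
  "pt set \<Rightarrow> sfield \<Rightarrow> pt set set \<Rightarrow> nat \<Rightarrow> (nat \<Rightarrow> pt) \<Rightarrow> sfield \<Rightarrow> sfield \<Rightarrow> bool" where
  "is_Lam_proj \<Gamma>1 g \<T> m M \<xi> \<pi> \<longleftrightarrow>
     \<pi> \<in> Lam_tilde \<Gamma>1 \<T> m M \<and>
     (\<forall>\<mu>\<in>Lam_tilde \<Gamma>1 \<T> m M.
        Lam_norm g m M (\<lambda>x. \<xi> x - \<pi> x) \<le> Lam_norm g m M (\<lambda>x. \<xi> x - \<mu> x))"

section \<open>Forms and norms\<close>

(* Classical partial derivative of the i-th component. Elements of V_space are smooth inside each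
   triangle, so it exists off the null set formed by the sides of the triangles, and coincides
   there with the weak derivative; "deriv" is unspecified where the derivative does not exist. *)
definition partial :: "vfield \<Rightarrow> 2 \<Rightarrow> 2 \<Rightarrow> pt \<Rightarrow> real" where
  "partial u i j x = deriv (\<lambda>t. u (x + t *\<^sub>R axis j 1) $ i) 0"

definition strain :: "vfield \<Rightarrow> 2 \<Rightarrow> 2 \<Rightarrow> pt \<Rightarrow> real" where
  "strain u i j x = (partial u i j x + partial u j i x) / 2"

definition divergence :: "vfield \<Rightarrow> pt \<Rightarrow> real" where
  "divergence v x = (\<Sum>i\<in>UNIV. partial v i i x)"

definition form_a :: "pt set \<Rightarrow> real \<Rightarrow> vfield \<Rightarrow> vfield \<Rightarrow> real" where
  "form_a \<Omega> \<nu> u v =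
     2 * \<nu> * (\<Sum>i\<in>UNIV. \<Sum>j\<in>UNIV. LINT x:\<Omega>|lebesgue. strain u i j x * strain v i j x)"

definition form_b :: "pt set \<Rightarrow> vfield \<Rightarrow> sfield \<Rightarrow> real" where
  "form_b \<Omega> v q = - (LINT x:\<Omega>|lebesgue. divergence v x * q x)"

definition L2_vector_fields :: "pt set \<Rightarrow> vfield set" where
  "L2_vector_fields \<Omega> =
     {f. set_borel_measurable lebesgue \<Omega> f \<and> set_integrable lebesgue \<Omega> (\<lambda>x. (norm (f x))\<^sup>2)}"

definition L2_inner :: "pt set \<Rightarrow> vfield \<Rightarrow> vfield \<Rightarrow> real" where
  "L2_inner \<Omega> f v = (LINT x:\<Omega>|lebesgue. f x \<bullet> v x)"

definition L2_norm_on :: "pt set \<Rightarrow> sfield \<Rightarrow> real" where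
  "L2_norm_on \<Omega> q = sqrt (LINT x:\<Omega>|lebesgue. (q x)\<^sup>2)"

definition H1_norm :: "pt set \<Rightarrow> vfield \<Rightarrow> real" where
  "H1_norm \<Omega> v =
     sqrt ((LINT x:\<Omega>|lebesgue. (norm (v x))\<^sup>2) +
           (\<Sum>i\<in>UNIV. \<Sum>j\<in>UNIV. LINT x:\<Omega>|lebesgue. (partial v i j x)\<^sup>2))"

section \<open>The discrete problem and the Uzawa iteration\<close>

definition VE_solution ::
  "pt set \<Rightarrow> pt set \<Rightarrow> pt set \<Rightarrow> pt \<Rightarrow> real \<Rightarrow> vfield \<Rightarrow> sfield \<Rightarrow> pt set set \<Rightarrow> nat \<Rightarrow> (nat \<Rightarrow> pt) \<Rightarrow>
   vfield \<Rightarrow> sfield \<Rightarrow> sfield \<Rightarrow> bool" where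
  "VE_solution \<Omega> \<Gamma>0 \<Gamma>1 n \<nu> f g \<T> m M u p l \<longleftrightarrow>
     u \<in> Vn_space \<Omega> \<Gamma>0 \<Gamma>1 n \<T> \<and> p \<in> Q0_space \<Omega> \<T> \<and> l \<in> Lam_tilde \<Gamma>1 \<T> m M \<and>
     (\<forall>v\<in>Vn_space \<Omega> \<Gamma>0 \<Gamma>1 n \<T>.
        form_a \<Omega> \<nu> u v + form_b \<Omega> v p + Lam_inner g m M (\<lambda>x. v x \<bullet> tangent n) l
        = L2_inner \<Omega> f v) \<and>
     (\<forall>q\<in>Q0_space \<Omega> \<T>. form_b \<Omega> u q = 0) \<and>
     (\<forall>\<mu>\<in>Lam_tilde \<Gamma>1 \<T> m M.
        Lam_inner g m M (\<lambda>x. u x \<bullet> tangent n) (\<lambda>x. \<mu> x - l x) \<le> 0)"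

definition uzawa_step1 ::
  "pt set \<Rightarrow> pt set \<Rightarrow> pt set \<Rightarrow> pt \<Rightarrow> real \<Rightarrow> vfield \<Rightarrow> sfield \<Rightarrow> pt set set \<Rightarrow> nat \<Rightarrow> (nat \<Rightarrow> pt) \<Rightarrow>
   sfield \<Rightarrow> vfield \<Rightarrow> sfield \<Rightarrow> bool" where
  "uzawa_step1 \<Omega> \<Gamma>0 \<Gamma>1 n \<nu> f g \<T> m M l u p \<longleftrightarrow>
     u \<in> Vn_space \<Omega> \<Gamma>0 \<Gamma>1 n \<T> \<and> p \<in> Q0_space \<Omega> \<T> \<and>
     (\<forall>v\<in>Vn_space \<Omega> \<Gamma>0 \<Gamma>1 n \<T>.
        form_a \<Omega> \<nu> u v + form_b \<Omega> v p
        = L2_inner \<Omega> f v - Lam_inner g m M (\<lambda>x. v x \<bullet> tangent n) l) \<and>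
     (\<forall>q\<in>Q0_space \<Omega> \<T>. form_b \<Omega> u q = 0)"

definition uzawa_step2 ::
  "pt set \<Rightarrow> pt \<Rightarrow> sfield \<Rightarrow> pt set set \<Rightarrow> nat \<Rightarrow> (nat \<Rightarrow> pt) \<Rightarrow> real \<Rightarrow>
   vfield \<Rightarrow> sfield \<Rightarrow> sfield \<Rightarrow> bool" where
  "uzawa_step2 \<Gamma>1 n g \<T> m M \<rho> u l l' \<longleftrightarrow>
     is_Lam_proj \<Gamma>1 g \<T> m M (\<lambda>x. l x + \<rho> * (u x \<bullet> tangent n)) l'"

end

theory Submission
  imports Defs
begin

text \<open>Let \<open>w, r, \<delta>\<close> be the errors of an iterate. Testing the error equation with \<open>w\<close> and using that
  the projection is nonexpansive gives
  \<open>\<parallel>\<delta>'\<parallel>\<^sup>2 \<le> \<parallel>\<delta>\<parallel>\<^sup>2 - 2 \<rho> a(w, w) + \<rho>\<^sup>2 \<parallel>w\<^sub>\<tau>\<parallel>\<^sup>2\<close>, so everything rests on a trace inequality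
  \<open>\<parallel>w\<^sub>\<tau>\<parallel>\<^sup>2 \<le> C a(w, w)\<close> with \<open>C\<close> independent of \<open>h\<close>; then \<open>a(w, w) \<rightarrow> 0\<close> by telescoping.
  Take a direction \<open>d\<close> with \<open>d \<bullet> n = 1\<close> and \<open>\<psi>(x) = (x - M\<^sub>1) \<bullet> n\<close>. As \<open>w\<close> vanishes on
  the other sides, the \<open>d\<close>-derivatives of \<open>\<psi> (d \<bullet> w)\<^sup>2\<close> and of \<open>arctan(\<psi>/h) (d \<bullet> w)\<^sup>2\<close> have integral zero.
  Since the \<open>d\<close>-derivative of \<open>d \<bullet> w\<close> is \<open>d \<bullet> \<epsilon>(w) d\<close>, this bounds first \<open>d \<bullet> w\<close> in \<open>L\<^sup>2\<close> and then
  \<open>1/h\<close> times its squared \<open>L\<^sup>2\<close> norm on a strip of width \<open>O(h)\<close>; an inverse estimate on the boundary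
  triangles and the two choices \<open>d = n \<plusminus> \<tau>\<close> give the trace inequality without Korn's inequality.
  For fixed \<open>h\<close>, edge bubbles show that the nodal pressure differences tend to zero, and nodal
  functions on the side do the same for \<open>\<delta>\<close>.\<close>

section \<open>Barycentric coordinates and hat functions\<close>

text \<open>Only the constant of the trace inequality has to be uniform in h; the bound on \<rho>
  becomes \<open>4 * \<nu> / (B + 1)\<close> with \<open>B\<close> made of \<open>K\<close>,
  \<open>K'\<close>, a bound of \<open>g\<close> and the diameter of \<Omega>. After the energy of
  the errors has been shown to vanish, one mesh is fixed and constants may depend on it. This is how
  \<open>H1_norm\<close> is reached: on each triangle the L2 norm of a quadratic bounds its
  gradient. The multiplier norm is a Simpson sum of nodal values, so no boundary integral occurs. A
  squared nodal value costs 1/h^2 times an integral over the adjacent triangle; the edge length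
  gives back one h and the strip weight of height 1/h the other. The pressure comes before the
  multiplier: velocities that vanish on the whole boundary do not see the multiplier, and once the
  pressure error is gone those in \<open>Vn\<close> can isolate its nodal values. The remaining
  obstacle is geometric. The boundary is given as point sets; it must be shown to consist of whole
  mesh edges, each in one of the two parts, with consecutive \<open>M i\<close> spanning one of
  them.\<close>

definition verts :: "pt set \<Rightarrow> pt set" where
  "verts T = {v. v extreme_point_of T}"

text \<open>Defined on the whole plane, not only on \<open>T\<close>, so that it is an affine
  function there. The choice fixes a coefficient function whose values on \<open>verts T\<close> are
  determined by affine independence; its other values are arbitrary.\<close>

definition bary :: "pt set \<Rightarrow> pt \<Rightarrow> pt \<Rightarrow> real" where
  "bary T a y = (SOME u. sum u (verts T) = 1 \<and> (\<Sum>v\<in>verts T. u v *\<^sub>R v) = y) a"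

lemma simplex2_verts:
  fixes T :: "pt set"
  assumes "2 simplex T"
  shows "\<not> affine_dependent (verts T)" "card (verts T) = 3" "finite (verts T)"
    "convex hull (verts T) = T" "affine hull (verts T) = UNIV"
proof -
  obtain C where C: "\<not> affine_dependent C" "card C = 3" "T = convex hull C"
    using assms unfolding simplex_def by auto
  have "verts T = C"
    unfolding verts_def C(3) using extreme_point_of_convex_hull_affine_independent[OF C(1)] by auto
  moreover have fin: "finite C"
    using C aff_independent_finite by blast
  moreover have "affine hull C = UNIV"
  proof -
    have "aff_dim C = 2"
      using affine_independent_iff_card[of C] C by auto
    then show ?thesis
      using aff_dim_eq_full[of C] by simp
  qed
  ultimately show "\<not> affine_dependent (verts T)" "card (verts T) = 3" "finite (verts T)"
    "convex hull (verts T) = T" "affine hull (verts T) = UNIV"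
    using C by auto
qed

lemma bary_sum:
  assumes "2 simplex T"
  shows "(\<Sum>a\<in>verts T. bary T a y) = 1" "(\<Sum>a\<in>verts T. bary T a y *\<^sub>R a) = y"
proof -
  note V = simplex2_verts[OF assms]
  have "y \<in> affine hull (verts T)"
    using V by simp
  then have "\<exists>u. sum u (verts T) = 1 \<and> (\<Sum>v\<in>verts T. u v *\<^sub>R v) = y"
    unfolding affine_hull_finite[OF V(3)] by simp
  then have "sum (\<lambda>a. bary T a y) (verts T) = 1 \<and> (\<Sum>v\<in>verts T. bary T v y *\<^sub>R v) = y"
    unfolding bary_def by (rule someI_ex)
  then show "(\<Sum>a\<in>verts T. bary T a y) = 1" "(\<Sum>a\<in>verts T. bary T a y *\<^sub>R a) = y"
    by auto
qed

lemma bary_unique: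
  assumes "2 simplex T" "sum u (verts T) = 1" "(\<Sum>v\<in>verts T. u v *\<^sub>R v) = y" "a \<in> verts T"
  shows "bary T a y = u a"
proof (rule ccontr)
  assume ne: "bary T a y \<noteq> u a"
  note V = simplex2_verts[OF assms(1)]
  have "affine_dependent (verts T)"
    unfolding affine_dependent_explicit_finite[OF V(3)]
  proof (intro exI[of _ "\<lambda>v. bary T v y - u v"] conjI)
    show "(\<Sum>v\<in>verts T. bary T v y - u v) = 0"
      using bary_sum[OF assms(1)] assms by (simp add: sum_subtractf)
    show "\<exists>v\<in>verts T. bary T v y - u v \<noteq> 0"
      using ne assms by auto
    show "(\<Sum>v\<in>verts T. (bary T v y - u v) *\<^sub>R v) = 0"
      using bary_sum[OF assms(1)] assms by (simp add: sum_subtractf scaleR_diff_left)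
  qed
  then show False using V by simp
qed

lemma bary_comb:
  assumes "2 simplex T" "a \<in> verts T" "s + t = 1"
  shows "bary T a (s *\<^sub>R x + t *\<^sub>R y) = s * bary T a x + t * bary T a y"
proof (rule bary_unique[OF assms(1) _ _ assms(2)])
  show "(\<Sum>v\<in>verts T. s * bary T v x + t * bary T v y) = 1"
    using bary_sum[OF assms(1)] assms by (simp add: sum.distrib flip: sum_distrib_left)
  show "(\<Sum>v\<in>verts T. (s * bary T v x + t * bary T v y) *\<^sub>R v) = s *\<^sub>R x + t *\<^sub>R y"
  proof -
    have "(\<Sum>v\<in>verts T. (s * bary T v x + t * bary T v y) *\<^sub>R v)
      = s *\<^sub>R (\<Sum>v\<in>verts T. bary T v x *\<^sub>R v) + t *\<^sub>R (\<Sum>v\<in>verts T. bary T v y *\<^sub>R v)"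
      by (simp add: sum.distrib scaleR_add_left scaleR_sum_right)
    then show ?thesis using bary_sum(2)[OF assms(1)] by simp
  qed
qed

text \<open>Everything follows from \<open>bary_comb\<close>: with the value at the origin
  subtracted, the weights \<open>c\<close> and \<open>1 - c\<close> give homogeneity, and the
  midpoint of the doubled arguments gives additivity.\<close>

lemma bary_affine:
  assumes "2 simplex T" "a \<in> verts T"
  shows "\<exists>\<alpha> \<beta> \<gamma>. \<forall>y. bary T a y = \<alpha> + \<beta> * y $ 1 + \<gamma> * y $ 2"
proof -
  define l where "l y = bary T a y - bary T a 0" for y
  have sc: "l (c *\<^sub>R x) = c * l x" for c x
  proof -
    have "bary T a (c *\<^sub>R x + (1 - c) *\<^sub>R 0) = c * bary T a x + (1 - c) * bary T a 0"
      by (rule bary_comb[OF assms]) simp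
    then show ?thesis by (simp add: l_def left_diff_distrib right_diff_distrib)
  qed
  have add: "l (x + y) = l x + l y" for x y
  proof -
    have "bary T a ((1/2) *\<^sub>R (2 *\<^sub>R x) + (1/2) *\<^sub>R (2 *\<^sub>R y))
        = 1/2 * bary T a (2 *\<^sub>R x) + 1/2 * bary T a (2 *\<^sub>R y)"
      by (rule bary_comb[OF assms]) simp
    then show ?thesis using sc[of 2 x] sc[of 2 y] by (simp add: l_def)
  qed
  have "bary T a y = bary T a 0 + l (axis 1 1) * y $ 1 + l (axis 2 1) * y $ 2" for y
  proof -
    have "y = y $ 1 *\<^sub>R axis 1 1 + y $ 2 *\<^sub>R axis 2 1"
      by (simp add: vec_eq_iff forall_2 axis_def)
    then have "l y = l (y $ 1 *\<^sub>R axis 1 1 + y $ 2 *\<^sub>R axis 2 1)"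
      by (rule arg_cong)
    then have "l y = y $ 1 * l (axis 1 1) + y $ 2 * l (axis 2 1)"
      unfolding add sc .
    then show ?thesis using l_def[of y] by (simp add: mult.commute)
  qed
  then show ?thesis by blast
qed

lemma continuous_on_bary:
  assumes "2 simplex T" "a \<in> verts T"
  shows "continuous_on S (bary T a)"
proof -
  obtain \<alpha> \<beta> \<gamma> where "\<forall>y. bary T a y = \<alpha> + \<beta> * y $ 1 + \<gamma> * y $ 2"
    using bary_affine[OF assms] by blast
  then have "bary T a = (\<lambda>y. \<alpha> + \<beta> * y $ 1 + \<gamma> * y $ 2)" by auto
  then show ?thesis by (auto intro!: continuous_intros)
qed

lemma bary_vert:
  assumes "2 simplex T" "a \<in> verts T" "b \<in> verts T"
  shows "bary T a b = (if a = b then 1 else 0)"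
proof (rule bary_unique[OF assms(1) _ _ assms(2)])
  note fin = simplex2_verts(3)[OF assms(1)]
  show "(\<Sum>v\<in>verts T. if v = b then 1 else 0::real) = 1"
    using fin assms by simp
  have "(\<Sum>v\<in>verts T. (if v = b then 1 else 0::real) *\<^sub>R v) = (\<Sum>v\<in>verts T. if v = b then v else 0)"
    by (intro sum.cong) auto
  then show "(\<Sum>v\<in>verts T. (if v = b then 1 else 0::real) *\<^sub>R v) = b"
    using fin assms by simp
qed

lemma mem_simplex2_iff:
  assumes "2 simplex T"
  shows "y \<in> T \<longleftrightarrow> (\<forall>a\<in>verts T. bary T a y \<ge> 0)"
proof
  note V = simplex2_verts[OF assms]
  show "\<forall>a\<in>verts T. bary T a y \<ge> 0" if "y \<in> T"
  proof -
    have "y \<in> convex hull (verts T)" using that by (simp add: V(4))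
    then obtain u where u: "\<forall>x\<in>verts T. 0 \<le> u x" "sum u (verts T) = 1" "(\<Sum>v\<in>verts T. u v *\<^sub>R v) = y"
      unfolding convex_hull_finite[OF V(3)] by blast
    then show ?thesis using bary_unique[OF assms u(2,3)] by simp
  qed
  show "y \<in> T" if "\<forall>a\<in>verts T. bary T a y \<ge> 0"
  proof -
    have "y \<in> convex hull (verts T)"
      unfolding convex_hull_finite[OF V(3)]
      using that bary_sum[OF assms, of y] by (intro CollectI exI[of _ "\<lambda>a. bary T a y"]) simp
    then show ?thesis by (simp add: V(4))
  qed
qed

lemma interior_simplex2_iff:
  assumes "2 simplex T"
  shows "y \<in> interior T \<longleftrightarrow> (\<forall>a\<in>verts T. bary T a y > 0)"
proof
  note V = simplex2_verts[OF assms]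
  have *: "interior T = {y. \<exists>u. (\<forall>x\<in>verts T. 0 < u x) \<and> sum u (verts T) = 1 \<and> (\<Sum>x\<in>verts T. u x *\<^sub>R x) = y}"
    using interior_convex_hull_explicit_minimal[OF V(1)] V(2) by (simp add: V(4))
  show "\<forall>a\<in>verts T. bary T a y > 0" if y: "y \<in> interior T"
  proof -
    obtain u where u: "\<forall>x\<in>verts T. 0 < u x" "sum u (verts T) = 1" "(\<Sum>v\<in>verts T. u v *\<^sub>R v) = y"
      using y unfolding * by blast
    then show ?thesis using bary_unique[OF assms u(2,3)] by simp
  qed
  show "y \<in> interior T" if "\<forall>a\<in>verts T. bary T a y > 0"
    unfolding * using that bary_sum[OF assms, of y]
    by (intro CollectI exI[of _ "\<lambda>a. bary T a y"]) simp
qed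

lemma verts_subset: "verts T \<subseteq> T"
  by (auto simp: verts_def extreme_point_of_def)

section \<open>Nodal P1 basis functions of a conforming triangulation\<close>

locale mesh =
  fixes \<T> :: "pt set set"
  assumes tri: "triangulation \<T>" and simplex2: "T \<in> \<T> \<Longrightarrow> 2 simplex T"
begin

lemma finite_mesh: "finite \<T>"
  using tri by (simp add: triangulation_def)

lemma Int_face: "T \<in> \<T> \<Longrightarrow> T' \<in> \<T> \<Longrightarrow> (T \<inter> T') face_of T"
  using tri by (simp add: triangulation_def)

lemma verts_Int_face: "T \<in> \<T> \<Longrightarrow> T' \<in> \<T> \<Longrightarrow> verts (T \<inter> T') = verts T \<inter> T'"
  using extreme_point_of_face[OF Int_face, of T T'] unfolding verts_def
  by (auto simp: extreme_point_of_def)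

text \<open>Conformity makes the intersection a face of both triangles, and the extreme points of a
  face are the extreme points of the triangle that lie in it.\<close>

lemma vert_in_mesh:
  assumes "T \<in> \<T>" "T' \<in> \<T>" "a \<in> verts T" "a \<in> T'"
  shows "a \<in> verts T'"
  using assms verts_Int_face[of T T'] verts_Int_face[of T' T] by (metis Int_commute IntD1 IntI)

lemma mesh_vertices_eq: "mesh_vertices \<T> = (\<Union>T\<in>\<T>. verts T)"
  by (auto simp: mesh_vertices_def verts_def)

lemma finite_mesh_vertices: "finite (mesh_vertices \<T>)"
  unfolding mesh_vertices_eq using finite_mesh simplex2_verts(3)[OF simplex2] by (rule finite_UN_I)

lemma mesh_vertex_in: "a \<in> mesh_vertices \<T> \<Longrightarrow> a \<in> T \<Longrightarrow> T \<in> \<T> \<Longrightarrow> a \<in> verts T"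
  unfolding mesh_vertices_eq using vert_in_mesh by blast

text \<open>The common face is the hull of the shared vertices, so a point of it has coefficients
  supported there. Extended by zero they represent the point in both triangles, and uniqueness
  identifies the two families of coordinates. This is what makes \<open>hat\<close> independent of
  the triangle.\<close>

lemma bary_Int:
  assumes T: "T \<in> \<T>" "T' \<in> \<T>" and x: "x \<in> T" "x \<in> T'" and a: "a \<in> verts T"
  shows "bary T a x = (if a \<in> T' then bary T' a x else 0)"
proof -
  note s = simplex2[OF T(1)] simplex2[OF T(2)]
  define F where "F = verts T \<inter> T'"
  have F': "F = verts T' \<inter> T"
    using vert_in_mesh[OF T] vert_in_mesh[OF T(2,1)] verts_subset[of T] verts_subset[of T']
    unfolding F_def by blast
  have fin: "finite (verts T)" "finite (verts T')" "finite F"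
    using simplex2_verts(3) s unfolding F_def by auto
  have "T \<inter> T' = convex hull F"
  proof -
    have "compact (T \<inter> T')" "convex (T \<inter> T')"
      using s[THEN compact_simplex] s[THEN convex_simplex] by (auto intro: compact_Int convex_Int)
    then have "T \<inter> T' = convex hull (verts (T \<inter> T'))"
      unfolding verts_def by (rule Krein_Milman_Minkowski)
    then show ?thesis using verts_Int_face[OF T] F_def by simp
  qed
  then have "x \<in> convex hull F" using x by auto
  then obtain u where u: "sum u F = 1" "(\<Sum>v\<in>F. u v *\<^sub>R v) = x"
    unfolding convex_hull_finite[OF fin(3)] by auto
  define u' where "u' v = (if v \<in> F then u v else 0)" for v
  have 1: "sum u' (verts T) = 1" "(\<Sum>v\<in>verts T. u' v *\<^sub>R v) = x"
    "sum u' (verts T') = 1" "(\<Sum>v\<in>verts T'. u' v *\<^sub>R v) = x"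
  proof -
    have "sum u' (verts T) = sum u' F" "(\<Sum>v\<in>verts T. u' v *\<^sub>R v) = (\<Sum>v\<in>F. u' v *\<^sub>R v)"
      by (rule sum.mono_neutral_right; use fin in \<open>auto simp: u'_def F_def\<close>)+
    moreover have "sum u' (verts T') = sum u' F" "(\<Sum>v\<in>verts T'. u' v *\<^sub>R v) = (\<Sum>v\<in>F. u' v *\<^sub>R v)"
      by (rule sum.mono_neutral_right; use fin in \<open>auto simp: u'_def F'\<close>)+
    moreover have "sum u' F = sum u F" "(\<Sum>v\<in>F. u' v *\<^sub>R v) = (\<Sum>v\<in>F. u v *\<^sub>R v)"
      by (auto simp: u'_def)
    ultimately show "sum u' (verts T) = 1" "(\<Sum>v\<in>verts T. u' v *\<^sub>R v) = x"
      "sum u' (verts T') = 1" "(\<Sum>v\<in>verts T'. u' v *\<^sub>R v) = x" using u by auto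
  qed
  have "bary T a x = u' a"
    by (rule bary_unique[OF s(1) 1(1,2) a])
  moreover have "bary T' a x = u' a" if "a \<in> T'"
    by (rule bary_unique[OF s(2) 1(3,4)]) (use that a vert_in_mesh[OF T] in blast)
  ultimately show ?thesis by (auto simp: u'_def F_def)
qed

text \<open>The nodal P1 basis function of \<open>a\<close>. By \<open>hat_eq\<close> the choice of
  the triangle does not matter.\<close>

definition hat :: "pt \<Rightarrow> pt \<Rightarrow> real" where
  "hat a x = (if \<exists>T\<in>\<T>. x \<in> T \<and> a \<in> verts T
     then bary (SOME T. T \<in> \<T> \<and> x \<in> T \<and> a \<in> verts T) a x else 0)"

lemma hat_eq:
  assumes "T \<in> \<T>" "x \<in> T"
  shows "hat a x = (if a \<in> verts T then bary T a x else 0)"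
proof (cases "\<exists>T\<in>\<T>. x \<in> T \<and> a \<in> verts T")
  case True
  define T' where "T' = (SOME T. T \<in> \<T> \<and> x \<in> T \<and> a \<in> verts T)"
  have T': "T' \<in> \<T> \<and> x \<in> T' \<and> a \<in> verts T'"
    unfolding T'_def by (rule someI_ex) (use True in auto)
  have "hat a x = bary T' a x"
    using True unfolding hat_def T'_def[symmetric] by (rule if_P)
  also have "\<dots> = (if a \<in> T then bary T a x else 0)"
    using bary_Int[of T' T x a] T' assms by auto
  also have "a \<in> T \<longleftrightarrow> a \<in> verts T"
    using T' vert_in_mesh[of T' T a] assms verts_subset[of T] by blast
  finally show ?thesis .
next
  case False
  then show ?thesis using assms by (auto simp: hat_def)
qed

lemma hat_nonneg: "hat a x \<ge> 0"
proof (cases "\<exists>T\<in>\<T>. x \<in> T")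
  case True
  then obtain T where T: "T \<in> \<T>" "x \<in> T" by blast
  then show ?thesis using hat_eq[OF T] mem_simplex2_iff[OF simplex2[OF T(1)]] by simp
qed (auto simp: hat_def)

lemma hat_le_1: "hat a x \<le> 1"
proof (cases "\<exists>T\<in>\<T>. x \<in> T \<and> a \<in> verts T")
  case True
  then obtain T where T: "T \<in> \<T>" "x \<in> T" "a \<in> verts T" by blast
  have "bary T a x \<le> (\<Sum>b\<in>verts T. bary T b x)"
    using T mem_simplex2_iff[OF simplex2[OF T(1)]] simplex2_verts(3)[OF simplex2[OF T(1)]]
    by (intro member_le_sum) auto
  then show ?thesis using T hat_eq[OF T(1,2)] bary_sum(1)[OF simplex2[OF T(1)]] by simp
qed (auto simp: hat_def)

lemma hat_vert:
  assumes "a \<in> mesh_vertices \<T>" "b \<in> mesh_vertices \<T>"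
  shows "hat a b = (if a = b then 1 else 0)"
proof -
  obtain T where T: "T \<in> \<T>" "b \<in> verts T" using assms(2) unfolding mesh_vertices_eq by blast
  moreover have "b \<in> T" using T verts_subset by blast
  ultimately show ?thesis
    using hat_eq[of T b a] bary_vert[OF simplex2[OF T(1)], of a b] by auto
qed

lemma closed_mesh_cell: "T \<in> \<T> \<Longrightarrow> closed T"
  using simplex2 closed_simplex by blast

lemma continuous_on_mesh:
  fixes w :: "pt \<Rightarrow> 'a::topological_space"
  assumes "\<And>T. T \<in> \<T> \<Longrightarrow> continuous_on T w"
  shows "continuous_on (\<Union>\<T>) w"
  using assms finite_mesh closed_mesh_cell continuous_on_closed_Union[of \<T> "\<lambda>T. T" w] by simp

lemma continuous_on_hat: "continuous_on (\<Union>\<T>) (hat a)"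
proof (rule continuous_on_mesh)
  fix T assume T: "T \<in> \<T>"
  have "continuous_on T (\<lambda>x. if a \<in> verts T then bary T a x else 0)"
    using continuous_on_bary[OF simplex2[OF T], of a T] by (cases "a \<in> verts T") auto
  then show "continuous_on T (hat a)"
    by (rule continuous_on_eq) (use hat_eq T in auto)
qed

lemma hat_midpoint:
  assumes "a \<in> mesh_vertices \<T>" "T \<in> \<T>" "x \<in> verts T" "y \<in> verts T"
  shows "hat a (midpoint x y) = (hat a x + hat a y) / 2"
proof -
  have xy: "x \<in> T" "y \<in> T" using assms(3,4) verts_subset by blast+
  then have "closed_segment x y \<subseteq> T"
    using convex_simplex[OF simplex2[OF assms(2)]] by (simp add: closed_segment_subset)
  then have m: "midpoint x y \<in> T"
    using midpoint_in_closed_segment by blast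
  have "bary T a (midpoint x y) = (bary T a x + bary T a y) / 2" if "a \<in> verts T"
    using bary_comb[OF simplex2[OF assms(2)] that, of "1/2" "1/2" x y]
    by (simp add: midpoint_def scaleR_add_right)
  then show ?thesis
    using hat_eq[OF assms(2) xy(1)] hat_eq[OF assms(2) xy(2)] hat_eq[OF assms(2) m] by simp
qed

end

section \<open>Edges and the boundary of the mesh\<close>

lemma bary_segment:
  assumes "2 simplex T" "a \<in> verts T" "b \<in> verts T" "c \<in> verts T"
  shows "bary T c ((1 - t) *\<^sub>R a + t *\<^sub>R b) = (if c = a then 1 - t else 0) + (if c = b then t else 0)"
  by (subst bary_comb[OF assms(1,4)]) (simp_all add: bary_vert assms)

text \<open>Off the interior some coordinate vanishes, which leaves an affine combination of the
  other two vertices.\<close>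

lemma boundary_point_simplex2:
  assumes T: "2 simplex T" and x: "x \<in> T" "x \<notin> interior T" "x \<notin> verts T"
  obtains a b where "a \<in> verts T" "b \<in> verts T" "a \<noteq> b" "x \<in> open_segment a b"
proof -
  note V = simplex2_verts[OF T]
  obtain c where c: "c \<in> verts T" "\<not> bary T c x > 0"
    using x(2) interior_simplex2_iff[OF T] by blast
  have ge: "bary T v x \<ge> 0" if "v \<in> verts T" for v
    using mem_simplex2_iff[OF T] x(1) that by blast
  have c0: "bary T c x = 0" using c ge[of c] by simp
  have "card (verts T - {c}) = 2" using V(2,3) c by simp
  then obtain a b where ab: "verts T - {c} = {a, b}" "a \<noteq> b"
    by (auto simp: card_2_iff)
  have "verts T = insert c (verts T - {c})" using c(1) by blast
  then have vT: "verts T = {c, a, b}" unfolding ab(1) .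
  have ne: "c \<noteq> a" "c \<noteq> b" using ab(1) by blast+
  define t where "t = bary T b x"
  have s: "bary T a x = 1 - t" "x = (1 - t) *\<^sub>R a + t *\<^sub>R b"
  proof -
    show *: "bary T a x = 1 - t"
      using bary_sum(1)[OF T, of x] ab(2) ne c0 unfolding vT by (simp add: t_def)
    have "bary T a x *\<^sub>R a + bary T b x *\<^sub>R b = x"
      using bary_sum(2)[OF T, of x] ab(2) ne c0 unfolding vT by simp
    then show "x = (1 - t) *\<^sub>R a + t *\<^sub>R b"
      unfolding * t_def[symmetric] by simp
  qed
  have t: "0 \<le> t" "t \<le> 1" using ge[of a] ge[of b] s(1) vT by (auto simp: t_def)
  have "t \<noteq> 0" "t \<noteq> 1" using s(2) x(3) unfolding vT by auto
  then have "0 < t" "t < 1" using t by auto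
  then have "x \<in> open_segment a b"
    unfolding in_segment using s(2) ab(2) by blast
  then show ?thesis by (intro that[of a b]) (simp_all add: vT ab(2))
qed

lemma verts_not_open_segment:
  assumes "v \<in> verts T" "a \<in> T" "b \<in> T"
  shows "v \<notin> open_segment a b"
  using assms by (auto simp: verts_def extreme_point_of_def)

lemma edge_simplex2_iff:
  assumes T: "2 simplex T"
  shows "closed_segment a b edge_of T \<longleftrightarrow> a \<in> verts T \<and> b \<in> verts T \<and> a \<noteq> b"
proof
  assume e: "closed_segment a b edge_of T"
  then have f: "closed_segment a b face_of T" and d: "aff_dim (closed_segment a b) = 1"
    by (auto simp: edge_of_def)
  have "a \<noteq> b" using d by auto
  moreover have "a extreme_point_of closed_segment a b" "b extreme_point_of closed_segment a b"
    by (simp_all add: segment_convex_hull extreme_point_of_convex_hull_2)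
  ultimately show "a \<in> verts T \<and> b \<in> verts T \<and> a \<noteq> b"
    using extreme_point_of_face[OF f, of a] extreme_point_of_face[OF f, of b] by (simp add: verts_def)
next
  assume ab: "a \<in> verts T \<and> b \<in> verts T \<and> a \<noteq> b"
  have "convex hull {a, b} face_of convex hull (verts T)"
    unfolding face_of_convex_hull_affine_independent[OF simplex2_verts(1)[OF T]]
    using ab by (intro exI[of _ "{a, b}"]) simp
  then have "closed_segment a b face_of T"
    by (simp add: segment_convex_hull simplex2_verts(4)[OF T])
  moreover have "aff_dim (closed_segment a b) = 1"
    using ab aff_dim_simplex[OF one_simplex_segment] by blast
  ultimately show "closed_segment a b edge_of T" by (simp add: edge_of_def)
qed

section \<open>Mesh faces that meet the interior of the meshed set\<close>

context mesh
begin

lemma mesh_nodes_iff: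
  "x \<in> mesh_nodes \<T> \<longleftrightarrow> x \<in> mesh_vertices \<T> \<or>
     (\<exists>T\<in>\<T>. \<exists>a\<in>verts T. \<exists>b\<in>verts T. a \<noteq> b \<and> x = midpoint a b)"
proof -
  have "(\<exists>T\<in>\<T>. closed_segment a b edge_of T) \<longleftrightarrow> (\<exists>T\<in>\<T>. a \<in> verts T \<and> b \<in> verts T \<and> a \<noteq> b)" for a b
    using edge_simplex2_iff[OF simplex2, of _ a b] by (rule bex_cong[OF refl])
  then show ?thesis unfolding mesh_nodes_def by blast
qed

text \<open>The homothety \<open>z \<mapsto> x + s (z - x)\<close> with small \<open>s\<close> carries a neighbourhood of \<open>y\<close> into triangles
  that contain \<open>x\<close>, where barycentric coordinates scale affinely.\<close>

lemma interior_face_transfer: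
  assumes T: "T \<in> \<T>" and x: "x \<in> T" "x \<in> interior (\<Union>\<T>)" and y: "y \<in> T"
    and pos: "\<And>a. a \<in> verts T \<Longrightarrow> bary T a x > 0 \<Longrightarrow> bary T a y > 0"
  shows "y \<in> interior (\<Union>\<T>)"
proof -
  note sT = simplex2[OF T]
  \<comment> \<open>Near \<open>x\<close> only triangles containing \<open>x\<close> remain: the
    finitely many others are closed and are removed.\<close>
  define W where "W = interior (\<Union>\<T>) - \<Union>{T'\<in>\<T>. x \<notin> T'}"
  have "open W"
    unfolding W_def using finite_mesh closed_mesh_cell by (intro open_Diff closed_Union) auto
  moreover have "x \<in> W" using x by (auto simp: W_def)
  ultimately obtain r where r: "r > 0" "ball x r \<subseteq> W" by (meson openE)
  define s where "s = min 1 (r / (2 * (norm (y - x) + 1)))"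
  have s: "0 < s" "s \<le> 1" using r by (auto simp: s_def add_nonneg_pos)
  have "s * norm (y - x) \<le> r / (2 * (norm (y - x) + 1)) * norm (y - x)"
    by (intro mult_right_mono) (auto simp: s_def)
  also have "\<dots> = r * (norm (y - x) / (2 * (norm (y - x) + 1)))" by simp
  also have "\<dots> < r * 1"
    using r by (intro mult_strict_left_mono) (auto simp: divide_simps add_nonneg_pos intro: order.strict_trans2[of _ 1])
  finally have sy: "s * norm (y - x) < r" by simp
  define p where "p z = x + s *\<^sub>R (z - x)" for z
  have p: "p z = (1 - s) *\<^sub>R x + s *\<^sub>R z" for z by (simp add: p_def algebra_simps)
  have contp: "continuous_on S p" for S unfolding p_def by (intro continuous_intros)
  define N where "N = p -` ball x r"
  have N: "open N" unfolding N_def using contp by (intro open_vimage) auto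
  have yN: "y \<in> N" using sy s by (simp add: N_def p_def dist_norm)
  have pN: "\<exists>T'\<in>\<T>. p z \<in> T' \<and> x \<in> T'" if "z \<in> N" for z
  proof -
    have "p z \<in> W" using that r by (auto simp: N_def)
    then have "p z \<in> interior (\<Union>\<T>)" by (simp add: W_def)
    then obtain T' where "T' \<in> \<T>" "p z \<in> T'" using interior_subset by blast
    then show ?thesis using \<open>p z \<in> W\<close> by (auto simp: W_def)
  qed
  have conth: "continuous_on N (\<lambda>z. hat a (p z))" for a
    by (rule continuous_on_compose2[OF continuous_on_hat contp]) (use pN in auto)
  define A where "A = {a\<in>verts T. bary T a x > 0}"
  have finA: "finite A" using simplex2_verts(3)[OF sT] by (simp add: A_def)
  \<comment> \<open>As \<open>p\<close> scales coordinates by \<open>s\<close>, the inequality says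
    that the coordinate of \<open>z\<close> itself is positive. It is imposed only for coordinates
    positive at \<open>x\<close>; for the others, \<open>p z\<close> lying in the triangle already
    forces the coordinate of \<open>z\<close> to be nonnegative.\<close>
  define N' where "N' = N \<inter> (\<Inter>a\<in>A. N \<inter> (\<lambda>z. hat a (p z)) -` {(1 - s) * hat a x <..})"
  have "open N'"
    unfolding N'_def using N finA conth by (intro open_Int open_INT) (auto intro: continuous_open_preimage)
  moreover have "y \<in> N'"
  proof -
    have py: "p y \<in> T" unfolding p
      using x(1) y convex_simplex[OF sT] s by (intro convexD) auto
    have "hat a (p y) > (1 - s) * hat a x" if "a \<in> A" for a
    proof -
      have a: "a \<in> verts T" "bary T a x > 0" using that by (auto simp: A_def)
      have "hat a (p y) = (1 - s) * bary T a x + s * bary T a y"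
        using hat_eq[OF T py] a bary_comb[OF sT a(1), of "1 - s" s x y] by (simp add: p)
      moreover have "s * bary T a y > 0" using pos a s by simp
      ultimately show ?thesis using hat_eq[OF T x(1)] a by simp
    qed
    then show ?thesis using yN by (auto simp: N'_def)
  qed
  moreover have "N' \<subseteq> \<Union>\<T>"
  proof
    fix z assume z: "z \<in> N'"
    then obtain T' where T': "T' \<in> \<T>" "p z \<in> T'" "x \<in> T'" using pN by (auto simp: N'_def)
    have "bary T' b z \<ge> 0" if b: "b \<in> verts T'" for b
    proof -
      have eq: "bary T' b (p z) = (1 - s) * bary T' b x + s * bary T' b z"
        using bary_comb[OF simplex2[OF T'(1)] b, of "1 - s" s x z] by (simp add: p)
      have h: "hat b x = bary T' b x" "hat b (p z) = bary T' b (p z)"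
        using hat_eq[OF T'(1)] T' b by auto
      have "s * bary T' b z \<ge> 0"
      proof (cases "b \<in> A")
        case True
        then have "hat b (p z) > (1 - s) * hat b x" using z unfolding N'_def by blast
        then show ?thesis using eq h by simp
      next
        case False
        have "hat b x = 0"
          using False hat_eq[OF T x(1), of b] mem_simplex2_iff[OF sT] x(1)
          by (auto simp: A_def not_less intro: antisym)
        moreover have "bary T' b (p z) \<ge> 0"
          using mem_simplex2_iff[OF simplex2[OF T'(1)]] T' b by blast
        ultimately show ?thesis using eq h by simp
      qed
      then show ?thesis using s by (simp add: zero_le_mult_iff)
    qed
    then show "z \<in> \<Union>\<T>" using mem_simplex2_iff[OF simplex2[OF T'(1)]] T' by blast
  qed
  ultimately show ?thesis by (meson interiorI)
qed

end

section \<open>Mesh edges on the frontier of the domain\<close>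

locale meshed_domain = mesh +
  fixes \<Omega> :: "pt set"
  assumes open_dom: "open \<Omega>" and bounded_dom: "bounded \<Omega>" and connected_dom: "connected \<Omega>"
    and interior_closure_dom: "interior (closure \<Omega>) = \<Omega>"
    and Union_mesh: "\<Union>\<T> = closure \<Omega>"
begin

lemma frontier_dom: "frontier \<Omega> = closure \<Omega> - \<Omega>"
  using open_dom by (simp add: frontier_def interior_open)

lemma cell_subset: "T \<in> \<T> \<Longrightarrow> T \<subseteq> closure \<Omega>"
  using Union_mesh by blast

lemma interior_cell_subset: "T \<in> \<T> \<Longrightarrow> interior T \<subseteq> \<Omega>"
  using interior_mono[OF cell_subset] interior_closure_dom by blast

text \<open>At a vertex the only positive coordinate is its own, so
  \<open>interior_face_transfer\<close> carries interiority from \<open>a\<close> to the whole open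
  star of \<open>a\<close>.\<close>

lemma hat_pos_interior:
  assumes a: "a \<in> mesh_vertices \<T>" "a \<in> \<Omega>" and x: "hat a x > 0" "x \<in> closure \<Omega>"
  shows "x \<in> \<Omega>"
proof -
  obtain T where T: "T \<in> \<T>" "x \<in> T" using x Union_mesh by blast
  then have aT: "a \<in> verts T" and p: "bary T a x > 0" using hat_eq[of T x a] x by (auto split: if_splits)
  have "x \<in> interior (\<Union>\<T>)"
  proof (rule interior_face_transfer[OF T(1) _ _ T(2), of a])
    show "a \<in> T" using aT verts_subset by blast
    show "a \<in> interior (\<Union>\<T>)" using a interior_closure_dom Union_mesh by simp
    show "bary T b x > 0" if "b \<in> verts T" "bary T b a > 0" for b
      using that p bary_vert[OF simplex2[OF T(1)] that(1) aT] by (auto split: if_splits)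
  qed
  then show ?thesis using interior_closure_dom Union_mesh by simp
qed

text \<open>All points of an open edge have the same positive coordinates, so one interior point
  makes the others interior.\<close>

lemma open_edge_interior:
  assumes T: "T \<in> \<T>" and ab: "a \<in> verts T" "b \<in> verts T" "a \<noteq> b"
    and x: "x \<in> open_segment a b" "x \<in> \<Omega>" and y: "y \<in> open_segment a b"
  shows "y \<in> \<Omega>"
proof -
  have "closed_segment a b \<subseteq> T"
    using ab verts_subset convex_simplex[OF simplex2[OF T]] by (meson closed_segment_subset subsetD)
  then have xy: "x \<in> T" "y \<in> T" using x y open_closed_segment by blast+
  obtain u where u: "0 < u" "u < 1" "y = (1 - u) *\<^sub>R a + u *\<^sub>R b"
    using y unfolding in_segment by blast
  obtain w where w: "0 < w" "w < 1" "x = (1 - w) *\<^sub>R a + w *\<^sub>R b"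
    using x unfolding in_segment by blast
  have "y \<in> interior (\<Union>\<T>)"
  proof (rule interior_face_transfer[OF T xy(1) _ xy(2)])
    show "x \<in> interior (\<Union>\<T>)" using x interior_closure_dom Union_mesh by simp
    show "bary T c y > 0" if "c \<in> verts T" "bary T c x > 0" for c
      using that bary_segment[OF simplex2[OF T] ab(1,2) that(1)] u w ab(3) by (auto split: if_splits)
  qed
  then show ?thesis using interior_closure_dom Union_mesh by simp
qed

text \<open>The interior of a triangle lies in \<Omega>, so a frontier point that is no vertex sits
  on an open edge; by \<open>open_edge_interior\<close> it keeps that whole edge out of
  \<Omega>.\<close>

lemma frontier_edge:
  assumes x: "x \<in> frontier \<Omega>" "x \<notin> mesh_vertices \<T>"
  obtains T a b where "T \<in> \<T>" "a \<in> verts T" "b \<in> verts T" "a \<noteq> b" "x \<in> open_segment a b"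
    "open_segment a b \<subseteq> frontier \<Omega>"
proof -
  obtain T where T: "T \<in> \<T>" "x \<in> T" using x frontier_dom Union_mesh by blast
  have "x \<notin> interior T" using interior_cell_subset[OF T(1)] x frontier_dom by blast
  moreover have "x \<notin> verts T" using x T mesh_vertices_eq by blast
  ultimately obtain a b where ab: "a \<in> verts T" "b \<in> verts T" "a \<noteq> b" "x \<in> open_segment a b"
    using boundary_point_simplex2[OF simplex2[OF T(1)] T(2)] by blast
  have "closed_segment a b \<subseteq> T"
    using ab verts_subset convex_simplex[OF simplex2[OF T(1)]] by (meson closed_segment_subset subsetD)
  then have "open_segment a b \<subseteq> closure \<Omega>" using cell_subset[OF T(1)] open_closed_segment by blast
  moreover have "y \<notin> \<Omega>" if "y \<in> open_segment a b" for y
    using open_edge_interior[OF T(1) ab(1-3) that _ ab(4)] x frontier_dom by blast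
  ultimately have "open_segment a b \<subseteq> frontier \<Omega>" using frontier_dom by blast
  then show ?thesis using that[OF T(1) ab] by blast
qed

lemma mesh_vertex_not_open_edge:
  assumes "T \<in> \<T>" "a \<in> verts T" "b \<in> verts T" "v \<in> mesh_vertices \<T>"
  shows "v \<notin> open_segment a b"
proof
  assume v: "v \<in> open_segment a b"
  have ab: "a \<in> T" "b \<in> T" using assms verts_subset by blast+
  then have "closed_segment a b \<subseteq> T"
    using convex_simplex[OF simplex2[OF assms(1)]] by (simp add: closed_segment_subset)
  then have "v \<in> T" using v open_closed_segment by blast
  then have "v \<in> verts T" using mesh_vertex_in assms by blast
  then show False using verts_not_open_segment ab v by blast
qed

end

lemma line_param_open_segment:
  fixes P Q :: "'a::real_normed_vector"
  assumes "P \<noteq> Q" "a < b"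
  shows "(1 - u) *\<^sub>R P + u *\<^sub>R Q \<in> open_segment ((1 - a) *\<^sub>R P + a *\<^sub>R Q) ((1 - b) *\<^sub>R P + b *\<^sub>R Q)
    \<longleftrightarrow> a < u \<and> u < b"
proof -
  define \<gamma> where "\<gamma> u = (1 - u) *\<^sub>R P + u *\<^sub>R Q" for u
  have inj: "\<gamma> u = \<gamma> v \<longleftrightarrow> u = v" for u v
  proof -
    have "\<gamma> u - \<gamma> v = (u - v) *\<^sub>R (Q - P)" by (simp add: \<gamma>_def algebra_simps)
    then have "\<gamma> u = \<gamma> v \<longleftrightarrow> (u - v) *\<^sub>R (Q - P) = 0" by (metis eq_iff_diff_eq_0)
    then show ?thesis using assms by auto
  qed
  have comb: "(1 - t) *\<^sub>R \<gamma> a + t *\<^sub>R \<gamma> b = \<gamma> (a + t * (b - a))" for t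
    by (simp add: \<gamma>_def algebra_simps)
  have "\<gamma> u \<in> open_segment (\<gamma> a) (\<gamma> b) \<longleftrightarrow> (\<exists>t>0. t < 1 \<and> u = a + t * (b - a))"
    unfolding in_segment comb inj using assms by auto
  also have "\<dots> \<longleftrightarrow> a < u \<and> u < b"
  proof
    assume "\<exists>t>0. t < 1 \<and> u = a + t * (b - a)"
    then obtain t where t: "0 < t" "t < 1" "u = a + t * (b - a)" by blast
    have "t * (b - a) < b - a" "0 < t * (b - a)"
      using mult_strict_right_mono[of t 1 "b - a"] t assms by simp_all
    then have "u - a < b - a" "0 < u - a" using t(3) by simp_all
    then show "a < u \<and> u < b" by simp
  next
    assume "a < u \<and> u < b"
    then show "\<exists>t>0. t < 1 \<and> u = a + t * (b - a)"
      using assms by (intro exI[of _ "(u - a) / (b - a)"]) (auto simp: field_simps)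
  qed
  finally show ?thesis by (simp add: \<gamma>_def)
qed

section \<open>One mesh of the family: the nodes on the side and their triangles\<close>

locale fem =
  fixes \<Omega> \<Gamma>0 \<Gamma>1 :: "pt set" and SS :: "pt set set" and n :: pt
    and \<nu> K K' h :: real and g :: sfield and \<T> :: "pt set set" and m :: nat and M :: "nat \<Rightarrow> pt"
  assumes polygon: "polygonal_domain \<Omega> SS"
    and frontier_Un: "frontier \<Omega> = closure \<Gamma>0 \<union> closure \<Gamma>1" and disjoint_parts: "\<Gamma>0 \<inter> \<Gamma>1 = {}"
    and openin_\<Gamma>0: "openin (top_of_set (frontier \<Omega>)) \<Gamma>0"
    and side: "closure \<Gamma>1 \<in> SS"
    and normal: "outer_unit_normal \<Omega> \<Gamma>1 n"
    and \<nu>_pos: "\<nu> > 0"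
    and g_cont: "continuous_on (closure \<Gamma>1) g" and g_pos: "\<And>x. x \<in> \<Gamma>1 \<Longrightarrow> g x > 0"
    and K_pos: "K > 0" "K' > 0"
    and admissible: "admissible_mesh \<Omega> K K' h \<T>"
    and enum: "boundary_enumeration \<Gamma>1 \<T> m M"

sublocale fem \<subseteq> meshed_domain \<T> \<Omega>
proof
  show "triangulation \<T>" "\<And>T. T \<in> \<T> \<Longrightarrow> 2 simplex T" "\<Union>\<T> = closure \<Omega>"
    using admissible by (auto simp: admissible_mesh_def)
  show "open \<Omega>" "bounded \<Omega>" "connected \<Omega>" "interior (closure \<Omega>) = \<Omega>"
    using polygon by (auto simp: polygonal_domain_def)
qed

context fem
begin

lemma M_in: "i \<in> {1..m+1} \<Longrightarrow> M i \<in> mesh_vertices \<T> \<and> M i \<in> closure \<Gamma>1"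
  using enum unfolding boundary_enumeration_def by blast

lemma side_eq: "closure \<Gamma>1 = closed_segment (M 1) (M (m+1))"
  using enum unfolding boundary_enumeration_def by blast

lemma side_simplex: "s \<in> SS \<Longrightarrow> 1 simplex s"
  using polygon by (simp add: polygonal_domain_def)

lemma side_subset: "closure \<Gamma>1 \<subseteq> frontier \<Omega>"
  using frontier_Un by blast

lemma side_ends: "M 1 \<noteq> M (m+1)"
proof
  assume "M 1 = M (m+1)"
  then have "1 simplex {M 1}"
    using side_simplex[OF side] side_eq by simp
  then show False by simp
qed

lemma m_pos: "m \<ge> 1"
  using side_ends by (cases m) auto

definition pos :: "nat \<Rightarrow> real" where
  "pos i = dist (M 1) (M i) / dist (M 1) (M (m+1))"

lemma M_eq: 
  assumes "i \<in> {1..m+1}"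
  shows "M i = (1 - pos i) *\<^sub>R M 1 + pos i *\<^sub>R M (m+1)"
proof -
  obtain u where u: "0 \<le> u" "M i = (1 - u) *\<^sub>R M 1 + u *\<^sub>R M (m+1)"
    using M_in[OF assms] unfolding side_eq in_segment by blast
  have "M 1 - M i = u *\<^sub>R (M 1 - M (m+1))" unfolding u(2) by (simp add: algebra_simps)
  then have "dist (M 1) (M i) = u * dist (M 1) (M (m+1))"
    using u(1) by (simp add: dist_norm)
  then have "pos i = u" using side_ends by (simp add: pos_def)
  then show ?thesis using u by simp
qed

lemma pos_less: "i \<in> {1..m+1} \<Longrightarrow> j \<in> {1..m+1} \<Longrightarrow> i < j \<Longrightarrow> pos i < pos j"
  unfolding pos_def using enum side_ends unfolding boundary_enumeration_def
  by (intro divide_strict_right_mono) (blast, simp)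

lemma pos_less_iff: "i \<in> {1..m+1} \<Longrightarrow> j \<in> {1..m+1} \<Longrightarrow> pos i < pos j \<longleftrightarrow> i < j"
  using pos_less[of i j] pos_less[of j i] by (cases i j rule: linorder_cases) auto

lemma open_segment_M:
  assumes "i \<in> {1..m+1}" "j \<in> {1..m+1}" "i < j"
  shows "(1 - u) *\<^sub>R M 1 + u *\<^sub>R M (m+1) \<in> open_segment (M i) (M j) \<longleftrightarrow> pos i < u \<and> u < pos j"
  unfolding line_param_open_segment[OF side_ends pos_less[OF assms], of u, symmetric]
  by (simp only: M_eq[OF assms(1), symmetric] M_eq[OF assms(2), symmetric])

lemma M_inj: "i \<in> {1..m+1} \<Longrightarrow> j \<in> {1..m+1} \<Longrightarrow> M i = M j \<longleftrightarrow> i = j"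
proof -
  assume ij: "i \<in> {1..m+1}" "j \<in> {1..m+1}"
  have "i = j" if "M i = M j"
  proof (rule ccontr)
    assume "i \<noteq> j"
    then have "pos i \<noteq> pos j" using pos_less_iff[OF ij] pos_less_iff[OF ij(2,1)] by linarith
    then show False using that by (simp add: pos_def)
  qed
  then show ?thesis by blast
qed

lemma M_between:
  assumes "i \<in> {1..m+1}" "j \<in> {1..m+1}" "k \<in> {1..m+1}" "i < j"
  shows "M k \<in> open_segment (M i) (M j) \<longleftrightarrow> i < k \<and> k < j"
  unfolding pos_less_iff[OF assms(1,3), symmetric] pos_less_iff[OF assms(3,2), symmetric]
    open_segment_M[OF assms(1,2,4), symmetric]
  by (simp only: M_eq[OF assms(3), symmetric])

lemma mesh_vertex_on_side:
  assumes "a \<in> mesh_vertices \<T>" "a \<in> closure \<Gamma>1"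
  obtains i where "i \<in> {1..m+1}" "a = M i"
  using enum assms unfolding boundary_enumeration_def by (metis IntI imageE)

text \<open>Near a point of the open side the frontier consists of that side only, so a point of \<open>\<Gamma>0\<close>
  there would be a limit of points of \<open>\<Gamma>1\<close>.\<close>

lemma closure_parts_Int: "closure \<Gamma>0 \<inter> closure \<Gamma>1 \<subseteq> {M 1, M (m+1)}"
proof (rule subsetI, rule ccontr)
  fix y assume y: "y \<in> closure \<Gamma>0 \<inter> closure \<Gamma>1" "y \<notin> {M 1, M (m+1)}"
  have SS: "triangulation SS" "frontier \<Omega> = \<Union>SS"
    using polygon by (simp_all add: polygonal_domain_def)
  have yt: "y \<notin> t" if t: "t \<in> SS" "t \<noteq> closure \<Gamma>1" for t
  proof
    assume "y \<in> t"
    define F where "F = closure \<Gamma>1 \<inter> t"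
    have F: "F face_of closure \<Gamma>1" "F face_of t"
      using SS(1) side t unfolding triangulation_def F_def by (blast, metis Int_commute)
    \<comment> \<open>The faces of a segment are the empty set, its ends and itself; the last case
      would make the side a proper face of \<open>t\<close>, which has the same dimension.\<close>
    have "F \<subseteq> {M 1, M (m+1)} \<or> F = closure \<Gamma>1"
    proof -
      have "F face_of convex hull {M 1, M (m+1)}"
        using F(1) by (simp add: side_eq segment_convex_hull)
      then obtain c where c: "c \<subseteq> {M 1, M (m+1)}" "F = convex hull c"
        using face_of_convex_hull_affine_independent[OF affine_independent_2] by blast
      then have "c = {} \<or> c = {M 1} \<or> c = {M (m+1)} \<or> c = {M 1, M (m+1)}" by blast
      then show ?thesis using c(2) by (auto simp: side_eq segment_convex_hull)
    qed
    moreover have "y \<in> F" using y \<open>y \<in> t\<close> by (auto simp: F_def)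
    ultimately have "F = closure \<Gamma>1" using y by blast
    then have "F \<noteq> t" using t by blast
    then have "aff_dim F < aff_dim t"
      using face_of_aff_dim_lt[OF convex_simplex[OF side_simplex[OF t(1)]] F(2)] by blast
    then show False
      using aff_dim_simplex[OF side_simplex[OF t(1)]] aff_dim_simplex[OF side_simplex[OF side]] \<open>F = closure \<Gamma>1\<close>
      by simp
  qed
  define W where "W = - \<Union>(SS - {closure \<Gamma>1})"
  have "open W"
    unfolding W_def using SS(1) closed_simplex[OF side_simplex] unfolding triangulation_def
    by (intro open_Compl closed_Union) (simp, blast)
  moreover have "y \<in> W" using yt by (auto simp: W_def)
  ultimately obtain z where z: "z \<in> \<Gamma>0" "z \<in> W"
    using y closure_iff_nhds_not_empty[of y \<Gamma>0] by blast
  have fr0: "\<Gamma>0 \<subseteq> frontier \<Omega>" using openin_imp_subset[OF openin_\<Gamma>0] .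
  then have "z \<in> closure \<Gamma>1" using z SS(2) by (auto simp: W_def)
  obtain U where U: "open U" "\<Gamma>0 = frontier \<Omega> \<inter> U"
    using openin_\<Gamma>0 by (auto simp: openin_open)
  then obtain x where "x \<in> \<Gamma>1" "x \<in> U"
    using z \<open>z \<in> closure \<Gamma>1\<close> closure_iff_nhds_not_empty[of z \<Gamma>1] by blast
  then show False using U side_subset disjoint_parts closure_subset[of \<Gamma>1] by blast
qed

text \<open>The ends of the side are mesh vertices, so the open edge avoids the only points that the
  two closures can share, and a connected set then lies in one of them.\<close>

lemma frontier_open_edge:
  assumes T: "T \<in> \<T>" "a \<in> verts T" "b \<in> verts T" and e: "open_segment a b \<subseteq> frontier \<Omega>"
  shows "open_segment a b \<subseteq> closure \<Gamma>0 \<or> open_segment a b \<subseteq> closure \<Gamma>1"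
proof -
  have "M 1 \<notin> open_segment a b" "M (m+1) \<notin> open_segment a b"
    using M_in[of 1] M_in[of "m+1"] mesh_vertex_not_open_edge[OF T] by auto
  then have "closure \<Gamma>0 \<inter> closure \<Gamma>1 \<inter> open_segment a b = {}" using closure_parts_Int by blast
  moreover have "open_segment a b \<subseteq> closure \<Gamma>0 \<union> closure \<Gamma>1" using e frontier_Un by simp
  ultimately show ?thesis
    using connected_closedD[OF convex_connected[OF convex_open_segment[of a b]], of "closure \<Gamma>0" "closure \<Gamma>1"] by auto
qed

lemma frontier_cases:
  assumes x: "x \<in> frontier \<Omega>" "x \<notin> mesh_vertices \<T>"
  obtains T a b where "T \<in> \<T>" "a \<in> verts T" "b \<in> verts T" "a \<noteq> b" "x \<in> open_segment a b"
    "closed_segment a b \<subseteq> (if x \<in> closure \<Gamma>1 then closure \<Gamma>1 else closure \<Gamma>0)"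
proof -
  obtain T a b where T: "T \<in> \<T>" "a \<in> verts T" "b \<in> verts T" "a \<noteq> b" "x \<in> open_segment a b"
    "open_segment a b \<subseteq> frontier \<Omega>"
    using frontier_edge[OF x] by blast
  have ne: "x \<noteq> M 1" "x \<noteq> M (m+1)" using x M_in[of 1] M_in[of "m+1"] by auto
  have cl: "closed_segment a b \<subseteq> closure A" if "open_segment a b \<subseteq> closure A" for A
    using closure_minimal[OF that closed_closure] T(4) by (simp add: closure_open_segment)
  have "closed_segment a b \<subseteq> (if x \<in> closure \<Gamma>1 then closure \<Gamma>1 else closure \<Gamma>0)"
    using frontier_open_edge[OF T(1-3,6)] cl[of \<Gamma>0] cl[of \<Gamma>1] T(5) ne closure_parts_Int
    by (cases "x \<in> closure \<Gamma>1") (simp, blast, simp, blast)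
  then show ?thesis using that T by blast
qed

abbreviation "cmid i \<equiv> midpoint (M i) (M (i+1))"

lemma cmid:
  assumes i: "i \<in> {1..m}"
  shows "cmid i \<in> closure \<Gamma>1" "cmid i \<notin> mesh_vertices \<T>" "cmid i \<notin> closure \<Gamma>0"
    "cmid i = (1 - (pos i + pos (i+1)) / 2) *\<^sub>R M 1 + ((pos i + pos (i+1)) / 2) *\<^sub>R M (m+1)"
proof -
  have i': "i \<in> {1..m+1}" "i+1 \<in> {1..m+1}" using i by auto
  show *: "cmid i = (1 - (pos i + pos (i+1)) / 2) *\<^sub>R M 1 + ((pos i + pos (i+1)) / 2) *\<^sub>R M (m+1)"
    unfolding midpoint_def M_eq[OF i'(1)] M_eq[OF i'(2)]
    by (simp add: vec_eq_iff field_simps)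
  show cS: "cmid i \<in> closure \<Gamma>1"
    using M_in[OF i'(1)] M_in[OF i'(2)] unfolding side_eq
    by (meson closed_segment_subset convex_closed_segment midpoint_in_closed_segment subsetD)
  show nv: "cmid i \<notin> mesh_vertices \<T>"
  proof
    assume "cmid i \<in> mesh_vertices \<T>"
    then obtain j where j: "j \<in> {1..m+1}" "cmid i = M j" using mesh_vertex_on_side cS by blast
    have "M i \<noteq> M (i+1)" using M_inj[OF i'] by simp
    then have "M j \<in> open_segment (M i) (M (i+1))"
      unfolding j(2)[symmetric] by simp
    then show False using M_between[OF i' j(1)] by auto
  qed
  show "cmid i \<notin> closure \<Gamma>0"
  proof
    assume "cmid i \<in> closure \<Gamma>0"
    then have "cmid i = M 1 \<or> cmid i = M (m+1)" using cS closure_parts_Int by blast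
    then show False using nv M_in[of 1] M_in[of "m+1"] by auto
  qed
qed

lemma M_not_closure_\<Gamma>0:
  assumes "i \<in> {2..m}" shows "M i \<notin> closure \<Gamma>0"
  using closure_parts_Int M_in[of i] M_inj[of i 1] M_inj[of i "m+1"] assms by auto

text \<open>The midpoint is no mesh vertex, so it lies in an open mesh edge on the side, with ends
  \<open>M j\<close> and \<open>M k\<close>. No mesh vertex lies inside a mesh edge, which leaves
  \<open>{j, k} = {i, i+1}\<close>.\<close>

lemma boundary_triangle:
  assumes i: "i \<in> {1..m}"
  shows "\<exists>T\<in>\<T>. M i \<in> verts T \<and> M (i+1) \<in> verts T"
proof -
  have i': "i \<in> {1..m+1}" "i+1 \<in> {1..m+1}" using i by auto
  note c = cmid[OF i]
  obtain T a b where T: "T \<in> \<T>" "a \<in> verts T" "b \<in> verts T" "a \<noteq> b" "cmid i \<in> open_segment a b"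
    "closed_segment a b \<subseteq> closure \<Gamma>1"
  proof -
    have "cmid i \<in> frontier \<Omega>" using c(1) side_subset by blast
    then obtain T a b where T: "T \<in> \<T>" "a \<in> verts T" "b \<in> verts T" "a \<noteq> b" "cmid i \<in> open_segment a b"
      "closed_segment a b \<subseteq> (if cmid i \<in> closure \<Gamma>1 then closure \<Gamma>1 else closure \<Gamma>0)"
      using c(2) by (rule frontier_cases)
    then show thesis using that[of T a b] c(1) by simp
  qed
  have "a \<in> mesh_vertices \<T>" "b \<in> mesh_vertices \<T>" using T mesh_vertices_eq by blast+
  moreover have "a \<in> closure \<Gamma>1" "b \<in> closure \<Gamma>1" using T(6) by auto
  ultimately obtain j k where jk: "j \<in> {1..m+1}" "a = M j" "k \<in> {1..m+1}" "b = M k"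
    by (metis mesh_vertex_on_side)
  have key: "{i, i+1} = {j, k}" if jk: "j \<in> {1..m+1}" "k \<in> {1..m+1}" "j < k"
      and v: "M j \<in> verts T" "M k \<in> verts T" and cm: "cmid i \<in> open_segment (M j) (M k)" for j k
  proof -
    have p: "pos j < (pos i + pos (i+1)) / 2" "(pos i + pos (i+1)) / 2 < pos k"
      using cm c(4) open_segment_M[OF jk] by auto
    have "\<not> (j < i \<and> i < k)" "\<not> (j < i + 1 \<and> i + 1 < k)"
      using M_between[OF jk(1,2) i'(1) jk(3)] M_between[OF jk(1,2) i'(2) jk(3)]
        mesh_vertex_not_open_edge[OF T(1) v] M_in[OF i'(1)] M_in[OF i'(2)] by auto
    moreover have "pos i < pos (i+1)" using pos_less[OF i'] by simp
    then have "pos i < (pos i + pos (i+1)) / 2" "(pos i + pos (i+1)) / 2 < pos (i+1)" by simp_all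
    then have "pos i < pos k" "pos j < pos (i+1)" using p by (auto intro: order.strict_trans)
    ultimately show ?thesis
    proof -
      have "i < k" "j < i + 1"
        using \<open>pos i < pos k\<close> \<open>pos j < pos (i+1)\<close> pos_less_iff[OF i'(1) jk(2)] pos_less_iff[OF jk(1) i'(2)]
        by blast+
      then have "i = j" "k = i + 1"
        using \<open>\<not> (j < i \<and> i < k)\<close> \<open>\<not> (j < i + 1 \<and> i + 1 < k)\<close> by linarith+
      then show ?thesis by simp
    qed
  qed
  have v: "M j \<in> verts T" "M k \<in> verts T" using T(2,3) jk(2,4) by simp_all
  have cm: "cmid i \<in> open_segment (M j) (M k)" using T(5) unfolding jk(2,4) .
  have "j \<noteq> k" using T(4) jk(2,4) by blast
  then consider "j < k" | "k < j" by linarith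
  then have eq: "{i, i+1} = {j, k}"
  proof cases
    case 1
    show ?thesis by (rule key[OF jk(1,3) 1 v cm])
  next
    case 2
    have "{i, i+1} = {k, j}"
      by (rule key[OF jk(3,1) 2 v(2,1)]) (use cm in \<open>simp add: open_segment_commute\<close>)
    then show ?thesis by blast
  qed
  have "i \<in> {j, k}" "i+1 \<in> {j, k}" unfolding eq[symmetric] by simp_all
  then have "M i \<in> verts T" "M (i+1) \<in> verts T" using v by auto
  then show ?thesis using T(1) by blast
qed

text \<open>For \<open>i < j\<close> the vertex \<open>M (i+1)\<close> would lie strictly between
  two points of \<open>T\<close>, against being extreme. Distinct boundary edges thus have distinct
  triangles, and integrals over these may be added up.\<close>

lemma boundary_triangle_unique:
  assumes i: "i \<in> {1..m}" "j \<in> {1..m}" and T: "T \<in> \<T>"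
    and v: "M i \<in> verts T" "M (i+1) \<in> verts T" "M j \<in> verts T" "M (j+1) \<in> verts T"
  shows "i = j"
proof -
  have *: False if "i < j" "i \<in> {1..m}" "j \<in> {1..m}" "M i \<in> verts T" "M (i+1) \<in> verts T" "M (j+1) \<in> verts T" for i j
  proof -
    have "M (i+1) \<in> open_segment (M i) (M (j+1))"
      using M_between[of i "j+1" "i+1"] that by auto
    then show False using verts_not_open_segment that verts_subset by blast
  qed
  show ?thesis using *[of i j] *[of j i] assms by (cases i j rule: linorder_cases) auto
qed

definition btri :: "nat \<Rightarrow> pt set" where
  "btri i = (SOME T. T \<in> \<T> \<and> M i \<in> verts T \<and> M (i+1) \<in> verts T)"

lemma btri: "i \<in> {1..m} \<Longrightarrow> btri i \<in> \<T> \<and> M i \<in> verts (btri i) \<and> M (i+1) \<in> verts (btri i)"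
  unfolding btri_def by (rule someI_ex) (use boundary_triangle in blast)

lemma inj_on_btri: "inj_on btri {1..m}"
  by (rule inj_onI) (metis btri boundary_triangle_unique)

lemma normal_orth: "x \<in> closure \<Gamma>1 \<Longrightarrow> y \<in> closure \<Gamma>1 \<Longrightarrow> n \<bullet> (y - x) = 0"
proof -
  have 1: "n \<bullet> (y - x) = 0" if "x \<in> \<Gamma>1" "y \<in> closure \<Gamma>1" for x y
    by (rule continuous_constant_on_closure[of "\<Gamma>1" "\<lambda>y. n \<bullet> (y - x)" 0 y])
      (use that normal in \<open>auto simp: outer_unit_normal_def intro!: continuous_intros\<close>)
  assume "x \<in> closure \<Gamma>1" "y \<in> closure \<Gamma>1"
  then show ?thesis
    by (intro continuous_constant_on_closure[of "\<Gamma>1" "\<lambda>x. n \<bullet> (y - x)" 0 x])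
      (use 1 in \<open>auto intro!: continuous_intros\<close>)
qed

lemma g_nonneg: "x \<in> closure \<Gamma>1 \<Longrightarrow> g x \<ge> 0"
  by (rule continuous_ge_on_closure[OF g_cont]) (use g_pos less_imp_le in blast)+

end

section \<open>Integrals of directional derivatives\<close>

lemma integral_lebesgue_translate:
  fixes F :: "'a::euclidean_space \<Rightarrow> real"
  assumes "F \<in> borel_measurable borel"
  shows "integral\<^sup>L lebesgue (\<lambda>x. F (c + x)) = integral\<^sup>L lebesgue F"
proof -
  have "integral\<^sup>L lborel F = integral\<^sup>L (distr lborel borel ((+) c)) F"
    by (simp add: lborel_distr_plus)
  also have "\<dots> = integral\<^sup>L lborel (\<lambda>x. F (c + x))"
    using assms by (intro integral_distr) auto
  finally show ?thesis
    using assms by (simp add: integral_completion)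
qed

text \<open>The difference quotients have integral 0 by translation invariance and converge boundedly.\<close>

lemma integral_directional_derivative_eq_0:
  fixes F G :: "'a::euclidean_space \<Rightarrow> real"
  assumes lip: "C-lipschitz_on UNIV F" and supp: "\<And>x. x \<notin> cball 0 R \<Longrightarrow> F x = 0"
    and N: "negligible N" and G: "G \<in> borel_measurable lebesgue"
    and deriv: "\<And>x. x \<notin> N \<Longrightarrow> ((\<lambda>t. F (x + t *\<^sub>R d)) has_real_derivative G x) (at 0)"
  shows "integral\<^sup>L lebesgue G = 0"
proof -
  define e where "e k = 1 / real (Suc k)" for k
  have e: "0 < e k" "e k \<le> 1" for k by (auto simp: e_def)
  have e_lim: "e \<longlonglongrightarrow> 0" unfolding e_def by (rule LIMSEQ_Suc[OF lim_1_over_n])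
  define s where "s k x = (F (x + e k *\<^sub>R d) - F x) / e k" for k x
  have contF: "continuous_on UNIV F" using lip by (rule lipschitz_on_continuous_on)
  then have Fm: "F \<in> borel_measurable borel" by (rule borel_measurable_continuous_onI)
  have "integrable lborel (\<lambda>x. indicator (cball 0 R) x *\<^sub>R F x)"
    by (rule borel_integrable_compact) (auto intro: continuous_on_subset[OF contF])
  moreover have "(\<lambda>x. indicator (cball 0 R) x *\<^sub>R F x) = F"
    using supp by (auto simp: indicator_def fun_eq_iff)
  ultimately have "integrable lborel F" by simp
  then have Fi: "integrable lebesgue F" using Fm by (simp add: integrable_completion)
  have Fi': "integrable lebesgue (\<lambda>x. F (x + c))" for c
  proof -
    have "integrable (distr lborel borel ((+) c)) F"
      using \<open>integrable lborel F\<close> by (simp add: lborel_distr_plus)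
    then have "integrable lborel (\<lambda>x. F (c + x))"
      using Fm by (subst (asm) integrable_distr_eq) auto
    then show ?thesis using Fm by (simp add: integrable_completion add.commute)
  qed
  have s0: "integral\<^sup>L lebesgue (s k) = 0" for k
    unfolding s_def using Fi Fi'[of "e k *\<^sub>R d"] integral_lebesgue_translate[OF Fm, of "e k *\<^sub>R d"]
    by (simp add: add.commute)
  have "(\<lambda>k. integral\<^sup>L lebesgue (s k)) \<longlonglongrightarrow> integral\<^sup>L lebesgue G"
  \<comment> \<open>Majorant: the Lipschitz constant bounds the quotients, and increments of length
    at most \<open>norm d\<close> keep their support in the ball enlarged by
    \<open>norm d\<close>.\<close>
  proof (rule integral_dominated_convergence[where w="\<lambda>x. indicator (cball 0 (R + norm d)) x *\<^sub>R (C * norm d)"])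
    show "G \<in> borel_measurable lebesgue" by fact
    show "s k \<in> borel_measurable lebesgue" for k
      unfolding s_def using Fi Fi'[of "e k *\<^sub>R d"] by (intro borel_measurable_divide borel_measurable_diff) auto
    have "integrable lborel (\<lambda>x. indicator (cball (0::'a) (R + norm d)) x *\<^sub>R (C * norm d))"
      by (rule borel_integrable_compact) auto
    then show "integrable lebesgue (\<lambda>x. indicator (cball (0::'a) (R + norm d)) x *\<^sub>R (C * norm d))"
      by (subst integrable_completion) auto
    have "AE x in lebesgue. x \<notin> N"
      using N by (simp add: negligible_iff_null_sets AE_not_in)
    then show "AE x in lebesgue. (\<lambda>k. s k x) \<longlonglongrightarrow> G x"
    proof (rule AE_mp, intro AE_I2 impI)
      fix x assume "x \<notin> N"
      then have "((\<lambda>t. (F (x + t *\<^sub>R d) - F x) / t) \<longlongrightarrow> G x) (at 0)"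
        using deriv by (simp add: has_field_derivative_iff)
      moreover have "filterlim e (at 0) sequentially"
        using e_lim e by (intro filterlim_atI) (auto simp: less_imp_neq[symmetric])
      ultimately show "(\<lambda>k. s k x) \<longlonglongrightarrow> G x"
        unfolding s_def by (rule filterlim_compose)
    qed
    show "AE x in lebesgue. norm (s k x) \<le> indicator (cball 0 (R + norm d)) x *\<^sub>R (C * norm d)" for k
    proof (intro AE_I2)
      fix x
      show "norm (s k x) \<le> indicator (cball 0 (R + norm d)) x *\<^sub>R (C * norm d)"
      proof (cases "x \<in> cball 0 (R + norm d)")
        case True
        have "dist (F (x + e k *\<^sub>R d)) (F x) \<le> C * dist (x + e k *\<^sub>R d) x"
          using lip by (intro lipschitz_onD) auto
        also have "\<dots> = C * norm d * e k" using e[of k] by (simp add: dist_norm)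
        finally have "\<bar>F (x + e k *\<^sub>R d) - F x\<bar> / e k \<le> C * norm d"
          using e[of k] by (simp add: dist_norm pos_divide_le_eq)
        then show ?thesis using True e[of k] by (simp add: s_def abs_divide)
      next
        case False
        have "norm x \<le> norm (x + e k *\<^sub>R d) + norm (e k *\<^sub>R d)"
          using norm_triangle_ineq4[of "x + e k *\<^sub>R d" "e k *\<^sub>R d"] by simp
        moreover have "norm (e k *\<^sub>R d) \<le> norm d" using e[of k] by (simp add: mult_left_le_one_le)
        moreover have "norm x > R + norm d" using False by simp
        ultimately have "norm (x + e k *\<^sub>R d) > R" "norm x > R"
          using norm_ge_zero[of d] by linarith+
        then have "x + e k *\<^sub>R d \<notin> cball 0 R" "x \<notin> cball 0 R" by simp_all
        then have "s k x = 0" using supp by (simp add: s_def)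
        then show ?thesis using False by simp
      qed
    qed
  qed
  then show ?thesis unfolding s0 by (simp add: LIMSEQ_const_iff)
qed

text \<open>Differentiability is asked on the whole plane: the polynomial of a cell is continued
  past the cell, which avoids one-sided derivatives. Keeping the gradient as two scalar functions
  makes derivatives in every direction explicit.\<close>

definition C1 :: "sfield \<Rightarrow> bool" where
  "C1 P \<longleftrightarrow> (\<exists>p1 p2. continuous_on UNIV p1 \<and> continuous_on UNIV p2 \<and>
     (\<forall>x. (P has_derivative (\<lambda>d. p1 x * d $ 1 + p2 x * d $ 2)) (at x)))"

lemma C1_I:
  assumes "continuous_on UNIV p1" "continuous_on UNIV p2"
    "\<And>x. (P has_derivative (\<lambda>d. p1 x * d $ 1 + p2 x * d $ 2)) (at x)"
  shows "C1 P"
  using assms unfolding C1_def by blast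

lemma C1_const: "C1 (\<lambda>x. c)"
  by (rule C1_I[of "\<lambda>_. 0" "\<lambda>_. 0"]) auto

lemma C1_fst: "C1 (\<lambda>x. x $ 1)"
  by (rule C1_I[of "\<lambda>_. 1" "\<lambda>_. 0"]) (auto intro!: bounded_linear_imp_has_derivative bounded_linear_vec_nth)

lemma C1_snd: "C1 (\<lambda>x. x $ 2)"
  by (rule C1_I[of "\<lambda>_. 0" "\<lambda>_. 1"]) (auto intro!: bounded_linear_imp_has_derivative bounded_linear_vec_nth)

lemma C1_continuous: "C1 P \<Longrightarrow> continuous_on S P"
  unfolding C1_def
  by (meson continuous_at_imp_continuous_on has_derivative_continuous)

lemma C1_add: assumes "C1 P" "C1 Q" shows "C1 (\<lambda>x. P x + Q x)"
proof -
  obtain p1 p2 q1 q2 where *: "continuous_on UNIV p1" "continuous_on UNIV p2"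
    "\<And>x. (P has_derivative (\<lambda>d. p1 x * d $ 1 + p2 x * d $ 2)) (at x)"
    "continuous_on UNIV q1" "continuous_on UNIV q2"
    "\<And>x. (Q has_derivative (\<lambda>d. q1 x * d $ 1 + q2 x * d $ 2)) (at x)"
    using assms unfolding C1_def by blast
  show ?thesis
    by (rule C1_I[of "\<lambda>x. p1 x + q1 x" "\<lambda>x. p2 x + q2 x"])
      (auto intro!: continuous_intros derivative_eq_intros *(1,2,4,5) *(3,6) simp: algebra_simps)
qed

lemma C1_mult: assumes "C1 P" "C1 Q" shows "C1 (\<lambda>x. P x * Q x)"
proof -
  obtain p1 p2 q1 q2 where *: "continuous_on UNIV p1" "continuous_on UNIV p2"
    "\<And>x. (P has_derivative (\<lambda>d. p1 x * d $ 1 + p2 x * d $ 2)) (at x)"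
    "continuous_on UNIV q1" "continuous_on UNIV q2"
    "\<And>x. (Q has_derivative (\<lambda>d. q1 x * d $ 1 + q2 x * d $ 2)) (at x)"
    using assms unfolding C1_def by blast
  show ?thesis
    by (rule C1_I[of "\<lambda>x. p1 x * Q x + P x * q1 x" "\<lambda>x. p2 x * Q x + P x * q2 x"])
      (auto intro!: continuous_intros derivative_eq_intros *(1,2,4,5) *(3,6)
          assms[THEN C1_continuous] simp: algebra_simps)
qed

lemma C1_arctan: assumes "C1 P" shows "C1 (\<lambda>x. arctan (P x))"
proof -
  obtain p1 p2 where *: "continuous_on UNIV p1" "continuous_on UNIV p2"
    "\<And>x. (P has_derivative (\<lambda>d. p1 x * d $ 1 + p2 x * d $ 2)) (at x)"
    using assms unfolding C1_def by blast
  have ne: "1 + (P x)\<^sup>2 \<noteq> 0" for x using zero_le_power2[of "P x"] by linarith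
  show ?thesis
    by (rule C1_I[of "\<lambda>x. p1 x / (1 + (P x)\<^sup>2)" "\<lambda>x. p2 x / (1 + (P x)\<^sup>2)"])
      (auto intro!: continuous_intros derivative_eq_intros *(1,2) *(3) C1_continuous[OF assms]
        simp: ne divide_inverse algebra_simps)
qed

lemma C1_cmult: "C1 P \<Longrightarrow> C1 (\<lambda>x. c * P x)"
  using C1_mult[OF C1_const] .

lemma C1_diff: "C1 P \<Longrightarrow> C1 Q \<Longrightarrow> C1 (\<lambda>x. P x - Q x)"
  using C1_add[of P "\<lambda>x. (-1) * Q x"] C1_cmult[of Q "-1"] by simp

lemma C1_power: "C1 P \<Longrightarrow> C1 (\<lambda>x. P x ^ k)"
  by (induction k) (auto intro: C1_const C1_mult)

lemma C1_sum: "(\<And>i. i \<in> I \<Longrightarrow> C1 (P i)) \<Longrightarrow> C1 (\<lambda>x. \<Sum>i\<in>I. P i x)"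
  by (induction I rule: infinite_finite_induct) (auto intro: C1_const C1_add)

lemmas C1_intros = C1_const C1_fst C1_snd C1_add C1_mult C1_diff C1_cmult C1_power C1_sum C1_arctan

lemma is_poly_on_C1:
  assumes "is_poly_on k S w" obtains P where "C1 P" "\<And>x. x \<in> S \<Longrightarrow> w x = P x"
proof -
  obtain c :: "nat \<Rightarrow> nat \<Rightarrow> real"
    where c: "\<forall>x\<in>S. w x = (\<Sum>i\<le>k. \<Sum>j\<le>k-i. c i j * (x $ 1) ^ i * (x $ 2) ^ j)"
    using assms unfolding is_poly_on_def by blast
  show ?thesis
    by (rule that[of "\<lambda>x. \<Sum>i\<le>k. \<Sum>j\<le>k-i. c i j * (x $ 1) ^ i * (x $ 2) ^ j"])
      (use c in \<open>auto intro!: C1_intros\<close>)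
qed

definition dir_deriv :: "pt \<Rightarrow> sfield \<Rightarrow> sfield" where
  "dir_deriv d F x = deriv (\<lambda>t. F (x + t *\<^sub>R d)) 0"

lemma partial_eq_dir_deriv: "partial u i j x = dir_deriv (axis j 1) (\<lambda>x. u x $ i) x"
  by (simp add: partial_def dir_deriv_def)

lemma C1_line_derivative:
  fixes d :: pt
  assumes "\<And>x. (P has_derivative (\<lambda>d. p1 x * d $ 1 + p2 x * d $ 2)) (at x)"
  shows "((\<lambda>t. P (x + t *\<^sub>R d)) has_real_derivative (p1 x * d $ 1 + p2 x * d $ 2)) (at 0)"
proof -
  have "((\<lambda>t. x + t *\<^sub>R d) has_derivative (\<lambda>t. t *\<^sub>R d)) (at 0)"
    by (auto intro!: derivative_eq_intros)
  then have "((\<lambda>t. P (x + t *\<^sub>R d)) has_derivative (\<lambda>t. p1 x * (t *\<^sub>R d) $ 1 + p2 x * (t *\<^sub>R d) $ 2)) (at 0)"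
    by (rule has_derivative_compose) (use assms[of "x + 0 *\<^sub>R d"] in simp)
  moreover have "(\<lambda>t. p1 x * (t *\<^sub>R d) $ 1 + p2 x * (t *\<^sub>R d) $ 2) = (*) (p1 x * d $ 1 + p2 x * d $ 2)"
    by (auto simp: fun_eq_iff algebra_simps)
  ultimately show ?thesis
    unfolding has_field_derivative_def by simp
qed

lemma C1_lipschitz:
  assumes "C1 P" "compact T" "convex T"
  obtains C where "C \<ge> 0" "C-lipschitz_on T P"
proof -
  obtain p1 p2 where *: "continuous_on UNIV p1" "continuous_on UNIV p2"
    "\<And>x. (P has_derivative (\<lambda>d. p1 x * d $ 1 + p2 x * d $ 2)) (at x)"
    using assms(1) unfolding C1_def by blast
  have "bounded (p1 ` T)" "bounded (p2 ` T)"
    using compact_continuous_image[OF continuous_on_subset[OF *(1)] assms(2)]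
      compact_continuous_image[OF continuous_on_subset[OF *(2)] assms(2)] compact_imp_bounded by blast+
  then obtain B1 B2 where B: "B1 > 0" "\<And>x. x \<in> T \<Longrightarrow> \<bar>p1 x\<bar> \<le> B1" "B2 > 0" "\<And>x. x \<in> T \<Longrightarrow> \<bar>p2 x\<bar> \<le> B2"
    unfolding bounded_pos by force
  have "(B1 + B2)-lipschitz_on T P"
  proof (rule bounded_derivative_imp_lipschitz)
    show "(P has_derivative (\<lambda>d. p1 x * d $ 1 + p2 x * d $ 2)) (at x within T)" for x
      using *(3) by (rule has_derivative_at_withinI)
    show "onorm (\<lambda>d::pt. p1 x * d $ 1 + p2 x * d $ 2) \<le> B1 + B2" if "x \<in> T" for x
    proof (rule onorm_le)
      fix d :: pt
      have "\<bar>p1 x * d $ 1\<bar> \<le> B1 * norm d" "\<bar>p2 x * d $ 2\<bar> \<le> B2 * norm d"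
        unfolding abs_mult using B that by (auto intro!: mult_mono component_le_norm_cart)
      then show "norm (p1 x * d $ 1 + p2 x * d $ 2) \<le> (B1 + B2) * norm d"
        unfolding real_norm_def distrib_right by linarith
    qed
  qed (use B assms in auto)
  then show ?thesis using that[of "B1 + B2"] B by simp
qed

section \<open>Quadratic polynomials\<close>

type_synonym coeffs = "real \<times> real \<times> real \<times> real \<times> real \<times> real"

text \<open>The coefficients form a tuple so that \<open>coeffs\<close> is a finite-dimensional
  Euclidean space with compact unit sphere.\<close>

fun quad_poly :: "coeffs \<Rightarrow> pt \<Rightarrow> real" where
  "quad_poly (a, b, c, d, e, f) y = a + b * y $ 1 + c * y $ 2 + d * (y $ 1)\<^sup>2 + e * (y $ 1 * y $ 2) + f * (y $ 2)\<^sup>2"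

lemma is_poly_on_2_iff: "is_poly_on 2 S w \<longleftrightarrow> (\<exists>c. \<forall>x\<in>S. w x = quad_poly c x)"
proof
  assume "is_poly_on 2 S w"
  then obtain c :: "nat \<Rightarrow> nat \<Rightarrow> real"
    where c: "\<forall>x\<in>S. w x = (\<Sum>i\<le>2. \<Sum>j\<le>2-i. c i j * (x $ 1) ^ i * (x $ 2) ^ j)"
    unfolding is_poly_on_def by blast
  have "w x = quad_poly (c 0 0, c 1 0, c 0 1, c 2 0, c 1 1, c 0 2) x" if "x \<in> S" for x
    using c that by (simp add: numeral_2_eq_2)
  then show "\<exists>c. \<forall>x\<in>S. w x = quad_poly c x" by blast
next
  assume "\<exists>c. \<forall>x\<in>S. w x = quad_poly c x"
  then obtain p where p: "\<forall>x\<in>S. w x = quad_poly p x" by blast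
  obtain a b c d e f where pe: "p = (a, b, c, d, e, f)" by (cases p) auto
  define k :: "nat \<Rightarrow> nat \<Rightarrow> real" where
    "k i j = (if i = 0 then (if j = 0 then a else if j = 1 then c else f)
              else if i = 1 then (if j = 0 then b else e) else d)" for i j
  have "w x = (\<Sum>i\<le>2. \<Sum>j\<le>2-i. k i j * (x $ 1) ^ i * (x $ 2) ^ j)" if "x \<in> S" for x
    using p that unfolding pe by (simp add: numeral_2_eq_2 k_def)
  then show "is_poly_on 2 S w" unfolding is_poly_on_def by blast
qed

lemma is_poly_on_1_iff: "is_poly_on 1 S w \<longleftrightarrow> (\<exists>a b c. \<forall>x\<in>S. w x = a + b * x $ 1 + c * x $ 2)"
proof
  assume "is_poly_on 1 S w"
  then obtain c :: "nat \<Rightarrow> nat \<Rightarrow> real"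
    where c: "\<forall>x\<in>S. w x = (\<Sum>i\<le>1. \<Sum>j\<le>1-i. c i j * (x $ 1) ^ i * (x $ 2) ^ j)"
    unfolding is_poly_on_def by blast
  have "w x = c 0 0 + c 1 0 * x $ 1 + c 0 1 * x $ 2" if "x \<in> S" for x
    using c that by simp
  then show "\<exists>a b c. \<forall>x\<in>S. w x = a + b * x $ 1 + c * x $ 2" by blast
next
  assume "\<exists>a b c. \<forall>x\<in>S. w x = a + b * x $ 1 + c * x $ 2"
  then obtain a b c where p: "\<forall>x\<in>S. w x = a + b * x $ 1 + c * x $ 2" by blast
  define k :: "nat \<Rightarrow> nat \<Rightarrow> real" where
    "k i j = (if i = 0 then (if j = 0 then a else c) else b)" for i j
  have "w x = (\<Sum>i\<le>1. \<Sum>j\<le>1-i. k i j * (x $ 1) ^ i * (x $ 2) ^ j)" if "x \<in> S" for x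
    using p that by (simp add: k_def)
  then show "is_poly_on 1 S w" unfolding is_poly_on_def by blast
qed

lemma quad_poly_affine: "\<exists>c'. \<forall>z. quad_poly c (v + h *\<^sub>R z) = quad_poly c' z"
proof -
  obtain a0 a1 a2 a3 a4 a5 where c: "c = (a0, a1, a2, a3, a4, a5)" by (cases c) auto
  show ?thesis
    unfolding c
    by (rule exI[of _ "(a0 + a1 * v $ 1 + a2 * v $ 2 + a3 * (v $ 1)\<^sup>2 + a4 * (v $ 1 * v $ 2) + a5 * (v $ 2)\<^sup>2,
        h * (a1 + 2 * a3 * v $ 1 + a4 * v $ 2), h * (a2 + a4 * v $ 1 + 2 * a5 * v $ 2),
        h\<^sup>2 * a3, h\<^sup>2 * a4, h\<^sup>2 * a5)"])
      (simp add: power2_eq_square algebra_simps)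
qed

lemma quad_poly_scale: "quad_poly (r *\<^sub>R c) y = r * quad_poly c y"
  by (cases c) (simp add: algebra_simps)

lemma norm_coeffs_ge:
  "\<bar>a\<bar> \<le> norm (a, b, c, d, e, f)" "\<bar>b\<bar> \<le> norm (a, b, c, d, e, f)" "\<bar>c\<bar> \<le> norm (a, b, c, d, e, f)"
  "\<bar>d\<bar> \<le> norm (a, b, c, d, e, f)" "\<bar>e\<bar> \<le> norm (a, b, c, d, e, f)" "\<bar>f\<bar> \<le> norm (a, b, c, d, e, f)"
  for a b c d e f :: real
proof -
  have "norm (b, c, d, e, f) \<le> norm (a, b, c, d, e, f)" "norm (c, d, e, f) \<le> norm (b, c, d, e, f)"
    "norm (d, e, f) \<le> norm (c, d, e, f)" "norm (e, f) \<le> norm (d, e, f)"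
    "norm f \<le> norm (e, f)"
    by (rule norm_snd_le)+
  moreover have "norm a \<le> norm (a, b, c, d, e, f)" "norm b \<le> norm (b, c, d, e, f)"
    "norm c \<le> norm (c, d, e, f)" "norm d \<le> norm (d, e, f)" "norm e \<le> norm (e, f)"
    by (rule norm_fst_le)+
  ultimately show
    "\<bar>a\<bar> \<le> norm (a, b, c, d, e, f)" "\<bar>b\<bar> \<le> norm (a, b, c, d, e, f)" "\<bar>c\<bar> \<le> norm (a, b, c, d, e, f)"
    "\<bar>d\<bar> \<le> norm (a, b, c, d, e, f)" "\<bar>e\<bar> \<le> norm (a, b, c, d, e, f)" "\<bar>f\<bar> \<le> norm (a, b, c, d, e, f)"
    unfolding real_norm_def by linarith+
qed

abbreviation sq :: "real \<Rightarrow> pt set" where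
  "sq s \<equiv> cbox (\<chi> i. - s) (\<chi> i. s)"

lemma continuous_on_quad_poly_pair: "continuous_on S (\<lambda>(c, y). quad_poly c y)"
proof -
  have eq: "(\<lambda>(c, y). quad_poly c y) = (\<lambda>(c, y). fst c + fst (snd c) * y $ 1 + fst (snd (snd c)) * y $ 2
      + fst (snd (snd (snd c))) * (y $ 1)\<^sup>2 + fst (snd (snd (snd (snd c)))) * (y $ 1 * y $ 2)
      + snd (snd (snd (snd (snd c)))) * (y $ 2)\<^sup>2)"
    by (auto simp: fun_eq_iff)
  show ?thesis unfolding eq case_prod_beta by (intro continuous_intros)
qed

lemma quad_poly_eq_0_on_square:
  assumes "s > 0" "\<And>y. y \<in> sq s \<Longrightarrow> quad_poly c y = 0"
  shows "c = 0"
proof -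
  obtain a0 a1 a2 a3 a4 a5 where c: "c = (a0, a1, a2, a3, a4, a5)" by (cases c) auto
  have z: "quad_poly c (\<chi> i. if i = 1 then p else q) = 0" if "\<bar>p\<bar> \<le> s" "\<bar>q\<bar> \<le> s" for p q
    using that by (intro assms(2)) (auto simp: mem_box_cart)
  have z': "a0 + a1 * p + a2 * q + a3 * p\<^sup>2 + a4 * (p * q) + a5 * q\<^sup>2 = 0" if "\<bar>p\<bar> \<le> s" "\<bar>q\<bar> \<le> s" for p q
    using z[OF that] unfolding c by simp
  have "a0 = 0" using z'[of 0 0] assms by simp
  have "a1 * s + a3 * s\<^sup>2 = 0" "- a1 * s + a3 * s\<^sup>2 = 0" "a2 * s + a5 * s\<^sup>2 = 0" "- a2 * s + a5 * s\<^sup>2 = 0"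
    using z'[of s 0] z'[of "-s" 0] z'[of 0 s] z'[of 0 "-s"] assms \<open>a0 = 0\<close> by simp_all
  then have "a1 * s = 0" "a3 * s\<^sup>2 = 0" "a2 * s = 0" "a5 * s\<^sup>2 = 0" by linarith+
  then have "a1 = 0" "a2 = 0" "a3 = 0" "a5 = 0" using assms by simp_all
  moreover have "a4 = 0" using z'[of s s] assms calculation \<open>a0 = 0\<close> by simp
  ultimately show ?thesis using c \<open>a0 = 0\<close> by (simp add: zero_prod_def)
qed

text \<open>Compactness: the integral is continuous in \<open>c\<close>, homogeneous of degree 2 and
  positive on the unit sphere. The constant is the reciprocal of its minimum there.\<close>

lemma coeffs_bound:
  assumes s: "s > 0"
  obtains C where "C > 0" "\<And>c. (norm c)\<^sup>2 \<le> C * integral (sq s) (\<lambda>y. (quad_poly c y)\<^sup>2)"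
proof -
  define f where "f c = integral (sq s) (\<lambda>y. (quad_poly c y)\<^sup>2)" for c
  have contf: "continuous_on UNIV f"
    unfolding f_def
  proof (rule integral_continuous_on_param)
    have "continuous_on (UNIV \<times> sq s) (\<lambda>z. ((\<lambda>(c, y). quad_poly c y) z)\<^sup>2)"
      by (intro continuous_intros continuous_on_quad_poly_pair)
    then show "continuous_on (UNIV \<times> sq s) (\<lambda>(c, y). (quad_poly c y)\<^sup>2)"
      by (simp add: case_prod_beta)
  qed
  have "compact (sphere (0::coeffs) 1)" by simp
  moreover have "sphere (0::coeffs) 1 \<noteq> {}" by simp
  ultimately obtain c0 where c0: "c0 \<in> sphere 0 1" "\<And>c. c \<in> sphere 0 1 \<Longrightarrow> f c0 \<le> f c"
    using continuous_attains_inf[of "sphere (0::coeffs) 1" f] continuous_on_subset[OF contf] by blast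
  have contq: "continuous_on (sq s) (\<lambda>y. (quad_poly c y)\<^sup>2)" for c
    by (cases c) (auto intro!: continuous_intros)
  have "f c0 \<ge> 0" unfolding f_def by (intro integral_nonneg integrable_continuous contq) auto
  moreover have "f c0 \<noteq> 0"
  proof
    assume "f c0 = 0"
    moreover have "box (\<chi> i. - s) (\<chi> i. s) \<noteq> ({} :: pt set)"
      using s by (simp add: interval_ne_empty_cart)
    ultimately have "\<forall>y\<in>sq s. (quad_poly c0 y)\<^sup>2 = 0"
      unfolding f_def using integral_cbox_eq_0_iff[OF contq] by auto
    then have "c0 = 0" using quad_poly_eq_0_on_square[OF s] by simp
    then show False using c0 by simp
  qed
  ultimately have pos: "f c0 > 0" by simp
  have "(norm c)\<^sup>2 \<le> 1 / f c0 * f c" for c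
  proof (cases "c = 0")
    case True
    then show ?thesis using pos unfolding f_def by (simp add: zero_prod_def integral_nonneg integrable_continuous contq)
  next
    case False
    have "f c0 \<le> f ((1 / norm c) *\<^sub>R c)" using c0(2) False by simp
    also have "\<dots> = (1 / norm c)\<^sup>2 * f c"
      unfolding f_def quad_poly_scale power_mult_distrib by simp
    finally show ?thesis using pos False by (simp add: field_simps power2_eq_square)
  qed
  then show ?thesis using that[of "1 / f c0"] pos unfolding f_def by simp
qed

lemma integral_cbox_scaled:
  fixes w :: "pt \<Rightarrow> real"
  assumes h: "h > 0" and w: "w integrable_on ((\<lambda>z. v + h *\<^sub>R z) ` sq s)"
  shows "integral ((\<lambda>z. v + h *\<^sub>R z) ` sq s) w = h\<^sup>2 * integral (sq s) (\<lambda>z. w (v + h *\<^sub>R z))"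
proof -
  define I where "I = integral ((\<lambda>z. v + h *\<^sub>R z) ` sq s) w"
  have im: "(\<lambda>z. v + h *\<^sub>R z) ` sq s = cbox (v + h *\<^sub>R (\<chi> i. - s)) (v + h *\<^sub>R (\<chi> i. s))"
    if "sq s \<noteq> {}"
    using image_affinity_cbox[of h v "\<chi> i. - s" "\<chi> i. s"] that h by (simp add: add.commute)
  show ?thesis
  proof (cases "sq s = {}")
    case False
    have "(w has_integral I) (cbox (v + h *\<^sub>R (\<chi> i. - s)) (v + h *\<^sub>R (\<chi> i. s)))"
      using w unfolding I_def im[OF False, symmetric] by (rule integrable_integral)
    from has_integral_affinity'[OF this h, of v]
    have "((\<lambda>z. w (h *\<^sub>R z + v)) has_integral I /\<^sub>R h ^ 2) (sq s)"
      using h by (simp add: DIM_cart)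
    then have "integral (sq s) (\<lambda>z. w (v + h *\<^sub>R z)) = I /\<^sub>R h ^ 2"
      by (simp add: add.commute integral_unique)
    then show ?thesis using h by (simp add: I_def)
  qed simp
qed

section \<open>Piecewise smooth functions\<close>

context meshed_domain
begin

text \<open>Values on the sides of the triangles are left free, because the derivative of a
  piecewise polynomial is unspecified there; the sides form a null set.\<close>

definition pw_cont :: "sfield \<Rightarrow> bool" where
  "pw_cont F \<longleftrightarrow> (\<forall>T\<in>\<T>. \<exists>g. continuous_on UNIV g \<and> (\<forall>x\<in>interior T. F x = g x))"

text \<open>Agreement on closed cells, unlike in \<open>pw_cont\<close>, builds in continuity across
  shared sides; this allows derivatives to be integrated over the whole domain.\<close>

definition pw_C1 :: "sfield \<Rightarrow> bool" where
  "pw_C1 F \<longleftrightarrow> (\<forall>T\<in>\<T>. \<exists>P. C1 P \<and> (\<forall>x\<in>T. F x = P x))"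

definition cells :: "pt set" where
  "cells = (\<Union>T\<in>\<T>. interior T)"

abbreviation intg :: "sfield \<Rightarrow> real" where
  "intg F \<equiv> LINT x:\<Omega>|lebesgue. F x"

lemma compact_cell: "T \<in> \<T> \<Longrightarrow> compact T"
  using simplex2 compact_simplex by blast

lemma convex_cell: "T \<in> \<T> \<Longrightarrow> convex T"
  using simplex2 convex_simplex by blast

lemma negligible_Union_frontier: "negligible (\<Union>T\<in>\<T>. frontier T)"
  using finite_mesh convex_cell by (auto intro!: negligible_Union negligible_convex_frontier)

lemma closure_minus_cells: "closure \<Omega> - cells \<subseteq> (\<Union>T\<in>\<T>. frontier T)"
proof
  fix x assume x: "x \<in> closure \<Omega> - cells"
  then obtain T where T: "T \<in> \<T>" "x \<in> T" using Union_mesh by blast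
  then have "x \<in> frontier T" using x closure_subset[of T] unfolding frontier_def cells_def by blast
  then show "x \<in> (\<Union>T\<in>\<T>. frontier T)" using T by blast
qed

lemma cells_subset: "cells \<subseteq> \<Omega>"
  using interior_cell_subset by (auto simp: cells_def)

lemma AE_cells: "AE x in lebesgue. x \<in> \<Omega> \<longrightarrow> x \<in> cells"
proof -
  have "AE x in lebesgue. x \<notin> (\<Union>T\<in>\<T>. frontier T)"
    using negligible_Union_frontier by (simp only: negligible_iff_null_sets AE_not_in)
  then show ?thesis
  proof (rule AE_mp, intro AE_I2 impI)
    fix x assume "x \<notin> (\<Union>T\<in>\<T>. frontier T)" "x \<in> \<Omega>"
    then show "x \<in> cells" using closure_minus_cells closure_subset[of \<Omega>] by blast
  qed
qed

lemma pw_cont_integrable: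
  assumes "pw_cont F" shows "set_integrable lebesgue \<Omega> F"
proof -
  have "set_integrable lebesgue (interior T) F" if T: "T \<in> \<T>" for T
  proof -
    obtain g where g: "continuous_on UNIV g" "\<forall>x\<in>interior T. F x = g x"
      using assms T unfolding pw_cont_def by blast
    have "set_integrable lborel T g"
      unfolding set_integrable_def using compact_cell[OF T] continuous_on_subset[OF g(1)]
      by (intro borel_integrable_compact) auto
    then have "set_integrable lebesgue T g"
      by (simp add: set_integrable_def integrable_completion)
    then have "set_integrable lebesgue (interior T) g"
      by (rule set_integrable_subset) (auto simp: interior_subset borel_open sets_completionI_sets)
    then show ?thesis
      using set_integrable_cong[of lebesgue lebesgue "interior T" "interior T" F g] g(2) by simp
  qed
  then have "set_integrable lebesgue cells F"
    unfolding cells_def using finite_mesh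
    by (intro set_integrable_UN) (auto simp: borel_open sets_completionI_sets)
  then show ?thesis
  proof (rule absolutely_integrable_spike_set)
    show "negligible {x \<in> cells - \<Omega>. F x \<noteq> 0}"
      using cells_subset by (auto intro: negligible_subset[OF negligible_empty])
    show "negligible {x \<in> \<Omega> - cells. F x \<noteq> 0}"
      using closure_minus_cells closure_subset[of \<Omega>]
      by (intro negligible_subset[OF negligible_Union_frontier]) blast
  qed
qed

lemma intg_mono:
  assumes "pw_cont F" "pw_cont G" "\<And>x. x \<in> cells \<Longrightarrow> F x \<le> G x"
  shows "intg F \<le> intg G"
  by (rule set_integral_mono_AE[OF assms(1,2)[THEN pw_cont_integrable]])
    (use AE_cells assms(3) in \<open>auto elim!: AE_mp\<close>)

lemma intg_cong:
  assumes "pw_cont F" "pw_cont G" "\<And>x. x \<in> cells \<Longrightarrow> F x = G x"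
  shows "intg F = intg G"
  using intg_mono[OF assms(1,2)] intg_mono[OF assms(2,1)] assms(3) by (simp add: antisym)

lemma pwcE:
  assumes "pw_cont F" "T \<in> \<T>" obtains g where "continuous_on UNIV g" "\<And>x. x \<in> interior T \<Longrightarrow> F x = g x"
  using assms unfolding pw_cont_def by blast

lemma pwcI: "(\<And>T. T \<in> \<T> \<Longrightarrow> \<exists>g. continuous_on UNIV g \<and> (\<forall>x\<in>interior T. F x = g x)) \<Longrightarrow> pw_cont F"
  unfolding pw_cont_def by blast

lemma pw_cont_cont: "continuous_on UNIV g \<Longrightarrow> pw_cont g"
  by (rule pwcI) blast

lemma pw_cont_const: "pw_cont (\<lambda>x. c)" by (rule pw_cont_cont) auto

lemma pw_cont_compose2:
  assumes "pw_cont F" "pw_cont G" "continuous_on UNIV (\<lambda>(a, b). op a b)"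
  shows "pw_cont (\<lambda>x. op (F x) (G x) :: real)"
proof (rule pwcI)
  fix T assume T: "T \<in> \<T>"
  obtain f g where "continuous_on UNIV f" "\<And>x. x \<in> interior T \<Longrightarrow> F x = f x"
    "continuous_on UNIV g" "\<And>x. x \<in> interior T \<Longrightarrow> G x = g x"
    using pwcE[OF assms(1) T] pwcE[OF assms(2) T] by metis
  moreover from this have "continuous_on UNIV (\<lambda>x. (\<lambda>(a, b). op a b) (f x, g x))"
    by (intro continuous_on_compose2[OF assms(3)] continuous_intros) auto
  ultimately show "\<exists>h. continuous_on UNIV h \<and> (\<forall>x\<in>interior T. op (F x) (G x) = h x)"
    by (intro exI[of _ "\<lambda>x. op (f x) (g x)"]) auto
qed

lemma pw_cont_add: "pw_cont F \<Longrightarrow> pw_cont G \<Longrightarrow> pw_cont (\<lambda>x. F x + G x)"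
  by (rule pw_cont_compose2) (auto simp: case_prod_beta intro!: continuous_intros)

lemma pw_cont_diff: "pw_cont F \<Longrightarrow> pw_cont G \<Longrightarrow> pw_cont (\<lambda>x. F x - G x)"
  by (rule pw_cont_compose2) (auto simp: case_prod_beta intro!: continuous_intros)

lemma pw_cont_mult: "pw_cont F \<Longrightarrow> pw_cont G \<Longrightarrow> pw_cont (\<lambda>x. F x * G x)"
  by (rule pw_cont_compose2) (auto simp: case_prod_beta intro!: continuous_intros)

lemma pw_cont_cmult: "pw_cont F \<Longrightarrow> pw_cont (\<lambda>x. c * F x)"
  by (rule pw_cont_mult[OF pw_cont_const])

lemma pw_cont_divide: "pw_cont F \<Longrightarrow> pw_cont (\<lambda>x. F x / c)"
  using pw_cont_cmult[of F "1/c"] by simp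

lemma pw_cont_power: "pw_cont F \<Longrightarrow> pw_cont (\<lambda>x. F x ^ k)"
  by (induction k) (auto intro: pw_cont_const pw_cont_mult)

lemma pw_cont_abs: "pw_cont F \<Longrightarrow> pw_cont (\<lambda>x. \<bar>F x\<bar>)"
  by (rule pw_cont_compose2[of F F "\<lambda>a b. \<bar>a\<bar>"]) (auto simp: case_prod_beta intro!: continuous_intros)

lemma pw_cont_sum: "(\<And>i. i \<in> I \<Longrightarrow> pw_cont (F i)) \<Longrightarrow> pw_cont (\<lambda>x. \<Sum>i\<in>I. F i x)"
  by (induction I rule: infinite_finite_induct) (auto intro: pw_cont_const pw_cont_add)

lemma intg_add: "pw_cont F \<Longrightarrow> pw_cont G \<Longrightarrow> intg (\<lambda>x. F x + G x) = intg F + intg G"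
  by (intro set_integral_add pw_cont_integrable)

lemma intg_diff: "pw_cont F \<Longrightarrow> pw_cont G \<Longrightarrow> intg (\<lambda>x. F x - G x) = intg F - intg G"
  by (intro set_integral_diff pw_cont_integrable)

lemma intg_cmult: "intg (\<lambda>x. c * F x) = c * intg F"
  by simp

lemma intg_sum: "(\<And>i. i \<in> I \<Longrightarrow> pw_cont (F i)) \<Longrightarrow> intg (\<lambda>x. \<Sum>i\<in>I. F i x) = (\<Sum>i\<in>I. intg (F i))"
proof (induction I rule: infinite_finite_induct)
  case (insert i I)
  then show ?case by (simp add: intg_add pw_cont_sum)
qed (simp_all add: set_lebesgue_integral_def)

lemma intg_nonneg: "(\<And>x. F x \<ge> 0) \<Longrightarrow> intg F \<ge> 0"
  unfolding set_lebesgue_integral_def by (intro integral_nonneg_AE) auto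

lemma pw1E:
  assumes "pw_C1 F" "T \<in> \<T>" obtains P where "C1 P" "\<And>x. x \<in> T \<Longrightarrow> F x = P x"
  using assms unfolding pw_C1_def by blast

lemma pw_C1_pw_cont: "pw_C1 F \<Longrightarrow> pw_cont F"
  by (rule pwcI) (metis C1_continuous interior_subset pw1E subsetD)

lemma pw_C1_C1: "C1 P \<Longrightarrow> pw_C1 P"
  unfolding pw_C1_def by blast

lemma pw_C1_const: "pw_C1 (\<lambda>x. c)" by (intro pw_C1_C1 C1_const)

lemma pw_C1_mult: "pw_C1 F \<Longrightarrow> pw_C1 G \<Longrightarrow> pw_C1 (\<lambda>x. F x * G x)"
  unfolding pw_C1_def using C1_mult by (metis (no_types, lifting))

lemma pw_C1_cmult: "pw_C1 F \<Longrightarrow> pw_C1 (\<lambda>x. c * F x)"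
  by (rule pw_C1_mult[OF pw_C1_const])

lemma pw_C1_power: "pw_C1 F \<Longrightarrow> pw_C1 (\<lambda>x. F x ^ k)"
  by (induction k) (auto intro: pw_C1_const pw_C1_mult)

lemma pw_C1_hat: "pw_C1 (hat a)"
  unfolding pw_C1_def
proof
  fix T assume T: "T \<in> \<T>"
  show "\<exists>P. C1 P \<and> (\<forall>x\<in>T. hat a x = P x)"
  proof (cases "a \<in> verts T")
    case True
    obtain \<alpha> \<beta> \<gamma> where "\<forall>y. bary T a y = \<alpha> + \<beta> * y $ 1 + \<gamma> * y $ 2"
      using bary_affine[OF simplex2[OF T] True] by blast
    then show ?thesis using hat_eq[OF T] True
      by (intro exI[of _ "\<lambda>y. \<alpha> + \<beta> * y $ 1 + \<gamma> * y $ 2"]) (auto intro!: C1_intros)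
  next
    case False
    then show ?thesis using hat_eq[OF T] by (intro exI[of _ "\<lambda>y. 0"]) (auto intro!: C1_intros)
  qed
qed

lemma pw_C1_dir_deriv:
  assumes "pw_C1 F" "T \<in> \<T>"
  obtains p1 p2 where "continuous_on UNIV p1" "continuous_on UNIV p2"
    "\<And>x d. x \<in> interior T \<Longrightarrow> ((\<lambda>t. F (x + t *\<^sub>R d)) has_real_derivative (p1 x * d $ 1 + p2 x * d $ 2)) (at 0)"
    "\<And>x d. x \<in> interior T \<Longrightarrow> dir_deriv d F x = p1 x * d $ 1 + p2 x * d $ 2"
proof -
  obtain P where P: "C1 P" "\<And>x. x \<in> T \<Longrightarrow> F x = P x" using pw1E[OF assms] by blast
  then obtain p1 p2 where p: "continuous_on UNIV p1" "continuous_on UNIV p2"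
     "\<And>x. (P has_derivative (\<lambda>d. p1 x * d $ 1 + p2 x * d $ 2)) (at x)"
    unfolding C1_def by blast
  have der: "((\<lambda>t. F (x + t *\<^sub>R d)) has_real_derivative (p1 x * d $ 1 + p2 x * d $ 2)) (at 0)"
    if x: "x \<in> interior T" for x d
  proof (rule has_field_derivative_transform_within_open[OF C1_line_derivative[OF p(3)]])
    show "open ((\<lambda>t. x + t *\<^sub>R d) -` interior T)"
      by (intro open_vimage continuous_intros) auto
    show "P (x + t *\<^sub>R d) = F (x + t *\<^sub>R d)" if "t \<in> (\<lambda>t. x + t *\<^sub>R d) -` interior T" for t
      using that P(2) interior_subset by force
  qed (use x in auto)
  show ?thesis
    using that[OF p(1,2) der] DERIV_imp_deriv[OF der] unfolding dir_deriv_def by simp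
qed

lemma pw_C1_has_derivative:
  assumes "pw_C1 F" "x \<in> cells"
  shows "((\<lambda>t. F (x + t *\<^sub>R d)) has_real_derivative dir_deriv d F x) (at 0)"
proof -
  obtain T where T: "T \<in> \<T>" "x \<in> interior T" using assms by (auto simp: cells_def)
  show ?thesis by (rule pw_C1_dir_deriv[OF assms(1) T(1)]) (use T in metis)
qed

lemma dir_deriv_components:
  assumes "pw_C1 F" "x \<in> cells"
  shows "dir_deriv d F x = d $ 1 * dir_deriv (axis 1 1) F x + d $ 2 * dir_deriv (axis 2 1) F x"
proof -
  obtain T where T: "T \<in> \<T>" "x \<in> interior T" using assms by (auto simp: cells_def)
  obtain p1 p2 where "\<And>d. dir_deriv d F x = p1 x * d $ 1 + p2 x * d $ 2"
    by (rule pw_C1_dir_deriv[OF assms(1) T(1)]) (use T in metis)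
  then show ?thesis by (simp add: axis_def)
qed

lemma pw_cont_dir_deriv: "pw_C1 F \<Longrightarrow> pw_cont (dir_deriv d F)"
proof (rule pwcI)
  fix T assume F: "pw_C1 F" and T: "T \<in> \<T>"
  obtain p1 p2 where p: "continuous_on UNIV p1" "continuous_on UNIV p2"
    "\<And>x d. x \<in> interior T \<Longrightarrow> dir_deriv d F x = p1 x * d $ 1 + p2 x * d $ 2"
    by (rule pw_C1_dir_deriv[OF F T]) metis
  then show "\<exists>g. continuous_on UNIV g \<and> (\<forall>x\<in>interior T. dir_deriv d F x = g x)"
    by (intro exI[of _ "\<lambda>x. p1 x * d $ 1 + p2 x * d $ 2"]) (auto intro!: continuous_intros)
qed

lemma dir_deriv_add: "pw_C1 F \<Longrightarrow> pw_C1 G \<Longrightarrow> x \<in> cells \<Longrightarrow> dir_deriv d (\<lambda>x. F x + G x) x = dir_deriv d F x + dir_deriv d G x"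
  unfolding dir_deriv_def[of d "\<lambda>x. F x + G x"]
  by (intro DERIV_imp_deriv DERIV_add pw_C1_has_derivative)

lemma dir_deriv_diff: "pw_C1 F \<Longrightarrow> pw_C1 G \<Longrightarrow> x \<in> cells \<Longrightarrow> dir_deriv d (\<lambda>x. F x - G x) x = dir_deriv d F x - dir_deriv d G x"
  unfolding dir_deriv_def[of d "\<lambda>x. F x - G x"]
  by (intro DERIV_imp_deriv DERIV_diff pw_C1_has_derivative)

lemma dir_deriv_mult:
  assumes "pw_C1 F" "pw_C1 G" "x \<in> cells"
  shows "dir_deriv d (\<lambda>x. F x * G x) x = dir_deriv d F x * G x + F x * dir_deriv d G x"
  unfolding dir_deriv_def[of d "\<lambda>x. F x * G x"]
  using DERIV_mult[OF pw_C1_has_derivative[OF assms(1,3)] pw_C1_has_derivative[OF assms(2,3)], of d d]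
  by (intro DERIV_imp_deriv) (simp add: algebra_simps)

lemma dir_deriv_const: "dir_deriv d (\<lambda>x. c) x = 0"
  by (simp add: dir_deriv_def)

lemma dir_deriv_cmult:
  assumes "pw_C1 F" "x \<in> cells"
  shows "dir_deriv d (\<lambda>x. c * F x) x = c * dir_deriv d F x"
  using dir_deriv_mult[OF pw_C1_const assms] by (simp add: dir_deriv_const)

text \<open>Boundary terms vanish because \<open>F\<close>, extended by zero, is Lipschitz on the whole plane.\<close>

lemma intg_dir_deriv_eq_0:
  assumes F: "pw_C1 F" and zero: "\<And>x. x \<in> frontier \<Omega> \<Longrightarrow> F x = 0"
  shows "intg (dir_deriv d F) = 0"
proof -
  define F0 where "F0 x = (if x \<in> \<Omega> then F x else 0)" for x
  have F0_cell: "F0 x = F x" if "x \<in> T" "T \<in> \<T>" for x T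
    using subsetD[OF cell_subset[OF that(2)] that(1)] zero[of x] frontier_dom unfolding F0_def by auto
  have "\<exists>C\<ge>0. C-lipschitz_on T F0" if T: "T \<in> \<T>" for T
  proof -
    obtain P where P: "C1 P" "\<And>x. x \<in> T \<Longrightarrow> F x = P x" using pw1E[OF F T] by blast
    obtain C where C: "C \<ge> 0" "C-lipschitz_on T P"
      by (rule C1_lipschitz[OF P(1) compact_cell[OF T] convex_cell[OF T]])
    have "C-lipschitz_on T F0"
      by (rule lipschitz_on_transform[OF C(2)]) (simp add: P(2) F0_cell[OF _ T])
    then show ?thesis using C by blast
  qed
  then have "\<forall>T\<in>\<T>. \<exists>C. C \<ge> 0 \<and> C-lipschitz_on T F0" by blast
  from bchoice[OF this] obtain c where c: "\<And>T. T \<in> \<T> \<Longrightarrow> c T \<ge> 0 \<and> (c T)-lipschitz_on T F0"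
    by blast
  define C where "C = (\<Sum>T\<in>\<T>. c T)"
  have C0: "C \<ge> 0" unfolding C_def using c by (intro sum_nonneg) auto
  have C: "C-lipschitz_on T F0" if "T \<in> \<T>" for T
  proof (rule lipschitz_on_le)
    show "(c T)-lipschitz_on T F0" using c[OF that] by blast
    show "c T \<le> C" unfolding C_def using c by (intro member_le_sum[OF that] finite_mesh) blast
  qed
  have C': "C-lipschitz_on (- \<Omega>) F0"
    using C0 by (intro lipschitz_onI) (auto simp: F0_def)
  have cover: "\<exists>A\<in>insert (- \<Omega>) \<T>. x \<in> A" for x
    using Union_mesh closure_subset[of \<Omega>] by blast
  have lip: "C-lipschitz_on UNIV F0"
  proof (rule lipschitz_onI[OF _ C0])
    fix x y :: pt
    \<comment> \<open>Along the segment from \<open>x\<close> to \<open>y\<close>, the finitely many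
      closed pieces that cover the plane, all with constant \<open>C\<close>, glue to one Lipschitz
      bound with the same constant.\<close>
    define \<gamma> where "\<gamma> t = x + t *\<^sub>R (y - x)" for t :: real
    have g1: "(norm (y - x))-lipschitz_on U \<gamma>" for U
    proof (rule lipschitz_onI)
      fix s t
      have "\<gamma> s - \<gamma> t = (s - t) *\<^sub>R (y - x)" by (simp add: \<gamma>_def scaleR_diff_left)
      then show "dist (\<gamma> s) (\<gamma> t) \<le> norm (y - x) * dist s t"
        by (simp add: dist_norm)
    qed simp
    have contg: "continuous_on UNIV \<gamma>" unfolding \<gamma>_def by (intro continuous_intros)
    have "(C * norm (y - x))-lipschitz_on {0..1} (\<lambda>t. F0 (\<gamma> t))"
    proof (rule lipschitz_on_closed_Union[where I="insert (- \<Omega>) \<T>" and U="\<lambda>A. \<gamma> -` A"])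
      show "(C * norm (y - x))-lipschitz_on (\<gamma> -` A) (\<lambda>t. F0 (\<gamma> t))" if "A \<in> insert (- \<Omega>) \<T>" for A
      proof (rule lipschitz_on_compose2[OF g1])
        have "C-lipschitz_on A F0" using that C C' by blast
        then show "C-lipschitz_on (\<gamma> ` (\<gamma> -` A)) F0" by (rule lipschitz_on_subset) blast
      qed
      show "closed (\<gamma> -` A)" if "A \<in> insert (- \<Omega>) \<T>" for A
        using that closed_mesh_cell open_dom by (intro closed_vimage contg) auto
      show "finite (insert (- \<Omega>) \<T>)" using finite_mesh by simp
      show "0 \<le> C * norm (y - x)" using C0 by simp
      show "{0..1} \<subseteq> (\<Union>A\<in>insert (- \<Omega>) \<T>. \<gamma> -` A)"
        using cover by blast
    qed
    from lipschitz_onD[OF this, of 0 1]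
    show "dist (F0 x) (F0 y) \<le> C * dist x y"
      by (simp add: \<gamma>_def dist_norm norm_minus_commute)
  qed
  obtain R where R: "\<And>x. x \<in> \<Omega> \<Longrightarrow> norm x \<le> R"
    using bounded_dom unfolding bounded_iff by blast
  have "integral\<^sup>L lebesgue (\<lambda>x. indicator \<Omega> x *\<^sub>R dir_deriv d F x) = 0"
  proof (rule integral_directional_derivative_eq_0[OF lip _ negligible_Union_frontier])
    show "F0 x = 0" if "x \<notin> cball 0 R" for x
    proof -
      have "x \<notin> \<Omega>" using that R[of x] by auto
      then show ?thesis by (simp add: F0_def)
    qed
    show "(\<lambda>x. indicator \<Omega> x *\<^sub>R dir_deriv d F x) \<in> borel_measurable lebesgue"
      using pw_cont_integrable[OF pw_cont_dir_deriv[OF F]] unfolding set_integrable_def by (rule borel_measurable_integrable)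
    fix x assume x: "x \<notin> (\<Union>T\<in>\<T>. frontier T)"
    show "((\<lambda>t. F0 (x + t *\<^sub>R d)) has_real_derivative indicator \<Omega> x *\<^sub>R dir_deriv d F x) (at 0)"
    proof (cases "x \<in> closure \<Omega>")
      case True
      then have xc: "x \<in> cells" using x closure_minus_cells by blast
      then have xO: "x \<in> \<Omega>" using cells_subset by blast
      have "((\<lambda>t. F0 (x + t *\<^sub>R d)) has_real_derivative dir_deriv d F x) (at 0)"
      proof (rule has_field_derivative_transform_within_open[OF pw_C1_has_derivative[OF F xc]])
        show "open ((\<lambda>t. x + t *\<^sub>R d) -` \<Omega>)"
          by (intro open_vimage continuous_intros open_dom)
        show "F (x + t *\<^sub>R d) = F0 (x + t *\<^sub>R d)" if "t \<in> (\<lambda>t. x + t *\<^sub>R d) -` \<Omega>" for t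
          using that by (simp add: F0_def)
      qed (use xO in simp)
      then show ?thesis using xO by simp
    next
      case False
      have "((\<lambda>t. F0 (x + t *\<^sub>R d)) has_real_derivative 0) (at 0)"
      proof (rule has_field_derivative_transform_within_open[OF DERIV_const[of 0]])
        show "open ((\<lambda>t. x + t *\<^sub>R d) -` (- closure \<Omega>))"
          by (intro open_vimage continuous_intros) auto
        show "0 = F0 (x + t *\<^sub>R d)" if "t \<in> (\<lambda>t. x + t *\<^sub>R d) -` (- closure \<Omega>)" for t
        proof -
          have "x + t *\<^sub>R d \<notin> closure \<Omega>" using that by simp
          then have "x + t *\<^sub>R d \<notin> \<Omega>" using closure_subset[of \<Omega>] by blast
          then show ?thesis by (simp add: F0_def)
        qed
      qed (use False in simp)
      moreover have "x \<notin> \<Omega>" using False closure_subset[of \<Omega>] by blast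
      ultimately show ?thesis by simp
    qed
  qed
  then show ?thesis unfolding set_lebesgue_integral_def .
qed

end

section \<open>Inverse estimates\<close>

lemma inner_pt: "x \<bullet> y = x $ 1 * y $ 1 + x $ 2 * y $ 2" for x y :: pt
  by (simp add: inner_vec_def sum_2)

lemma tangent_nth: "tangent n $ 1 = n $ 2" "tangent n $ 2 = - n $ 1"
  by (simp_all add: tangent_def)

lemma quad_poly_add: "quad_poly (c + c') y = quad_poly c y + quad_poly c' y"
  by (cases c; cases c') (simp add: algebra_simps)

lemma quad_poly_diff: "quad_poly (c - c') y = quad_poly c y - quad_poly c' y"
  by (cases c; cases c') (simp add: algebra_simps)

lemma quad_poly_line: "\<exists>\<alpha> \<beta> \<gamma>. \<forall>t. quad_poly c ((1 - t) *\<^sub>R a + t *\<^sub>R b) = \<alpha> + \<beta> * t + \<gamma> * t\<^sup>2"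
proof -
  obtain c' where c': "\<And>t. quad_poly c ((1 - t) *\<^sub>R a + t *\<^sub>R b) = quad_poly c' (t *\<^sub>R (b - a))"
  proof -
    obtain c' where c': "\<And>z. quad_poly c (a + 1 *\<^sub>R z) = quad_poly c' z" using quad_poly_affine[of c a 1] by blast
    have "(1 - t) *\<^sub>R a + t *\<^sub>R b = a + 1 *\<^sub>R (t *\<^sub>R (b - a))" for t by (simp add: algebra_simps)
    then show ?thesis using c' by (intro that[of c']) presburger
  qed
  obtain a0 a1 a2 a3 a4 a5 where c: "c' = (a0, a1, a2, a3, a4, a5)" by (cases c') auto
  show ?thesis
    unfolding c' c
    by (rule exI[of _ a0], rule exI[of _ "a1 * (b - a) $ 1 + a2 * (b - a) $ 2"],
        rule exI[of _ "a3 * ((b - a) $ 1)\<^sup>2 + a4 * ((b - a) $ 1 * (b - a) $ 2) + a5 * ((b - a) $ 2)\<^sup>2"])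
      (simp add: power_mult_distrib power2_eq_square algebra_simps)
qed

text \<open>On a line a quadratic is determined by three values; the ends and the midpoint are the
  nodes of an edge.\<close>

lemma quadratic_eq_0_on_segment:
  assumes w: "is_poly_on 2 (closed_segment a b) w"
    and z: "w a = 0" "w b = 0" "w (midpoint a b) = 0" and x: "x \<in> closed_segment a b"
  shows "w x = 0"
proof -
  obtain c where c: "\<And>x. x \<in> closed_segment a b \<Longrightarrow> w x = quad_poly c x"
    using w unfolding is_poly_on_2_iff by blast
  obtain \<alpha> \<beta> \<gamma> where l: "\<And>t. quad_poly c ((1 - t) *\<^sub>R a + t *\<^sub>R b) = \<alpha> + \<beta> * t + \<gamma> * t\<^sup>2"
    using quad_poly_line[of c a b] by blast
  have m: "midpoint a b = (1 - 1/2) *\<^sub>R a + (1/2) *\<^sub>R b"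
    by (simp add: midpoint_def algebra_simps)
  have "\<alpha> = 0" using l[of 0] c[of a] z by simp
  moreover have "\<alpha> + \<beta> + \<gamma> = 0" using l[of 1] c[of b] z by simp
  moreover have "\<alpha> + \<beta> / 2 + \<gamma> / 4 = 0"
    using l[of "1/2"] c[of "midpoint a b"] z unfolding m[symmetric] by (simp add: power2_eq_square)
  ultimately have "\<alpha> = 0" "\<beta> = 0" "\<gamma> = 0" by linarith+
  then show ?thesis using c[OF x] x l unfolding in_segment by auto
qed

lemma is_poly_on_subset: "is_poly_on k S w \<Longrightarrow> S' \<subseteq> S \<Longrightarrow> is_poly_on k S' w"
  unfolding is_poly_on_def by blast

text \<open>In the rescaled variable \<open>z\<close> the set contains a ball of fixed radius
  \<open>K\<close>, so \<open>coeffs_bound\<close> applies with a constant that depends on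
  \<open>K\<close> alone. The two-dimensional change of variables produces the factor 1/h^2.\<close>

lemma coeffs_estimate:
  fixes K :: real
  assumes "K > 0"
  obtains C where "C > 0"
    "\<And>h T w c0. h > 0 \<Longrightarrow> compact T \<Longrightarrow> cball c0 (K * h) \<subseteq> T \<Longrightarrow> is_poly_on 2 T w \<Longrightarrow>
      \<exists>q. (\<forall>z. c0 + h *\<^sub>R z \<in> T \<longrightarrow> w (c0 + h *\<^sub>R z) = quad_poly q z) \<and>
        (norm q)\<^sup>2 \<le> C / h\<^sup>2 * (LINT x:T|lebesgue. (w x)\<^sup>2)"
proof -
  \<comment> \<open>Half of \<open>K\<close> keeps the square inside the ball of radius
    \<open>K\<close>, since the norm is at most the sum of the two absolute coordinates.\<close>
  define s where "s = K / 2"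
  have s: "s > 0" using assms by (simp add: s_def)
  obtain C where C: "C > 0" "\<And>c. (norm c)\<^sup>2 \<le> C * integral (sq s) (\<lambda>y. (quad_poly c y)\<^sup>2)"
    using coeffs_bound[OF s] by blast
  show ?thesis
  proof (rule that[OF C(1)])
    fix h :: real and T :: "pt set" and w c0
    assume h: "h > 0" and T: "compact T" "cball c0 (K * h) \<subseteq> T" and w: "is_poly_on 2 T w"
    obtain q where q: "\<And>x. x \<in> T \<Longrightarrow> w x = quad_poly q x" using w unfolding is_poly_on_2_iff by blast
    obtain q' where q': "\<And>z. quad_poly q (c0 + h *\<^sub>R z) = quad_poly q' z" using quad_poly_affine[of q c0 h] by blast
    define S where "S = (\<lambda>z. c0 + h *\<^sub>R z) ` sq s"
    have S_T: "S \<subseteq> T"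
    proof
      fix y assume "y \<in> S"
      then obtain z where z: "y = c0 + h *\<^sub>R z" "z \<in> sq s" by (auto simp: S_def)
      have "\<bar>z $ 1\<bar> \<le> s" "\<bar>z $ 2\<bar> \<le> s" using z(2) by (auto simp: mem_box_cart abs_le_iff minus_le_iff)
      then have "norm z \<le> K"
        using norm_le_l1_cart[of z] by (simp add: sum_2 s_def)
      then have "norm (h *\<^sub>R z) \<le> K * h" using h by (simp add: mult.commute)
      then have "y \<in> cball c0 (K * h)" unfolding z(1) by (simp add: dist_norm)
      then show "y \<in> T" using T(2) by blast
    qed
    have contw: "continuous_on T (\<lambda>x. (w x)\<^sup>2)"
    proof -
      have "continuous_on T (\<lambda>x. (quad_poly q x)\<^sup>2)" by (cases q) (auto intro!: continuous_intros)
      then show ?thesis by (rule continuous_on_eq) (simp add: q)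
    qed
    have wT: "set_integrable lborel T (\<lambda>x. (w x)\<^sup>2)"
      unfolding set_integrable_def using T(1) contw by (rule borel_integrable_compact)
    then have wT': "set_integrable lebesgue T (\<lambda>x. (w x)\<^sup>2)"
      by (simp add: set_integrable_def integrable_completion)
    have "continuous_on S (\<lambda>x. (w x)\<^sup>2)" using contw S_T by (rule continuous_on_subset)
    moreover have "compact S" unfolding S_def by (intro compact_continuous_image continuous_intros) auto
    ultimately have "set_integrable lborel S (\<lambda>x. (w x)\<^sup>2)"
      unfolding set_integrable_def by (intro borel_integrable_compact)
    then have wS: "set_integrable lebesgue S (\<lambda>x. (w x)\<^sup>2)"
      by (simp add: set_integrable_def integrable_completion)
    have "(norm q')\<^sup>2 \<le> C * integral (sq s) (\<lambda>y. (quad_poly q' y)\<^sup>2)" by (rule C)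
    also have "integral (sq s) (\<lambda>y. (quad_poly q' y)\<^sup>2) = integral (sq s) (\<lambda>z. (w (c0 + h *\<^sub>R z))\<^sup>2)"
      by (rule integral_cong) (use S_T q q' in \<open>auto simp: S_def\<close>)
    also have "\<dots> = integral S (\<lambda>x. (w x)\<^sup>2) / h\<^sup>2"
      using integral_cbox_scaled[OF h, of "\<lambda>x. (w x)\<^sup>2" c0 s] h
        set_lebesgue_integral_eq_integral(1)[OF wS] by (simp add: S_def)
    also have "integral S (\<lambda>x. (w x)\<^sup>2) \<le> integral T (\<lambda>x. (w x)\<^sup>2)"
      using S_T set_lebesgue_integral_eq_integral(1)[OF wS] set_lebesgue_integral_eq_integral(1)[OF wT']
      by (intro integral_subset_le) auto
    also have "integral T (\<lambda>x. (w x)\<^sup>2) = (LINT x:T|lebesgue. (w x)\<^sup>2)"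
      using set_lebesgue_integral_eq_integral(2)[OF wT'] by simp
    finally have n: "(norm q')\<^sup>2 \<le> C / h\<^sup>2 * (LINT x:T|lebesgue. (w x)\<^sup>2)"
      using C h by (simp add: divide_right_mono)
    have "\<forall>z. c0 + h *\<^sub>R z \<in> T \<longrightarrow> w (c0 + h *\<^sub>R z) = quad_poly q' z"
      using q q' by simp
    then show "\<exists>q. (\<forall>z. c0 + h *\<^sub>R z \<in> T \<longrightarrow> w (c0 + h *\<^sub>R z) = quad_poly q z) \<and>
        (norm q)\<^sup>2 \<le> C / h\<^sup>2 * (LINT x:T|lebesgue. (w x)\<^sup>2)"
      using n by blast
  qed
qed

text \<open>After rescaling, points of \<open>T\<close> are at distance at most
  \<open>2 * K'\<close> from the centre of the inner ball, where a quadratic is bounded by its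
  coefficients.\<close>

lemma inverse_estimate:
  fixes K K' :: real
  assumes "K > 0" "K' > 0"
  obtains C where "C > 0"
    "\<And>h T w c0 c1 x. h > 0 \<Longrightarrow> compact T \<Longrightarrow> cball c0 (K * h) \<subseteq> T \<Longrightarrow> T \<subseteq> cball c1 (K' * h) \<Longrightarrow>
      is_poly_on 2 T w \<Longrightarrow> x \<in> T \<Longrightarrow> (w x)\<^sup>2 \<le> C / h\<^sup>2 * (LINT x:T|lebesgue. (w x)\<^sup>2)"
proof -
  obtain C where C: "C > 0" "\<And>h T w c0. h > 0 \<Longrightarrow> compact T \<Longrightarrow> cball c0 (K * h) \<subseteq> T \<Longrightarrow> is_poly_on 2 T w \<Longrightarrow>
      \<exists>q. (\<forall>z. c0 + h *\<^sub>R z \<in> T \<longrightarrow> w (c0 + h *\<^sub>R z) = quad_poly q z) \<and>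
        (norm q)\<^sup>2 \<le> C / h\<^sup>2 * (LINT x:T|lebesgue. (w x)\<^sup>2)"
    using coeffs_estimate[OF assms(1)] by blast
  \<comment> \<open>Bound of the sum of the absolute monomials of degree at most 2 when both
    coordinates are at most \<open>k = 2 * K'\<close>:
    \<open>1 + 2 * k + 3 * k\<^sup>2\<close>.\<close>
  define B where "B = 1 + 4 * K' + 12 * K'\<^sup>2"
  have B: "B > 0" using assms by (auto simp: B_def intro!: add_pos_nonneg)
  show ?thesis
  proof (rule that[of "B\<^sup>2 * C"])
    show "B\<^sup>2 * C > 0" using B C by simp
    fix h :: real and T :: "pt set" and w c0 c1 x
    assume h: "h > 0" and T: "compact T" "cball c0 (K * h) \<subseteq> T" "T \<subseteq> cball c1 (K' * h)"
      and w: "is_poly_on 2 T w" and x: "x \<in> T"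
    obtain q' where q': "\<And>z. c0 + h *\<^sub>R z \<in> T \<Longrightarrow> w (c0 + h *\<^sub>R z) = quad_poly q' z"
      and n: "(norm q')\<^sup>2 \<le> C / h\<^sup>2 * (LINT x:T|lebesgue. (w x)\<^sup>2)"
      using C(2)[OF h T(1,2) w] by blast
    define z where "z = (1 / h) *\<^sub>R (x - c0)"
    have xz: "x = c0 + h *\<^sub>R z" using h by (simp add: z_def)
    have "c0 \<in> T" using T(2) assms h by (auto intro!: subsetD[OF T(2)])
    then have "dist c1 c0 \<le> K' * h" "dist c1 x \<le> K' * h" using T(3) x by auto
    then have "norm (x - c0) \<le> 2 * K' * h"
      using dist_triangle3[of x c0 c1] by (simp add: dist_norm)
    then have nz: "norm z \<le> 2 * K'"
      unfolding z_def norm_scaleR using h by (simp add: pos_divide_le_eq)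
    define k where "k = 2 * K'"
    have z12: "\<bar>z $ 1\<bar> \<le> k" "\<bar>z $ 2\<bar> \<le> k" 
      using nz component_le_norm_cart[of z 1] component_le_norm_cart[of z 2] by (auto simp: k_def)
    have k: "k \<ge> 0" using assms by (simp add: k_def)
    have "\<bar>quad_poly q' z\<bar> \<le> norm q' * B"
    proof -
      obtain a0 a1 a2 a3 a4 a5 where c: "q' = (a0, a1, a2, a3, a4, a5)" by (cases q') auto
      note N = norm_coeffs_ge[where a=a0 and b=a1 and c=a2 and d=a3 and e=a4 and f=a5, folded c]
      have "\<bar>a1 * z $ 1\<bar> \<le> norm q' * k" "\<bar>a2 * z $ 2\<bar> \<le> norm q' * k"
        unfolding abs_mult by (auto intro!: mult_mono N z12)
      moreover have "\<bar>a3 * (z $ 1)\<^sup>2\<bar> \<le> norm q' * (k * k)"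
        unfolding abs_mult power2_eq_square
        by (rule mult_mono[OF N(4) mult_mono[OF z12(1) z12(1) k abs_ge_zero]]) simp_all
      moreover have "\<bar>a4 * (z $ 1 * z $ 2)\<bar> \<le> norm q' * (k * k)"
        unfolding abs_mult
        by (rule mult_mono[OF N(5) mult_mono[OF z12(1) z12(2) k abs_ge_zero]]) simp_all
      moreover have "\<bar>a5 * (z $ 2)\<^sup>2\<bar> \<le> norm q' * (k * k)"
        unfolding abs_mult power2_eq_square
        by (rule mult_mono[OF N(6) mult_mono[OF z12(2) z12(2) k abs_ge_zero]]) simp_all
      ultimately have "\<bar>quad_poly q' z\<bar> \<le> norm q' + norm q' * k + norm q' * k + norm q' * (k * k) + norm q' * (k * k) + norm q' * (k * k)"
        using N(1) unfolding c quad_poly.simps by linarith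
      then show ?thesis by (simp add: B_def k_def algebra_simps power2_eq_square)
    qed
    moreover have "w x = quad_poly q' z" using q'[of z] x unfolding xz[symmetric] by simp
    ultimately have "\<bar>w x\<bar>\<^sup>2 \<le> (norm q' * B)\<^sup>2" by (intro power_mono) simp_all
    then have "(w x)\<^sup>2 \<le> (norm q' * B)\<^sup>2" by simp
    also have "\<dots> \<le> B\<^sup>2 * (C / h\<^sup>2 * (LINT x:T|lebesgue. (w x)\<^sup>2))"
      using mult_left_mono[OF n, of "B\<^sup>2"] by (simp add: power_mult_distrib mult.commute)
    finally show "(w x)\<^sup>2 \<le> B\<^sup>2 * C / h\<^sup>2 * (LINT x:T|lebesgue. (w x)\<^sup>2)" by (simp add: mult.assoc)
  qed
qed

context meshed_domain
begin

lemma pw_cont_integrable_cell: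
  assumes "pw_cont G" and T: "T \<in> \<T>"
  shows "set_integrable lebesgue T G"
proof (rule absolutely_integrable_spike_set)
  show "set_integrable lebesgue (interior T) G"
    by (rule set_integrable_subset[OF pw_cont_integrable[OF assms(1)]])
      (use interior_cell_subset[OF T] in \<open>simp_all add: borel_open sets_completionI_sets\<close>)
  show "negligible {x \<in> interior T - T. G x \<noteq> 0}"
    by (rule negligible_subset[OF negligible_empty]) (use interior_subset in blast)
  show "negligible {x \<in> T - interior T. G x \<noteq> 0}"
    by (rule negligible_subset[OF negligible_convex_frontier[OF convex_cell[OF T]]])
      (use closure_subset[of T] in \<open>unfold frontier_def, blast\<close>)
qed

text \<open>Off the frontiers a point lies in at most one triangle: a common face that meets the
  interior of a triangle is that triangle, so two triangles sharing such a point contain each other.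
  Nonnegativity covers the rest of the domain.\<close>

lemma sum_cells_le:
  assumes G: "pw_cont G" "\<And>x. G x \<ge> 0" and S: "\<S> \<subseteq> \<T>"
  shows "(\<Sum>T\<in>\<S>. LINT x:T|lebesgue. G x) \<le> intg G"
proof -
  have fin: "finite \<S>" using finite_mesh S finite_subset by blast
  have Tm: "T \<in> sets lebesgue" if "T \<in> \<T>" for T
    using closed_mesh_cell[OF that] by (simp add: borel_closed sets_completionI_sets)
  have GO: "integrable lebesgue (\<lambda>x. indicator \<Omega> x *\<^sub>R G x)"
    using pw_cont_integrable[OF G(1)] by (simp add: set_integrable_def)
  have AEf: "AE x in lebesgue. x \<notin> (\<Union>T\<in>\<T>. frontier T)"
    using negligible_Union_frontier by (simp only: negligible_iff_null_sets AE_not_in)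
  have GTi: "integrable lebesgue (\<lambda>x. indicator T x *\<^sub>R G x)" if "T \<in> \<S>" for T
    using pw_cont_integrable_cell[OF G(1), of T] S that unfolding set_integrable_def by blast
  have "(\<Sum>T\<in>\<S>. LINT x:T|lebesgue. G x) = (LINT x|lebesgue. (\<Sum>T\<in>\<S>. indicator T x *\<^sub>R G x))"
    unfolding set_lebesgue_integral_def
    by (rule Bochner_Integration.integral_sum[symmetric, OF GTi])
  also have "\<dots> \<le> (LINT x|lebesgue. indicator \<Omega> x *\<^sub>R G x)"
  proof (rule integral_mono_AE[OF _ GO])
    show "integrable lebesgue (\<lambda>x. \<Sum>T\<in>\<S>. indicator T x *\<^sub>R G x)"
      by (rule Bochner_Integration.integrable_sum[OF GTi])
    show "AE x in lebesgue. (\<Sum>T\<in>\<S>. indicator T x *\<^sub>R G x) \<le> indicator \<Omega> x *\<^sub>R G x"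
      using AEf
    proof (rule AE_mp, intro AE_I2 impI)
      fix x assume x: "x \<notin> (\<Union>T\<in>\<T>. frontier T)"
      have int: "x \<in> interior T" if "x \<in> T" "T \<in> \<T>" for T
        using that x closure_subset[of T] unfolding frontier_def by blast
      show "(\<Sum>T\<in>\<S>. indicator T x *\<^sub>R G x) \<le> indicator \<Omega> x *\<^sub>R G x"
      proof (cases "\<exists>T\<in>\<S>. x \<in> T")
        case True
        then obtain T where T: "T \<in> \<S>" "x \<in> T" by blast
        then have TT: "T \<in> \<T>" using S by blast
        have xO: "x \<in> \<Omega>" using int[OF T(2) TT] interior_cell_subset[OF TT] by blast
        have uniq: "T' = T" if T': "T' \<in> \<S>" "x \<in> T'" for T'
        proof -
          have TT': "T' \<in> \<T>" using T' S by blast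
          have *: "A \<subseteq> B" if AB: "A \<in> \<T>" "B \<in> \<T>" "x \<in> A" "x \<in> B" for A B
          proof -
            have "A \<subseteq> A \<inter> B"
            proof (rule subset_of_face_of[OF Int_face[OF AB(1,2)] order_refl])
              show "(A \<inter> B) \<inter> rel_interior A \<noteq> {}"
                using int[OF AB(3,1)] AB(4) interior_subset_rel_interior[of A] interior_subset[of A]
                by blast
            qed
            then show ?thesis by blast
          qed
          show ?thesis using *[OF TT TT' T(2) T'(2)] *[OF TT' TT T'(2) T(2)] by blast
        qed
        have "(\<Sum>T'\<in>\<S>. indicator T' x *\<^sub>R G x) = (\<Sum>T'\<in>{T}. indicator T' x *\<^sub>R G x)"
        proof (rule sum.mono_neutral_right[OF fin])
          show "\<forall>T'\<in>\<S> - {T}. indicator T' x *\<^sub>R G x = 0"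
          proof
            fix T' assume "T' \<in> \<S> - {T}"
            then have "x \<notin> T'" using uniq by blast
            then show "indicator T' x *\<^sub>R G x = 0" by simp
          qed
        qed (use T in simp)
        then show ?thesis using T xO by simp
      next
        case False
        then have "(\<Sum>T\<in>\<S>. indicator T x *\<^sub>R G x) = 0" by (intro sum.neutral) simp
        then show ?thesis using G(2) by simp
      qed
    qed
  qed
  finally show ?thesis unfolding set_lebesgue_integral_def .
qed

end

section \<open>Poincare and trace inequalities\<close>

lemma cauchy_schwarz_4:
  fixes x1 :: real
  shows "(x1 * y1 + x2 * y2 + x3 * y3 + x4 * y4)\<^sup>2
    \<le> (x1\<^sup>2 + x2\<^sup>2 + x3\<^sup>2 + x4\<^sup>2) * (y1\<^sup>2 + y2\<^sup>2 + y3\<^sup>2 + y4\<^sup>2)"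
proof -
  have "(x1\<^sup>2 + x2\<^sup>2 + x3\<^sup>2 + x4\<^sup>2) * (y1\<^sup>2 + y2\<^sup>2 + y3\<^sup>2 + y4\<^sup>2)
      - (x1 * y1 + x2 * y2 + x3 * y3 + x4 * y4)\<^sup>2
    = (x1 * y2 - x2 * y1)\<^sup>2 + (x1 * y3 - x3 * y1)\<^sup>2 + (x1 * y4 - x4 * y1)\<^sup>2
      + (x2 * y3 - x3 * y2)\<^sup>2 + (x2 * y4 - x4 * y2)\<^sup>2 + (x3 * y4 - x4 * y3)\<^sup>2"
    by (simp add: power2_eq_square algebra_simps)
  also have "\<dots> \<ge> 0" by (intro add_nonneg_nonneg zero_le_power2)
  finally show ?thesis by simp
qed

lemma V_space_diff: "u \<in> V_space \<Omega> \<T> \<Longrightarrow> v \<in> V_space \<Omega> \<T> \<Longrightarrow> (\<lambda>x. u x - v x) \<in> V_space \<Omega> \<T>"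
proof -
  assume uv: "u \<in> V_space \<Omega> \<T>" "v \<in> V_space \<Omega> \<T>"
  have "is_poly_on 2 T (\<lambda>x. (u x - v x) $ i)" if "T \<in> \<T>" for T i
  proof -
    obtain c c' where "\<forall>x\<in>T. u x $ i = quad_poly c x" "\<forall>x\<in>T. v x $ i = quad_poly c' x"
      using uv \<open>T \<in> \<T>\<close> unfolding V_space_def is_poly_on_2_iff by blast
    then have "\<forall>x\<in>T. (u x - v x) $ i = quad_poly (c - c') x" by (simp add: quad_poly_diff)
    then show ?thesis unfolding is_poly_on_2_iff by blast
  qed
  then show ?thesis using uv by (auto simp: V_space_def intro!: continuous_intros)
qed

lemma Vn_space_diff:
  "u \<in> Vn_space \<Omega> \<Gamma>0 \<Gamma>1 n \<T> \<Longrightarrow> v \<in> Vn_space \<Omega> \<Gamma>0 \<Gamma>1 n \<T> \<Longrightarrow> (\<lambda>x. u x - v x) \<in> Vn_space \<Omega> \<Gamma>0 \<Gamma>1 n \<T>"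
  using V_space_diff[of u \<Omega> \<T> v] by (simp add: Vn_space_def inner_diff_left)

section \<open>Strain energy and estimates in one direction\<close>

context meshed_domain
begin

abbreviation "Vh \<equiv> V_space \<Omega> \<T>"

lemma V_poly: "v \<in> Vh \<Longrightarrow> T \<in> \<T> \<Longrightarrow> is_poly_on 2 T (\<lambda>x. v x $ i)"
  unfolding V_space_def by blast

lemma V_poly_inner:
  assumes "v \<in> Vh" "T \<in> \<T>" shows "is_poly_on 2 T (\<lambda>x. d \<bullet> v x)"
proof -
  obtain c c' where c: "\<forall>x\<in>T. v x $ 1 = quad_poly c x" "\<forall>x\<in>T. v x $ 2 = quad_poly c' x"
    using V_poly[OF assms] unfolding is_poly_on_2_iff by blast
  have "\<forall>x\<in>T. d \<bullet> v x = quad_poly (d $ 1 *\<^sub>R c + d $ 2 *\<^sub>R c') x"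
    using c by (simp add: inner_pt quad_poly_add quad_poly_scale)
  then show ?thesis unfolding is_poly_on_2_iff by blast
qed

lemma pw_C1_poly: "(\<And>T. T \<in> \<T> \<Longrightarrow> is_poly_on k T w) \<Longrightarrow> pw_C1 w"
  unfolding pw_C1_def using is_poly_on_C1 by metis

lemma pw_C1_V: "v \<in> Vh \<Longrightarrow> pw_C1 (\<lambda>x. v x $ i)"
  using V_poly pw_C1_poly by blast

lemma pw_C1_V_inner: "v \<in> Vh \<Longrightarrow> pw_C1 (\<lambda>x. d \<bullet> v x)"
  using V_poly_inner pw_C1_poly by blast

lemma pw_cont_partial: "v \<in> Vh \<Longrightarrow> pw_cont (partial v i j)"
  using pw_cont_dir_deriv[OF pw_C1_V, of v "axis j 1" i] by (simp add: partial_eq_dir_deriv[abs_def])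

lemma pw_cont_strain: "v \<in> Vh \<Longrightarrow> pw_cont (strain v i j)"
  unfolding strain_def[abs_def] by (intro pw_cont_divide pw_cont_add pw_cont_partial)

definition energy :: "vfield \<Rightarrow> real" where
  "energy v = intg (\<lambda>x. \<Sum>i\<in>UNIV. \<Sum>j\<in>UNIV. (strain v i j x)\<^sup>2)"

lemma energy_nonneg: "energy v \<ge> 0"
  unfolding energy_def by (intro intg_nonneg sum_nonneg zero_le_power2)

lemma pw_cont_energy: "v \<in> Vh \<Longrightarrow> pw_cont (\<lambda>x. \<Sum>i\<in>UNIV. \<Sum>j\<in>UNIV. (strain v i j x)\<^sup>2)"
  by (intro pw_cont_sum pw_cont_power pw_cont_strain)

lemma form_a_self: "v \<in> Vh \<Longrightarrow> form_a \<Omega> \<nu> v v = 2 * \<nu> * energy v"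
  unfolding form_a_def energy_def
  by (simp add: intg_sum pw_cont_sum pw_cont_power pw_cont_strain power2_eq_square[symmetric])

lemma dir_deriv_inner_strain:
  assumes v: "v \<in> Vh" and x: "x \<in> cells"
  shows "dir_deriv d (\<lambda>x. d \<bullet> v x) x = (d $ 1)\<^sup>2 * strain v 1 1 x + (d $ 1 * d $ 2) * strain v 1 2 x
    + (d $ 2 * d $ 1) * strain v 2 1 x + (d $ 2)\<^sup>2 * strain v 2 2 x"
proof -
  note p = pw_C1_V[OF v]
  have "dir_deriv d (\<lambda>x. d \<bullet> v x) x = d $ 1 * dir_deriv d (\<lambda>x. v x $ 1) x + d $ 2 * dir_deriv d (\<lambda>x. v x $ 2) x"
    unfolding inner_pt using dir_deriv_add[OF pw_C1_cmult[OF p] pw_C1_cmult[OF p] x] dir_deriv_cmult[OF p x] by simp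
  then show ?thesis
    using dir_deriv_components[OF p x, of d]
    by (simp add: strain_def partial_eq_dir_deriv power2_eq_square algebra_simps)
qed

text \<open>The derivative is the Frobenius product of the strain with the matrix of entries
  \<open>d $ i * d $ j\<close>, whose Frobenius norm is \<open>d \<bullet> d\<close>.\<close>

lemma dir_deriv_inner_bound:
  assumes v: "v \<in> Vh" and x: "x \<in> cells"
  shows "(dir_deriv d (\<lambda>x. d \<bullet> v x) x)\<^sup>2 \<le> (d \<bullet> d)\<^sup>2 * (\<Sum>i\<in>UNIV. \<Sum>j\<in>UNIV. (strain v i j x)\<^sup>2)"
proof -
  have "(dir_deriv d (\<lambda>x. d \<bullet> v x) x)\<^sup>2 \<le> (((d $ 1)\<^sup>2)\<^sup>2 + (d $ 1 * d $ 2)\<^sup>2 + (d $ 2 * d $ 1)\<^sup>2 + ((d $ 2)\<^sup>2)\<^sup>2)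
    * ((strain v 1 1 x)\<^sup>2 + (strain v 1 2 x)\<^sup>2 + (strain v 2 1 x)\<^sup>2 + (strain v 2 2 x)\<^sup>2)"
    unfolding dir_deriv_inner_strain[OF assms] by (rule cauchy_schwarz_4)
  also have "((d $ 1)\<^sup>2)\<^sup>2 + (d $ 1 * d $ 2)\<^sup>2 + (d $ 2 * d $ 1)\<^sup>2 + ((d $ 2)\<^sup>2)\<^sup>2 = (d \<bullet> d)\<^sup>2"
    by (simp add: inner_pt power2_eq_square algebra_simps)
  finally show ?thesis by (simp add: sum_2 algebra_simps)
qed

lemma intg_dir_deriv_inner_bound:
  assumes v: "v \<in> Vh"
  shows "intg (\<lambda>x. (dir_deriv d (\<lambda>x. d \<bullet> v x) x)\<^sup>2) \<le> (d \<bullet> d)\<^sup>2 * energy v"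
proof -
  have "intg (\<lambda>x. (dir_deriv d (\<lambda>x. d \<bullet> v x) x)\<^sup>2)
      \<le> intg (\<lambda>x. (d \<bullet> d)\<^sup>2 * (\<Sum>i\<in>UNIV. \<Sum>j\<in>UNIV. (strain v i j x)\<^sup>2))"
    by (rule intg_mono) (intro pw_cont_power pw_cont_dir_deriv pw_C1_V_inner v pw_cont_cmult pw_cont_energy dir_deriv_inner_bound)+
  then show ?thesis unfolding intg_cmult energy_def .
qed

text \<open>Integrate the \<open>d\<close>-derivative of \<open>\<theta>(\<psi>) (d \<bullet> v)\<^sup>2\<close>, where \<open>\<psi>\<close> is an affine function that
  vanishes on the part of the boundary where \<open>v\<close> does not. With \<open>\<theta>\<close> the identity this gives a
  Poincare inequality, and with \<open>\<theta>\<close> a bounded function that is steep near 0 it controls \<open>v\<close> on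
  a thin strip. Only \<open>d \<bullet> \<epsilon>(v) d\<close> occurs, so Korn's inequality is not needed.\<close>

context
  fixes v :: vfield and z n d :: pt and R :: real
  assumes v: "v \<in> Vh" and zero: "\<And>x. x \<in> frontier \<Omega> \<Longrightarrow> v x = 0 \<or> (x - z) \<bullet> n = 0"
    and dn: "d \<bullet> n = 1" and R: "\<And>x. x \<in> \<Omega> \<Longrightarrow> \<bar>(x - z) \<bullet> n\<bar> \<le> R"
begin

lemma C1_psi: "C1 (\<lambda>x. (x - z) \<bullet> n)"
  unfolding inner_pt by (auto intro!: C1_intros)

lemma pw_C1_psi: "pw_C1 (\<lambda>x. (x - z) \<bullet> n)"
  by (rule pw_C1_C1[OF C1_psi])

lemma dir_deriv_psi: "dir_deriv d (\<lambda>x. (x - z) \<bullet> n) x = 1"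
proof -
  have "((\<lambda>t. (x + t *\<^sub>R d - z) \<bullet> n) has_real_derivative d \<bullet> n) (at 0)"
    by (auto intro!: derivative_eq_intros simp: inner_diff_left inner_add_left)
  then show ?thesis using dn unfolding dir_deriv_def by (simp add: DERIV_imp_deriv)
qed

lemma weighted_identity:
  assumes \<theta>: "pw_C1 \<theta>" and \<theta>0: "\<And>x. (x - z) \<bullet> n = 0 \<Longrightarrow> \<theta> x = 0"
  shows "intg (\<lambda>x. dir_deriv d \<theta> x * (d \<bullet> v x)\<^sup>2 + 2 * \<theta> x * (d \<bullet> v x) * dir_deriv d (\<lambda>x. d \<bullet> v x) x) = 0"
proof -
  note w = pw_C1_V_inner[OF v, of d]
  have "intg (dir_deriv d (\<lambda>x. \<theta> x * (d \<bullet> v x)\<^sup>2)) = 0"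
  proof (rule intg_dir_deriv_eq_0)
    show "pw_C1 (\<lambda>x. \<theta> x * (d \<bullet> v x)\<^sup>2)" by (intro pw_C1_mult pw_C1_power \<theta> w)
    show "\<theta> x * (d \<bullet> v x)\<^sup>2 = 0" if "x \<in> frontier \<Omega>" for x
      using zero[OF that] \<theta>0 by auto
  qed
  moreover have "intg (dir_deriv d (\<lambda>x. \<theta> x * (d \<bullet> v x)\<^sup>2))
    = intg (\<lambda>x. dir_deriv d \<theta> x * (d \<bullet> v x)\<^sup>2 + 2 * \<theta> x * (d \<bullet> v x) * dir_deriv d (\<lambda>x. d \<bullet> v x) x)"
  proof (rule intg_cong)
    show "pw_cont (dir_deriv d (\<lambda>x. \<theta> x * (d \<bullet> v x)\<^sup>2))" by (intro pw_cont_dir_deriv pw_C1_mult pw_C1_power \<theta> w)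
    show "pw_cont (\<lambda>x. dir_deriv d \<theta> x * (d \<bullet> v x)\<^sup>2 + 2 * \<theta> x * (d \<bullet> v x) * dir_deriv d (\<lambda>x. d \<bullet> v x) x)"
      by (intro pw_cont_add pw_cont_mult pw_cont_const pw_cont_dir_deriv pw_cont_power \<theta> w pw_C1_pw_cont)
    fix x assume x: "x \<in> cells"
    show "dir_deriv d (\<lambda>x. \<theta> x * (d \<bullet> v x)\<^sup>2) x = dir_deriv d \<theta> x * (d \<bullet> v x)\<^sup>2 + 2 * \<theta> x * (d \<bullet> v x) * dir_deriv d (\<lambda>x. d \<bullet> v x) x"
      using dir_deriv_mult[OF \<theta> pw_C1_mult[OF w w] x] dir_deriv_mult[OF w w x]
      by (simp add: power2_eq_square algebra_simps)
  qed
  ultimately show ?thesis by simp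
qed

lemma poincare_direction:
  "intg (\<lambda>x. (d \<bullet> v x)\<^sup>2) \<le> 4 * R\<^sup>2 * intg (\<lambda>x. (dir_deriv d (\<lambda>x. d \<bullet> v x) x)\<^sup>2)"
proof -
  note w = pw_C1_V_inner[OF v, of d]
  let ?w = "\<lambda>x. d \<bullet> v x" and ?D = "dir_deriv d (\<lambda>x. d \<bullet> v x)" and ?\<psi> = "\<lambda>x. (x - z) \<bullet> n"
  note pc = pw_C1_pw_cont[OF w] pw_cont_dir_deriv[OF w] pw_C1_pw_cont[OF pw_C1_psi]
  have "intg (\<lambda>x. 1/2 * (?w x)\<^sup>2 - 2 * R\<^sup>2 * (?D x)\<^sup>2)
    \<le> intg (\<lambda>x. dir_deriv d ?\<psi> x * (?w x)\<^sup>2 + 2 * ?\<psi> x * ?w x * ?D x)"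
  proof (rule intg_mono)
    show "pw_cont (\<lambda>x. 1/2 * (?w x)\<^sup>2 - 2 * R\<^sup>2 * (?D x)\<^sup>2)"
      by (intro pw_cont_diff pw_cont_cmult pw_cont_power pc)
    show "pw_cont (\<lambda>x. dir_deriv d ?\<psi> x * (?w x)\<^sup>2 + 2 * ?\<psi> x * ?w x * ?D x)"
      by (intro pw_cont_add pw_cont_mult pw_cont_const pw_cont_power pc pw_cont_dir_deriv pw_C1_psi)
    fix x assume x: "x \<in> cells"
    have "(?\<psi> x)\<^sup>2 \<le> R\<^sup>2" using R[of x] cells_subset x by (simp add: abs_le_square_iff[symmetric] subset_iff)
    then have "(?\<psi> x)\<^sup>2 * (?D x)\<^sup>2 \<le> R\<^sup>2 * (?D x)\<^sup>2" by (intro mult_right_mono) auto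
    \<comment> \<open>Half of this square absorbs the mixed term at the cost of half of the square
      of \<open>?w x\<close>; solving for the integral then doubles \<open>2 * R\<^sup>2\<close> to
      the constant of the claim.\<close>
    moreover have "0 \<le> (?w x + 2 * ?\<psi> x * ?D x)\<^sup>2" by simp
    ultimately have "1/2 * (?w x)\<^sup>2 - 2 * R\<^sup>2 * (?D x)\<^sup>2 \<le> (?w x)\<^sup>2 + 2 * ?\<psi> x * ?w x * ?D x"
      by (simp add: power2_eq_square algebra_simps)
    then show "1/2 * (?w x)\<^sup>2 - 2 * R\<^sup>2 * (?D x)\<^sup>2 \<le> dir_deriv d ?\<psi> x * (?w x)\<^sup>2 + 2 * ?\<psi> x * ?w x * ?D x"
      by (simp add: dir_deriv_psi)
  qed
  also have "\<dots> = 0" by (rule weighted_identity[OF pw_C1_psi]) simp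
  also have "intg (\<lambda>x. 1/2 * (?w x)\<^sup>2 - 2 * R\<^sup>2 * (?D x)\<^sup>2)
    = 1/2 * intg (\<lambda>x. (?w x)\<^sup>2) - 2 * R\<^sup>2 * intg (\<lambda>x. (?D x)\<^sup>2)"
    using intg_diff[OF pw_cont_cmult[OF pw_cont_power[OF pc(1)]] pw_cont_cmult[OF pw_cont_power[OF pc(2)]]]
    unfolding intg_cmult .
  finally show ?thesis by simp
qed

text \<open>The weight is the derivative of \<open>?\<theta>\<close>, of order 1/h at distance O(h)
  from the line, while \<open>?\<theta>\<close> is bounded by 2 for every \<open>h\<close>. The
  mixed term therefore costs only two integrals free of \<open>h\<close>, and
  \<open>poincare_direction\<close> turns them into \<open>2 * (4 * R\<^sup>2) + 2\<close>.\<close>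

lemma strip_direction:
  assumes h: "h > 0"
  shows "intg (\<lambda>x. 1 / h / (1 + ((x - z) \<bullet> n / h)\<^sup>2) * (d \<bullet> v x)\<^sup>2)
    \<le> (8 * R\<^sup>2 + 2) * intg (\<lambda>x. (dir_deriv d (\<lambda>x. d \<bullet> v x) x)\<^sup>2)"
proof -
  note w = pw_C1_V_inner[OF v, of d]
  let ?w = "\<lambda>x. d \<bullet> v x" and ?D = "dir_deriv d (\<lambda>x. d \<bullet> v x)" and ?\<psi> = "\<lambda>x. (x - z) \<bullet> n"
  let ?\<theta> = "\<lambda>x. arctan (1 / h * ?\<psi> x)" and ?\<omega> = "\<lambda>x. 1 / h / (1 + ((x - z) \<bullet> n / h)\<^sup>2)"
  have \<theta>: "pw_C1 ?\<theta>"
    by (intro pw_C1_C1 C1_arctan C1_cmult C1_psi)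
  have d\<theta>: "dir_deriv d ?\<theta> x = ?\<omega> x" for x
  proof -
    have "((\<lambda>t. arctan (1 / h * ((x + t *\<^sub>R d - z) \<bullet> n))) has_real_derivative ?\<omega> x) (at 0)"
      using dn h by (auto intro!: derivative_eq_intros simp: inner_diff_left inner_add_left divide_inverse mult.commute)
    then show ?thesis unfolding dir_deriv_def by (rule DERIV_imp_deriv)
  qed
  have p\<omega>: "pw_cont ?\<omega>"
  proof (rule pw_cont_cont)
    have "1 + ((x - z) \<bullet> n / h)\<^sup>2 \<noteq> 0" for x using zero_le_power2[of "(x - z) \<bullet> n / h"] by linarith
    then show "continuous_on UNIV ?\<omega>" using h by (intro continuous_intros) auto
  qed
  note pc = pw_C1_pw_cont[OF w] pw_cont_dir_deriv[OF w] pw_C1_pw_cont[OF \<theta>] p\<omega>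
  have "intg (\<lambda>x. ?\<omega> x * (?w x)\<^sup>2 - (2 * (?w x)\<^sup>2 + 2 * (?D x)\<^sup>2))
    \<le> intg (\<lambda>x. dir_deriv d ?\<theta> x * (?w x)\<^sup>2 + 2 * ?\<theta> x * ?w x * ?D x)"
  proof (rule intg_mono)
    show "pw_cont (\<lambda>x. ?\<omega> x * (?w x)\<^sup>2 - (2 * (?w x)\<^sup>2 + 2 * (?D x)\<^sup>2))"
      by (intro pw_cont_diff pw_cont_mult pw_cont_add pw_cont_const pw_cont_power pc)
    show "pw_cont (\<lambda>x. dir_deriv d ?\<theta> x * (?w x)\<^sup>2 + 2 * ?\<theta> x * ?w x * ?D x)"
      by (intro pw_cont_add pw_cont_mult pw_cont_const pw_cont_power pc pw_cont_dir_deriv \<theta>)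
    fix x
    have "\<bar>?\<theta> x\<bar> < pi / 2" using arctan_bounded[of "1 / h * ?\<psi> x"] by linarith
    then have "\<bar>?\<theta> x\<bar> \<le> 2" using pi_less_4 by linarith
    then have "\<bar>?\<theta> x\<bar> * \<bar>?w x * ?D x\<bar> \<le> 2 * \<bar>?w x * ?D x\<bar>" by (intro mult_right_mono) auto
    then have "\<bar>?\<theta> x * (?w x * ?D x)\<bar> \<le> 2 * (\<bar>?w x\<bar> * \<bar>?D x\<bar>)" by (simp add: abs_mult)
    moreover have "2 * (\<bar>?w x\<bar> * \<bar>?D x\<bar>) \<le> (?w x)\<^sup>2 + (?D x)\<^sup>2"
      using sum_squares_bound[of "\<bar>?w x\<bar>" "\<bar>?D x\<bar>"] by simp
    ultimately have "- (2 * (?w x)\<^sup>2 + 2 * (?D x)\<^sup>2) \<le> 2 * (?\<theta> x * (?w x * ?D x))" by linarith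
    then show "?\<omega> x * (?w x)\<^sup>2 - (2 * (?w x)\<^sup>2 + 2 * (?D x)\<^sup>2) \<le> dir_deriv d ?\<theta> x * (?w x)\<^sup>2 + 2 * ?\<theta> x * ?w x * ?D x"
      unfolding d\<theta> by (simp add: mult.assoc)
  qed
  also have "\<dots> = 0" by (rule weighted_identity[OF \<theta>]) simp
  also have "intg (\<lambda>x. ?\<omega> x * (?w x)\<^sup>2 - (2 * (?w x)\<^sup>2 + 2 * (?D x)\<^sup>2))
    = intg (\<lambda>x. ?\<omega> x * (?w x)\<^sup>2) - (2 * intg (\<lambda>x. (?w x)\<^sup>2) + 2 * intg (\<lambda>x. (?D x)\<^sup>2))"
  proof -
    have "intg (\<lambda>x. 2 * (?w x)\<^sup>2 + 2 * (?D x)\<^sup>2) = 2 * intg (\<lambda>x. (?w x)\<^sup>2) + 2 * intg (\<lambda>x. (?D x)\<^sup>2)"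
      using intg_add[OF pw_cont_cmult[OF pw_cont_power[OF pc(1)]] pw_cont_cmult[OF pw_cont_power[OF pc(2)]]]
      unfolding intg_cmult .
    then show ?thesis
      using intg_diff[of "\<lambda>x. ?\<omega> x * (?w x)\<^sup>2" "\<lambda>x. 2 * (?w x)\<^sup>2 + 2 * (?D x)\<^sup>2"]
        pw_cont_mult[OF pc(4) pw_cont_power[OF pc(1)]] pw_cont_add[OF pw_cont_cmult[OF pw_cont_power[OF pc(1)]] pw_cont_cmult[OF pw_cont_power[OF pc(2)]]]
      by simp
  qed
  finally have "intg (\<lambda>x. ?\<omega> x * (?w x)\<^sup>2) \<le> 2 * intg (\<lambda>x. (?w x)\<^sup>2) + 2 * intg (\<lambda>x. (?D x)\<^sup>2)" by simp
  then show ?thesis using poincare_direction by (simp add: algebra_simps)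
qed

end

end

section \<open>Algebra of the multiplier form, and convexity of the multiplier set\<close>

lemma Lam_inner_add_left: "Lam_inner g m M (\<lambda>x. a x + b x) c = Lam_inner g m M a c + Lam_inner g m M b c"
  by (simp add: Lam_inner_def Let_def algebra_simps sum.distrib flip: add_divide_distrib)

lemma Lam_inner_scale_left: "Lam_inner g m M (\<lambda>x. t * a x) c = t * Lam_inner g m M a c"
  by (simp add: Lam_inner_def Let_def sum_distrib_left algebra_simps)

lemma Lam_inner_commute: "Lam_inner g m M a c = Lam_inner g m M c a"
  by (simp add: Lam_inner_def Let_def mult.commute mult.left_commute)

lemma Lam_inner_add_right: "Lam_inner g m M c (\<lambda>x. a x + b x) = Lam_inner g m M c a + Lam_inner g m M c b"
  using Lam_inner_add_left[of g m M a b c] by (simp add: Lam_inner_commute)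

lemma Lam_inner_scale_right: "Lam_inner g m M c (\<lambda>x. t * a x) = t * Lam_inner g m M c a"
  using Lam_inner_scale_left[of g m M t a c] by (simp add: Lam_inner_commute)

lemma Lam_inner_diff_left: "Lam_inner g m M (\<lambda>x. a x - b x) c = Lam_inner g m M a c - Lam_inner g m M b c"
  using Lam_inner_add_left[of g m M a "\<lambda>x. (-1) * b x" c] Lam_inner_scale_left[of g m M "-1" b c] by simp

lemma Lam_inner_diff_right: "Lam_inner g m M c (\<lambda>x. a x - b x) = Lam_inner g m M c a - Lam_inner g m M c b"
  using Lam_inner_diff_left[of g m M a b c] by (simp add: Lam_inner_commute)

lemmas Lam_inner_linear = Lam_inner_add_left Lam_inner_add_right Lam_inner_diff_left
  Lam_inner_diff_right Lam_inner_scale_left Lam_inner_scale_right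

lemma is_poly_on_2_affine:
  assumes "is_poly_on 2 S u" "is_poly_on 2 S v"
  shows "is_poly_on 2 S (\<lambda>x. u x + t * (v x - u x))"
proof -
  obtain c c' where "\<forall>x\<in>S. u x = quad_poly c x" "\<forall>x\<in>S. v x = quad_poly c' x"
    using assms unfolding is_poly_on_2_iff by blast
  then have "\<forall>x\<in>S. u x + t * (v x - u x) = quad_poly (c + t *\<^sub>R (c' - c)) x"
    by (simp add: quad_poly_add quad_poly_scale quad_poly_diff)
  then show ?thesis unfolding is_poly_on_2_iff by blast
qed

lemma Lam_tilde_convex:
  assumes "\<pi> \<in> Lam_tilde \<Gamma>1 \<T> m M" "\<mu> \<in> Lam_tilde \<Gamma>1 \<T> m M" "0 \<le> t" "t \<le> 1"
  shows "(\<lambda>x. \<pi> x + t * (\<mu> x - \<pi> x)) \<in> Lam_tilde \<Gamma>1 \<T> m M"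
proof -
  have "\<bar>\<pi> x + t * (\<mu> x - \<pi> x)\<bar> \<le> 1" if "x \<in> \<Gamma>1 \<inter> mesh_nodes \<T>" for x
  proof -
    have 1: "\<bar>\<pi> x\<bar> \<le> 1" "\<bar>\<mu> x\<bar> \<le> 1" using assms that by (auto simp: Lam_tilde_def)
    have "\<pi> x + t * (\<mu> x - \<pi> x) = (1 - t) * \<pi> x + t * \<mu> x" by (simp add: algebra_simps)
    also have "\<bar>\<dots>\<bar> \<le> (1 - t) * \<bar>\<pi> x\<bar> + t * \<bar>\<mu> x\<bar>"
      using assms by (intro order_trans[OF abs_triangle_ineq]) (simp add: abs_mult)
    also have "\<dots> \<le> (1 - t) * 1 + t * 1"
      using assms 1 by (intro add_mono mult_left_mono) auto
    finally show ?thesis by simp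
  qed
  moreover have "(\<lambda>x. \<pi> x + t * (\<mu> x - \<pi> x)) \<in> Lam_space \<Gamma>1 m M"
    using assms unfolding Lam_tilde_def Lam_space_def
    by (auto intro!: continuous_intros is_poly_on_2_affine)
  ultimately show ?thesis by (auto simp: Lam_tilde_def)
qed

text \<open>On a bounded set the gradient of a quadratic is bounded by its coefficients, and these
  by the L2 norm. As the result serves a single mesh, the constant may depend on \<open>T\<close>,
  and \<open>coeffs_estimate\<close> is used at scale 1.\<close>

lemma grad_estimate:
  assumes T: "compact T" "cball c0 r \<subseteq> T" "r > 0"
  obtains C where "C \<ge> 0"
    "\<And>w x j. is_poly_on 2 T w \<Longrightarrow> x \<in> interior T \<Longrightarrow> (dir_deriv (axis j 1) w x)\<^sup>2 \<le> C * (LINT x:T|lebesgue. (w x)\<^sup>2)"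
proof -
  obtain C where C: "C > 0" "\<And>h T w c0. h > 0 \<Longrightarrow> compact T \<Longrightarrow> cball c0 (r * h) \<subseteq> T \<Longrightarrow> is_poly_on 2 T w \<Longrightarrow>
      \<exists>q. (\<forall>z. c0 + h *\<^sub>R z \<in> T \<longrightarrow> w (c0 + h *\<^sub>R z) = quad_poly q z) \<and>
        (norm q)\<^sup>2 \<le> C / h\<^sup>2 * (LINT x:T|lebesgue. (w x)\<^sup>2)"
    using coeffs_estimate[OF T(3)] by blast
  obtain B where B: "\<And>x. x \<in> T \<Longrightarrow> norm x \<le> B" using compact_imp_bounded[OF T(1)] unfolding bounded_iff by blast
  define k where "k = B + norm c0"
  have k: "k \<ge> 0"
  proof -
    have "c0 \<in> T" using T(2,3) by (auto intro: subsetD[OF T(2)])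
    then show ?thesis using B[of c0] norm_ge_zero[of c0] unfolding k_def by linarith
  qed
  show ?thesis
  proof (rule that[of "(1 + 3 * k)\<^sup>2 * C"])
    show "0 \<le> (1 + 3 * k)\<^sup>2 * C" using C by simp
    fix w x and j :: 2 assume w: "is_poly_on 2 T w" and x: "x \<in> interior T"
    obtain q where q: "\<And>z. c0 + z \<in> T \<Longrightarrow> w (c0 + z) = quad_poly q z"
      "(norm q)\<^sup>2 \<le> C * (LINT x:T|lebesgue. (w x)\<^sup>2)"
      using C(2)[of 1 T c0 w] T w by auto
    define z where "z = x - c0"
    have xT: "x \<in> T" using x interior_subset by blast
    have "norm z \<le> k" using norm_triangle_ineq4[of x c0] B[OF xT] by (simp add: z_def k_def)
    then have z: "\<bar>z $ 1\<bar> \<le> k" "\<bar>z $ 2\<bar> \<le> k"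
      using component_le_norm_cart[of z 1] component_le_norm_cart[of z 2] by linarith+
    obtain a0 a1 a2 a3 a4 a5 where c: "q = (a0, a1, a2, a3, a4, a5)" by (cases q) auto
    note N = norm_coeffs_ge[where a=a0 and b=a1 and c=a2 and d=a3 and e=a4 and f=a5, folded c]
    define p1 where "p1 y = a1 + 2 * a3 * y $ 1 + a4 * y $ 2" for y :: pt
    define p2 where "p2 y = a2 + a4 * y $ 1 + 2 * a5 * y $ 2" for y :: pt
    have der: "(quad_poly q has_derivative (\<lambda>d. p1 y * d $ 1 + p2 y * d $ 2)) (at y)" for y
    proof -
      have "((\<lambda>y. a0 + a1 * y $ 1 + a2 * y $ 2 + a3 * (y $ 1)\<^sup>2 + a4 * (y $ 1 * y $ 2) + a5 * (y $ 2)\<^sup>2)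
        has_derivative (\<lambda>d. p1 y * d $ 1 + p2 y * d $ 2)) (at y)"
        by (auto intro!: derivative_eq_intros bounded_linear_imp_has_derivative[OF bounded_linear_vec_nth]
            simp: p1_def p2_def algebra_simps)
      moreover have "(\<lambda>y. a0 + a1 * y $ 1 + a2 * y $ 2 + a3 * (y $ 1)\<^sup>2 + a4 * (y $ 1 * y $ 2) + a5 * (y $ 2)\<^sup>2) = quad_poly q"
        unfolding c by (simp add: fun_eq_iff)
      ultimately show ?thesis by simp
    qed
    have "((\<lambda>t. w (x + t *\<^sub>R axis j 1)) has_real_derivative (p1 z * axis j 1 $ 1 + p2 z * axis j 1 $ 2)) (at 0)"
    proof (rule has_field_derivative_transform_within_open[OF C1_line_derivative[OF der]])
      show "open ((\<lambda>t. x + t *\<^sub>R axis j 1) -` interior T)"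
        by (intro open_vimage continuous_intros) auto
      show "quad_poly q (z + t *\<^sub>R axis j 1) = w (x + t *\<^sub>R axis j 1)" if "t \<in> (\<lambda>t. x + t *\<^sub>R axis j 1) -` interior T" for t
      proof -
        have e: "c0 + (z + t *\<^sub>R axis j 1) = x + t *\<^sub>R axis j 1" by (simp add: z_def)
        have "x + t *\<^sub>R axis j 1 \<in> T" using that interior_subset by auto
        then show ?thesis using q(1)[of "z + t *\<^sub>R axis j 1"] unfolding e by simp
      qed
    qed (use x in simp)
    then have dir_deriv: "dir_deriv (axis j 1) w x = p1 z * axis j 1 $ 1 + p2 z * axis j 1 $ 2"
      unfolding dir_deriv_def by (rule DERIV_imp_deriv)
    have m: "\<bar>a * b\<bar> \<le> norm q * k" if "\<bar>a\<bar> \<le> norm q" "\<bar>b\<bar> \<le> k" for a b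
      unfolding abs_mult by (rule mult_mono[OF that]) auto
    have "\<bar>p1 z\<bar> \<le> norm q + 2 * (norm q * k) + norm q * k"
      using N(2) m[OF N(4) z(1)] m[OF N(5) z(2)] unfolding p1_def mult.assoc by linarith
    moreover have "\<bar>p2 z\<bar> \<le> norm q + norm q * k + 2 * (norm q * k)"
      using N(3) m[OF N(5) z(1)] m[OF N(6) z(2)] unfolding p2_def mult.assoc by linarith
    ultimately have "\<bar>p1 z\<bar> \<le> (1 + 3 * k) * norm q" "\<bar>p2 z\<bar> \<le> (1 + 3 * k) * norm q"
      by (simp_all add: algebra_simps)
    then have "\<bar>dir_deriv (axis j 1) w x\<bar> \<le> (1 + 3 * k) * norm q"
      unfolding dir_deriv using exhaust_2[of j] by (auto simp: axis_def)
    then have "\<bar>dir_deriv (axis j 1) w x\<bar>\<^sup>2 \<le> ((1 + 3 * k) * norm q)\<^sup>2" by (intro power_mono) auto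
    also have "\<dots> \<le> (1 + 3 * k)\<^sup>2 * (C * (LINT x:T|lebesgue. (w x)\<^sup>2))"
      unfolding power_mult_distrib by (intro mult_left_mono q(2)) simp
    finally show "(dir_deriv (axis j 1) w x)\<^sup>2 \<le> (1 + 3 * k)\<^sup>2 * C * (LINT x:T|lebesgue. (w x)\<^sup>2)"
      by (simp add: mult.assoc)
  qed
qed

section \<open>Linearity and boundedness of the forms on \<open>Vh\<close>\<close>

context meshed_domain
begin

lemma partial_diff:
  assumes "u \<in> Vh" "v \<in> Vh" "x \<in> cells"
  shows "partial (\<lambda>x. u x - v x) i j x = partial u i j x - partial v i j x"
  using dir_deriv_diff[OF pw_C1_V[OF assms(1)] pw_C1_V[OF assms(2)] assms(3)] by (simp add: partial_eq_dir_deriv)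

lemma form_a_diff_left:
  assumes u: "u \<in> Vh" "u' \<in> Vh" and v: "v \<in> Vh"
  shows "form_a \<Omega> \<nu> (\<lambda>x. u x - u' x) v = form_a \<Omega> \<nu> u v - form_a \<Omega> \<nu> u' v"
proof -
  have "intg (\<lambda>x. strain (\<lambda>x. u x - u' x) i j x * strain v i j x)
    = intg (\<lambda>x. strain u i j x * strain v i j x) - intg (\<lambda>x. strain u' i j x * strain v i j x)" for i j
  proof -
    note p = pw_cont_mult[OF pw_cont_strain pw_cont_strain]
    have "intg (\<lambda>x. strain (\<lambda>x. u x - u' x) i j x * strain v i j x)
      = intg (\<lambda>x. strain u i j x * strain v i j x - strain u' i j x * strain v i j x)"
      by (rule intg_cong[OF p[OF V_space_diff[OF u] v] pw_cont_diff[OF p[OF u(1) v] p[OF u(2) v]]])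
        (simp add: strain_def partial_diff[OF u] algebra_simps diff_divide_distrib add_divide_distrib)
    then show ?thesis using intg_diff[OF p[OF u(1) v] p[OF u(2) v]] by simp
  qed
  then show ?thesis unfolding form_a_def by (simp add: sum_subtractf right_diff_distrib)
qed

lemma pw_cont_divergence: "v \<in> Vh \<Longrightarrow> pw_cont (divergence v)"
  unfolding divergence_def[abs_def] by (intro pw_cont_sum pw_cont_partial)

lemma form_b_diff_left:
  assumes u: "u \<in> Vh" "u' \<in> Vh" and q: "pw_cont q"
  shows "form_b \<Omega> (\<lambda>x. u x - u' x) q = form_b \<Omega> u q - form_b \<Omega> u' q"
proof -
  note p = pw_cont_mult[OF pw_cont_divergence q]
  have "intg (\<lambda>x. divergence (\<lambda>x. u x - u' x) x * q x)
    = intg (\<lambda>x. divergence u x * q x - divergence u' x * q x)"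
    by (rule intg_cong[OF p[OF V_space_diff[OF u]] pw_cont_diff[OF p[OF u(1)] p[OF u(2)]]])
      (simp add: divergence_def partial_diff[OF u] sum_subtractf algebra_simps)
  then show ?thesis unfolding form_b_def using intg_diff[OF p[OF u(1)] p[OF u(2)]] by simp
qed

lemma form_b_diff_right:
  assumes u: "u \<in> Vh" and q: "pw_cont q" "pw_cont q'"
  shows "form_b \<Omega> u (\<lambda>x. q x - q' x) = form_b \<Omega> u q - form_b \<Omega> u q'"
  using intg_diff[OF pw_cont_mult[OF pw_cont_divergence[OF u] q(1)] pw_cont_mult[OF pw_cont_divergence[OF u] q(2)]]
  unfolding form_b_def by (simp add: right_diff_distrib)

text \<open>Young's inequality with a free weight. In the limit argument the energy of
  \<open>u\<close> tends to zero and that of \<open>v\<close> is fixed: a large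
  \<open>\<theta>\<close> makes the second term small, then the limit makes the first one
  small.\<close>

lemma form_a_bound:
  assumes u: "u \<in> Vh" and v: "v \<in> Vh" and \<theta>: "\<theta> > 0" and \<nu>: "\<nu> > 0"
  shows "\<bar>form_a \<Omega> \<nu> u v\<bar> \<le> \<nu> * (\<theta> * energy u + energy v / \<theta>)"
proof -
  let ?s = "\<lambda>w x. \<Sum>i\<in>UNIV. \<Sum>j\<in>UNIV. (strain w i j x)\<^sup>2"
  let ?m = "\<lambda>x. \<Sum>i\<in>UNIV. \<Sum>j\<in>UNIV. strain u i j x * strain v i j x"
  have pm: "pw_cont ?m" by (intro pw_cont_sum pw_cont_mult pw_cont_strain u v)
  have pw: "pw_cont (\<lambda>x. 1/2 * (\<theta> * ?s u x + ?s v x / \<theta>))"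
    by (intro pw_cont_cmult pw_cont_add pw_cont_divide pw_cont_energy u v)
  have fa: "form_a \<Omega> \<nu> u v = 2 * \<nu> * intg ?m"
    unfolding form_a_def by (simp add: intg_sum pw_cont_sum pw_cont_mult pw_cont_strain u v)
  have pt: "\<bar>a * b\<bar> \<le> 1/2 * (\<theta> * a\<^sup>2 + b\<^sup>2 / \<theta>)" for a b :: real
  proof -
    have "0 \<le> (\<theta> * \<bar>a\<bar> - \<bar>b\<bar>)\<^sup>2 / \<theta>" using \<theta> by simp
    also have "\<dots> = \<theta> * a\<^sup>2 + b\<^sup>2 / \<theta> - 2 * \<bar>a * b\<bar>"
      using \<theta> by (simp add: power2_diff add_divide_distrib diff_divide_distrib power_mult_distrib abs_mult)
        (simp add: power2_eq_square)
    finally show ?thesis by simp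
  qed
  have le: "\<bar>?m x\<bar> \<le> 1/2 * (\<theta> * ?s u x + ?s v x / \<theta>)" for x
  proof -
    have "\<bar>?m x\<bar> \<le> (\<Sum>i\<in>UNIV. \<Sum>j\<in>UNIV. \<bar>strain u i j x * strain v i j x\<bar>)"
      by (intro order_trans[OF sum_abs] sum_mono) simp
    also have "\<dots> \<le> (\<Sum>i\<in>UNIV. \<Sum>j\<in>UNIV. 1/2 * (\<theta> * (strain u i j x)\<^sup>2 + (strain v i j x)\<^sup>2 / \<theta>))"
      by (intro sum_mono pt)
    also have "\<dots> = 1/2 * (\<theta> * ?s u x + ?s v x / \<theta>)"
      by (simp add: sum_2 algebra_simps add_divide_distrib)
    finally show ?thesis .
  qed
  have "intg ?m \<le> intg (\<lambda>x. 1/2 * (\<theta> * ?s u x + ?s v x / \<theta>))"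
    by (rule intg_mono[OF pm pw]) (use le abs_le_D1 in blast)
  moreover have "intg (\<lambda>x. (-1) * ?m x) \<le> intg (\<lambda>x. 1/2 * (\<theta> * ?s u x + ?s v x / \<theta>))"
  proof (rule intg_mono[OF pw_cont_cmult[OF pm] pw])
    show "(-1) * ?m x \<le> 1/2 * (\<theta> * ?s u x + ?s v x / \<theta>)" for x
      using abs_le_D2[OF le[of x]] by simp
  qed
  moreover have "intg (\<lambda>x. 1/2 * (\<theta> * ?s u x + ?s v x / \<theta>)) = 1/2 * (\<theta> * energy u + energy v / \<theta>)"
    using intg_add[OF pw_cont_cmult[OF pw_cont_energy[OF u]] pw_cont_divide[OF pw_cont_energy[OF v]], of \<theta> \<theta>]
    unfolding energy_def intg_cmult by simp
  ultimately have "\<bar>intg ?m\<bar> \<le> 1/2 * (\<theta> * energy u + energy v / \<theta>)"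
    unfolding intg_cmult by linarith
  then have "2 * \<nu> * \<bar>intg ?m\<bar> \<le> 2 * \<nu> * (1/2 * (\<theta> * energy u + energy v / \<theta>))"
    using \<nu> by (intro mult_left_mono) auto
  then show ?thesis unfolding fa abs_mult using \<nu> by simp
qed

end

section \<open>Poincare and trace inequalities on \<open>Vn\<close>, with constants free of
  h\<close>

context fem
begin

abbreviation "Vn \<equiv> Vn_space \<Omega> \<Gamma>0 \<Gamma>1 n \<T>"

lemma Vn_V: "v \<in> Vn \<Longrightarrow> v \<in> Vh"
  by (simp add: Vn_space_def)

text \<open>\<open>Vn\<close> prescribes zeros at nodes only. A frontier point off the side is a
  node or lies on a mesh edge contained in \<open>closure \<Gamma>0\<close>, and the three nodes of
  that edge make the quadratic vanish along it.\<close>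

lemma Vn_zero:
  assumes v: "v \<in> Vn" and x: "x \<in> frontier \<Omega>" "x \<notin> closure \<Gamma>1"
  shows "v x = 0"
proof -
  have node: "v y = 0" if "y \<in> closure \<Gamma>0" "y \<in> mesh_nodes \<T>" for y
    using v that by (simp add: Vn_space_def)
  show ?thesis
  proof (cases "x \<in> mesh_vertices \<T>")
    case True
    then show ?thesis using node x frontier_Un mesh_nodes_iff by blast
  next
    case False
    obtain T a b where T: "T \<in> \<T>" "a \<in> verts T" "b \<in> verts T" "a \<noteq> b" "x \<in> open_segment a b"
      "closed_segment a b \<subseteq> (if x \<in> closure \<Gamma>1 then closure \<Gamma>1 else closure \<Gamma>0)"
      using x(1) False by (rule frontier_cases)
    have S: "closed_segment a b \<subseteq> closure \<Gamma>0" using T(6) x(2) by simp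
    have ST: "closed_segment a b \<subseteq> T"
      using T verts_subset[of T] convex_cell[OF T(1)] by (meson closed_segment_subset subsetD)
    have "a \<in> mesh_nodes \<T>" "b \<in> mesh_nodes \<T>" "midpoint a b \<in> mesh_nodes \<T>"
      using T(1-4) unfolding mesh_nodes_iff mesh_vertices_eq by blast+
    then have z: "v a = 0" "v b = 0" "v (midpoint a b) = 0"
      using node[OF subsetD[OF S ends_in_segment(1)]] node[OF subsetD[OF S ends_in_segment(2)]]
        node[OF subsetD[OF S midpoint_in_closed_segment]] by blast+
    have "v x $ i = 0" for i
      by (rule quadratic_eq_0_on_segment[OF is_poly_on_subset[OF V_poly[OF Vn_V[OF v] T(1)] ST]])
        (use z T(5) open_closed_segment in auto)
    then show ?thesis by (simp add: vec_eq_iff)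
  qed
qed

lemma M1_side: "M 1 \<in> closure \<Gamma>1"
  using M_in[of 1] by simp

lemma Vn_zero_or:
  assumes "v \<in> Vn" "x \<in> frontier \<Omega>"
  shows "v x = 0 \<or> (x - M 1) \<bullet> n = 0"
  using Vn_zero[OF assms] normal_orth[OF M1_side, of x] by (auto simp: inner_commute)

lemma unit_normal: "n $ 1 * n $ 1 + n $ 2 * n $ 2 = 1"
proof -
  have "norm n = 1" using normal by (simp add: outer_unit_normal_def)
  then have "n \<bullet> n = 1" by (simp add: norm_eq_1)
  then show ?thesis by (simp add: inner_pt)
qed

text \<open>The tangent is parallel to the side, so the weighted identity cannot be used for it
  directly. \<open>dp\<close> and \<open>dm\<close> are orthogonal, both satisfy
  \<open>d \<bullet> n = 1\<close>, and together they recover every component; the price is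
  \<open>d \<bullet> d = 2\<close>.\<close>

definition dp :: pt where "dp = n + tangent n"
definition dm :: pt where "dm = n - tangent n"

lemma dpm:
  "dp \<bullet> n = 1" "dm \<bullet> n = 1" "dp \<bullet> dp = 2" "dm \<bullet> dm = 2"
  using unit_normal by (simp_all add: dp_def dm_def inner_pt tangent_nth algebra_simps)

lemma dpm_norm: "(norm y)\<^sup>2 = 1/2 * ((dp \<bullet> y)\<^sup>2 + (dm \<bullet> y)\<^sup>2)"
proof -
  have "1/2 * ((dp \<bullet> y)\<^sup>2 + (dm \<bullet> y)\<^sup>2) = (n $ 1 * n $ 1 + n $ 2 * n $ 2) * (y $ 1 * y $ 1 + y $ 2 * y $ 2)"
    by (simp add: dp_def dm_def inner_pt tangent_nth power2_eq_square algebra_simps)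
  then show ?thesis using unit_normal by (simp add: power2_norm_eq_inner inner_pt)
qed

lemma tangent_sq_le: "(y \<bullet> tangent n)\<^sup>2 \<le> 1/2 * ((dp \<bullet> y)\<^sup>2 + (dm \<bullet> y)\<^sup>2)"
proof -
  have "1/2 * ((dp \<bullet> y)\<^sup>2 + (dm \<bullet> y)\<^sup>2) = (y \<bullet> tangent n)\<^sup>2 + (y \<bullet> n)\<^sup>2"
    by (simp add: dp_def dm_def inner_pt tangent_nth power2_eq_square algebra_simps)
  then show ?thesis by simp
qed

lemma cell_balls: 
  assumes "T \<in> \<T>"
  obtains c0 c1 where "cball c0 (K * h) \<subseteq> T" "T \<subseteq> cball c1 (K' * h)"
proof -
  have "\<forall>T\<in>\<T>. (\<exists>c. cball c (K * h) \<subseteq> T) \<and> (\<exists>c. T \<subseteq> cball c (K' * h))"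
    using admissible unfolding admissible_mesh_def by (elim conjE)
  then show ?thesis using assms that by fast
qed

text \<open>Two distinct vertices of one triangle lie in a ball of radius
  \<open>K' * h\<close>.\<close>

lemma h_pos: "h > 0"
proof -
  have 1: "1 \<in> {1..m}" using m_pos by simp
  have T: "btri 1 \<in> \<T>" "M 1 \<in> btri 1" "M (1+1) \<in> btri 1"
    using btri[OF 1] verts_subset[of "btri 1"] by auto
  obtain c0 c1 where c: "btri 1 \<subseteq> cball c1 (K' * h)" by (rule cell_balls[OF T(1)])
  then have d: "dist c1 (M 1) \<le> K' * h" "dist c1 (M (1+1)) \<le> K' * h" using T by auto
  have "M 1 \<noteq> M (1+1)" using M_inj[of 1 "1+1"] m_pos by simp
  then have "0 < dist (M 1) (M (1+1))" by simp
  also have "\<dots> \<le> dist c1 (M 1) + dist c1 (M (1+1))" by (rule dist_triangle3)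
  finally have "K' * h > 0" using d by linarith
  then show ?thesis using K_pos by (simp add: zero_less_mult_iff)
qed

context
  fixes R :: real
  assumes R: "\<And>x y. x \<in> closure \<Omega> \<Longrightarrow> y \<in> closure \<Omega> \<Longrightarrow> norm (x - y) \<le> R"
begin

lemma psi_le: "x \<in> \<Omega> \<Longrightarrow> \<bar>(x - M 1) \<bullet> n\<bar> \<le> R"
proof -
  assume x: "x \<in> \<Omega>"
  have "norm n = 1" using normal by (simp add: outer_unit_normal_def)
  then have "\<bar>(x - M 1) \<bullet> n\<bar> \<le> norm (x - M 1)" using Cauchy_Schwarz_ineq2[of "x - M 1" n] by simp
  also have "\<dots> \<le> R"
    using x closure_subset[of \<Omega>] M1_side side_subset frontier_dom by (intro R) blast+
  finally show ?thesis .
qed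

text \<open>By \<open>dpm_norm\<close> the squared norm is the mean of two directional squares, each
  covered by \<open>poincare_direction\<close>; the factor 4 beyond \<open>4 * R\<^sup>2\<close> is
  \<open>(d \<bullet> d)\<^sup>2\<close>.\<close>

lemma L2_bound:
  assumes v: "v \<in> Vn"
  shows "intg (\<lambda>x. (norm (v x))\<^sup>2) \<le> 16 * R\<^sup>2 * energy v"
proof -
  note V = Vn_V[OF v]
  note p = pw_cont_power[OF pw_C1_pw_cont[OF pw_C1_V_inner[OF V]]]
  have *: "intg (\<lambda>x. (d \<bullet> v x)\<^sup>2) \<le> 4 * R\<^sup>2 * (4 * energy v)" if "d \<bullet> n = 1" "d \<bullet> d = 2" for d
  proof -
    have "intg (\<lambda>x. (d \<bullet> v x)\<^sup>2) \<le> 4 * R\<^sup>2 * intg (\<lambda>x. (dir_deriv d (\<lambda>x. d \<bullet> v x) x)\<^sup>2)"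
      using V Vn_zero_or[OF v] that(1) psi_le by (rule poincare_direction)
    also have "\<dots> \<le> 4 * R\<^sup>2 * (4 * energy v)"
      using intg_dir_deriv_inner_bound[OF V, of d] that(2) by (intro mult_left_mono) auto
    finally show ?thesis .
  qed
  have "intg (\<lambda>x. (norm (v x))\<^sup>2) = 1/2 * (intg (\<lambda>x. (dp \<bullet> v x)\<^sup>2) + intg (\<lambda>x. (dm \<bullet> v x)\<^sup>2))"
    unfolding dpm_norm intg_cmult intg_add[OF p p] ..
  then show ?thesis using *[OF dpm(1,3)] *[OF dpm(2,4)] by simp
qed

lemma strip_bound:
  assumes v: "v \<in> Vn"
  shows "intg (\<lambda>x. 1 / h / (1 + ((x - M 1) \<bullet> n / h)\<^sup>2) * (v x \<bullet> tangent n)\<^sup>2) \<le> (8 * R\<^sup>2 + 2) * 4 * energy v"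
    and "pw_cont (\<lambda>x. 1 / h / (1 + ((x - M 1) \<bullet> n / h)\<^sup>2) * (v x \<bullet> tangent n)\<^sup>2)"
proof -
  note V = Vn_V[OF v]
  let ?\<omega> = "\<lambda>x. 1 / h / (1 + ((x - M 1) \<bullet> n / h)\<^sup>2)"
  have ne: "1 + ((x - M 1) \<bullet> n / h)\<^sup>2 > 0" for x
    using zero_le_power2[of "(x - M 1) \<bullet> n / h"] by linarith
  have p\<omega>: "pw_cont ?\<omega>"
  proof (rule pw_cont_cont)
    have "1 + ((x - M 1) \<bullet> n / h)\<^sup>2 \<noteq> 0" for x using ne[of x] by linarith
    then show "continuous_on UNIV ?\<omega>" using h_pos by (intro continuous_intros) auto
  qed
  have \<omega>: "?\<omega> x \<ge> 0" for x using ne[of x] h_pos by simp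
  note p = pw_cont_mult[OF p\<omega> pw_cont_power[OF pw_C1_pw_cont[OF pw_C1_V_inner[OF V]]]]
  show pt: "pw_cont (\<lambda>x. ?\<omega> x * (v x \<bullet> tangent n)\<^sup>2)"
    using p[of "tangent n" 2] by (simp add: inner_commute)
  have *: "intg (\<lambda>x. ?\<omega> x * (d \<bullet> v x)\<^sup>2) \<le> (8 * R\<^sup>2 + 2) * (4 * energy v)" if "d \<bullet> n = 1" "d \<bullet> d = 2" for d
  proof -
    have "intg (\<lambda>x. ?\<omega> x * (d \<bullet> v x)\<^sup>2) \<le> (8 * R\<^sup>2 + 2) * intg (\<lambda>x. (dir_deriv d (\<lambda>x. d \<bullet> v x) x)\<^sup>2)"
      using V Vn_zero_or[OF v] that(1) psi_le h_pos by (rule strip_direction)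
    also have "\<dots> \<le> (8 * R\<^sup>2 + 2) * (4 * energy v)"
      using intg_dir_deriv_inner_bound[OF V, of d] that(2) by (intro mult_left_mono) auto
    finally show ?thesis .
  qed
  have "intg (\<lambda>x. ?\<omega> x * (v x \<bullet> tangent n)\<^sup>2)
      \<le> intg (\<lambda>x. 1/2 * (?\<omega> x * (dp \<bullet> v x)\<^sup>2 + ?\<omega> x * (dm \<bullet> v x)\<^sup>2))"
  proof (rule intg_mono[OF pt pw_cont_cmult[OF pw_cont_add[OF p p]]])
    fix x
    show "?\<omega> x * (v x \<bullet> tangent n)\<^sup>2 \<le> 1/2 * (?\<omega> x * (dp \<bullet> v x)\<^sup>2 + ?\<omega> x * (dm \<bullet> v x)\<^sup>2)"
      using mult_left_mono[OF tangent_sq_le[of "v x"] \<omega>[of x]] by (simp add: algebra_simps)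
  qed
  also have "\<dots> = 1/2 * (intg (\<lambda>x. ?\<omega> x * (dp \<bullet> v x)\<^sup>2) + intg (\<lambda>x. ?\<omega> x * (dm \<bullet> v x)\<^sup>2))"
    unfolding intg_cmult intg_add[OF p p] ..
  also have "\<dots> \<le> (8 * R\<^sup>2 + 2) * 4 * energy v"
  proof -
    have half: "a \<le> c \<Longrightarrow> b \<le> c \<Longrightarrow> 1/2 * (a + b) \<le> c" for a b c :: real by simp
    show ?thesis unfolding mult.assoc[of "8 * R\<^sup>2 + 2" 4] by (rule half[OF *[OF dpm(1,3)] *[OF dpm(2,4)]])
  qed
  finally show "intg (\<lambda>x. ?\<omega> x * (v x \<bullet> tangent n)\<^sup>2) \<le> (8 * R\<^sup>2 + 2) * 4 * energy v" .
qed

text \<open>Balance of powers: the edge length is at most \<open>2 * K' * h\<close>, the inverse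
  estimate costs \<open>C / h\<^sup>2\<close>, and the lower bound of the strip weight on a boundary
  triangle gives \<open>h * (1 + 4 * K'\<^sup>2)\<close>, so \<open>h\<close> cancels. The inverse
  estimate enters as an assumption over all mesh sizes, which lets \<open>C\<close> be fixed before
  the mesh.\<close>

lemma Lam_bound:
  assumes v: "v \<in> Vn" and G: "G \<ge> 0" "\<And>x. x \<in> closure \<Gamma>1 \<Longrightarrow> g x \<le> G"
    and C: "C > 0" "\<And>h T w c0 c1 x. h > 0 \<Longrightarrow> compact T \<Longrightarrow> cball c0 (K * h) \<subseteq> T \<Longrightarrow> T \<subseteq> cball c1 (K' * h) \<Longrightarrow>
      is_poly_on 2 T w \<Longrightarrow> x \<in> T \<Longrightarrow> (w x)\<^sup>2 \<le> C / h\<^sup>2 * (LINT x:T|lebesgue. (w x)\<^sup>2)"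
  shows "Lam_inner g m M (\<lambda>x. v x \<bullet> tangent n) (\<lambda>x. v x \<bullet> tangent n)
    \<le> 2 * K' * G * C * (1 + 4 * K'\<^sup>2) * ((8 * R\<^sup>2 + 2) * 4 * energy v)"
proof -
  note V = Vn_V[OF v]
  let ?w = "\<lambda>x. v x \<bullet> tangent n"
  let ?\<omega> = "\<lambda>x. 1 / h / (1 + ((x - M 1) \<bullet> n / h)\<^sup>2)"
  define J where "J i = (LINT x:btri i|lebesgue. (?w x)\<^sup>2)" for i
  define J' where "J' i = (LINT x:btri i|lebesgue. ?\<omega> x * (?w x)\<^sup>2)" for i
  have pw: "pw_cont (\<lambda>x. (?w x)\<^sup>2)"
    using pw_cont_power[OF pw_C1_pw_cont[OF pw_C1_V_inner[OF V, of "tangent n"]], of 2] by (simp add: inner_commute)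
  have ne: "1 + ((x - M 1) \<bullet> n / h)\<^sup>2 > 0" for x
    using zero_le_power2[of "(x - M 1) \<bullet> n / h"] by linarith
  have local: "dist (M i) (M (i+1)) \<le> 2 * K' * h" "J i \<le> h * (1 + 4 * K'\<^sup>2) * J' i"
    "\<And>x. x \<in> closed_segment (M i) (M (i+1)) \<Longrightarrow> (?w x)\<^sup>2 \<le> C / h\<^sup>2 * J i" "J' i \<ge> 0"
    if i: "i \<in> {1..m}" for i
  proof -
    have T: "btri i \<in> \<T>" "M i \<in> btri i" "M (i+1) \<in> btri i" using btri[OF i] verts_subset by blast+
    obtain c0 c1 where c: "cball c0 (K * h) \<subseteq> btri i" "btri i \<subseteq> cball c1 (K' * h)"
      by (rule cell_balls[OF T(1)])
    have dT: "dist x y \<le> 2 * K' * h" if "x \<in> btri i" "y \<in> btri i" for x y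
    proof -
      have "dist c1 x \<le> K' * h" "dist c1 y \<le> K' * h" using c(2) that by auto
      then show ?thesis using dist_triangle3[of x y c1] by simp
    qed
    show "dist (M i) (M (i+1)) \<le> 2 * K' * h" by (rule dT[OF T(2,3)])
    show "(?w x)\<^sup>2 \<le> C / h\<^sup>2 * J i" if x: "x \<in> closed_segment (M i) (M (i+1))" for x
    proof -
      have "closed_segment (M i) (M (i+1)) \<subseteq> btri i"
        using T convex_cell by (simp add: closed_segment_subset)
      then have xT: "x \<in> btri i" using x by blast
      have "is_poly_on 2 (btri i) ?w"
        using V_poly_inner[OF V T(1), of "tangent n"] by (simp add: inner_commute)
      then show ?thesis unfolding J_def by (rule C(2)[OF h_pos compact_cell[OF T(1)] c _ xT])
    qed
    show "J' i \<ge> 0"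
      unfolding J'_def set_lebesgue_integral_def
      using h_pos less_imp_le[OF ne] by (intro integral_nonneg_AE) auto
    have "J i \<le> (LINT x:btri i|lebesgue. h * (1 + 4 * K'\<^sup>2) * (?\<omega> x * (?w x)\<^sup>2))"
      unfolding J_def
    proof (rule set_integral_mono)
      show "set_integrable lebesgue (btri i) (\<lambda>x. (?w x)\<^sup>2)" by (rule pw_cont_integrable_cell[OF pw T(1)])
      show "set_integrable lebesgue (btri i) (\<lambda>x. h * (1 + 4 * K'\<^sup>2) * (?\<omega> x * (?w x)\<^sup>2))"
        by (rule pw_cont_integrable_cell[OF pw_cont_cmult[OF strip_bound(2)[OF v]] T(1)])
      fix x assume x: "x \<in> btri i"
      have i1: "M i \<in> closure \<Gamma>1" using M_in[of i] i by simp
      \<comment> \<open>The distance to the line of the side may be measured from any of its points;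
        measured from \<open>M i\<close> it is at most the diameter of the triangle.\<close>
      have "(x - M 1) \<bullet> n = (x - M i) \<bullet> n + (M i - M 1) \<bullet> n" by (simp flip: inner_add_left)
      also have "\<dots> = (x - M i) \<bullet> n" using normal_orth[OF M1_side i1] by (simp add: inner_commute)
      finally have "\<bar>(x - M 1) \<bullet> n\<bar> \<le> norm (x - M i) * norm n"
        using Cauchy_Schwarz_ineq2[of "x - M i" n] by simp
      also have "\<dots> \<le> 2 * K' * h"
        using dT[OF x T(2)] normal by (simp add: outer_unit_normal_def dist_norm)
      finally have "\<bar>(x - M 1) \<bullet> n / h\<bar> \<le> 2 * K'" using h_pos by (simp add: abs_divide pos_divide_le_eq)
      then have "\<bar>(x - M 1) \<bullet> n / h\<bar>\<^sup>2 \<le> (2 * K')\<^sup>2" by (intro power_mono) auto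
      then have le: "1 + ((x - M 1) \<bullet> n / h)\<^sup>2 \<le> 1 + 4 * K'\<^sup>2"
        unfolding power2_abs power_mult_distrib by simp
      have "1 \<le> h * (1 + 4 * K'\<^sup>2) * ?\<omega> x"
        using le ne[of x] h_pos by simp
      then have "1 * (?w x)\<^sup>2 \<le> h * (1 + 4 * K'\<^sup>2) * ?\<omega> x * (?w x)\<^sup>2"
        by (rule mult_right_mono) (rule zero_le_power2)
      then show "(?w x)\<^sup>2 \<le> h * (1 + 4 * K'\<^sup>2) * (?\<omega> x * (?w x)\<^sup>2)"
        unfolding mult_1_left by (simp only: mult.assoc)
    qed
    also have "\<dots> = h * (1 + 4 * K'\<^sup>2) * J' i"
      unfolding J'_def by (rule set_integral_mult_right)
    finally show "J i \<le> h * (1 + 4 * K'\<^sup>2) * J' i" .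
  qed
  define B where "B = 2 * K' * G * C * (1 + 4 * K'\<^sup>2)"
  have B: "B \<ge> 0" using K_pos G C by (simp add: B_def)
  have summand: "dist (M i) (M (i+1)) * (let c = cmid i in
         g (M i) * ?w (M i) * ?w (M i) + 4 * g c * ?w c * ?w c
         + g (M (i+1)) * ?w (M (i+1)) * ?w (M (i+1))) \<le> 6 * (B * J' i)" if i: "i \<in> {1..m}" for i
  proof -
    note L = local[OF i]
    have S: "C / h\<^sup>2 * J i \<ge> 0" by (rule order_trans[OF zero_le_power2 L(3)]) (rule ends_in_segment)
    have b: "g x * ?w x * ?w x \<le> G * (C / h\<^sup>2 * J i)"
      if x: "x \<in> closed_segment (M i) (M (i+1))" "x \<in> closure \<Gamma>1" for x
    proof -
      have "g x * (?w x)\<^sup>2 \<le> G * (C / h\<^sup>2 * J i)"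
        by (rule mult_mono[OF G(2)[OF x(2)] L(3)[OF x(1)] G(1)]) simp
      then show ?thesis by (simp add: power2_eq_square mult.assoc)
    qed
    have c: "cmid i \<in> closure \<Gamma>1" "M i \<in> closure \<Gamma>1" "M (i+1) \<in> closure \<Gamma>1"
      using cmid(1)[OF i] M_in[of i] M_in[of "i+1"] i by auto
    have "g (M i) * ?w (M i) * ?w (M i) + 4 * g (cmid i) * ?w (cmid i) * ?w (cmid i)
         + g (M (i+1)) * ?w (M (i+1)) * ?w (M (i+1)) \<le> 6 * (G * (C / h\<^sup>2 * J i))"
    proof -
      \<comment> \<open>The Simpson weights 1, 4, 1 add up to 6, which cancels the 1/6 in
        \<open>Lam_inner\<close>.\<close>
      have lin: "p \<le> s \<Longrightarrow> q \<le> s \<Longrightarrow> r \<le> s \<Longrightarrow> p + 4 * q + r \<le> 6 * s" for p q r s :: real by simp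
      show ?thesis
        using lin[OF b[OF ends_in_segment(1) c(2)] b[OF midpoint_in_closed_segment c(1)] b[OF ends_in_segment(2) c(3)]]
        unfolding mult.assoc .
    qed
    then have "dist (M i) (M (i+1)) * (g (M i) * ?w (M i) * ?w (M i) + 4 * g (cmid i) * ?w (cmid i) * ?w (cmid i)
         + g (M (i+1)) * ?w (M (i+1)) * ?w (M (i+1))) \<le> (2 * K' * h) * (6 * (G * (C / h\<^sup>2 * J i)))"
    proof (rule order_trans[OF mult_left_mono mult_right_mono[OF L(1)]])
      show "0 \<le> 6 * (G * (C / h\<^sup>2 * J i))" using mult_nonneg_nonneg[OF G(1) S] by simp
    qed simp
    also have "\<dots> = 12 * K' * G * C / h * J i" using h_pos by (simp add: power2_eq_square)
    also have "\<dots> \<le> 12 * K' * G * C / h * (h * (1 + 4 * K'\<^sup>2) * J' i)"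
      using L(2) K_pos G C h_pos by (intro mult_left_mono) auto
    also have "\<dots> = 6 * (B * J' i)" using h_pos by (simp add: B_def)
    finally show ?thesis by (simp add: Let_def)
  qed
  have "Lam_inner g m M ?w ?w \<le> 1/6 * (\<Sum>i=1..m. 6 * (B * J' i))"
    unfolding Lam_inner_def by (intro mult_left_mono sum_mono summand) auto
  also have "\<dots> = B * (\<Sum>i=1..m. J' i)" by (simp flip: sum_distrib_left)
  also have "(\<Sum>i=1..m. J' i) = (\<Sum>T\<in>btri ` {1..m}. LINT x:T|lebesgue. ?\<omega> x * (?w x)\<^sup>2)"
    unfolding J'_def sum.reindex[OF inj_on_btri] o_def ..
  also have "\<dots> \<le> intg (\<lambda>x. ?\<omega> x * (?w x)\<^sup>2)"
  proof (rule sum_cells_le[OF strip_bound(2)[OF v]])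
    show "0 \<le> ?\<omega> x * (?w x)\<^sup>2" for x using h_pos less_imp_le[OF ne[of x]] by simp
    show "btri ` {1..m} \<subseteq> \<T>" using btri by blast
  qed
  also have "\<dots> \<le> (8 * R\<^sup>2 + 2) * 4 * energy v" by (rule strip_bound(1)[OF v])
  finally show ?thesis using B unfolding B_def by (simp add: mult_left_mono)
qed

end

end

section \<open>Test functions for the pressure and the multiplier\<close>

lemma affine_mult_is_poly_on_2:
  assumes "\<forall>x\<in>S. f x = a + b * x $ 1 + c * x $ 2" "\<forall>x\<in>S. g x = a' + b' * x $ 1 + c' * x $ 2"
  shows "is_poly_on 2 S (\<lambda>x. f x * g x)"
  unfolding is_poly_on_2_iff
  by (rule exI[of _ "(a * a', a * b' + b * a', a * c' + c * a', b * b', b * c' + c * b', c * c')"])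
    (use assms in \<open>auto simp: power2_eq_square algebra_simps\<close>)

context meshed_domain
begin

lemma Q_affine_cell:
  assumes "q \<in> Q_space \<Omega> \<T>" "T \<in> \<T>"
  obtains \<alpha> \<beta> \<gamma> where "\<And>x. x \<in> T \<Longrightarrow> q x = \<alpha> + \<beta> * x $ 1 + \<gamma> * x $ 2"
proof -
  have "is_poly_on 1 T q" using assms unfolding Q_space_def by blast
  then obtain \<alpha> \<beta> \<gamma> where "\<forall>x\<in>T. q x = \<alpha> + \<beta> * x $ 1 + \<gamma> * x $ 2"
    unfolding is_poly_on_1_iff by blast
  then show thesis by (intro that[of \<alpha> \<beta> \<gamma>]) blast
qed

lemma Q_bary:
  assumes q: "q \<in> Q_space \<Omega> \<T>" and T: "T \<in> \<T>" "x \<in> T"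
  shows "q x = (\<Sum>a\<in>verts T. bary T a x * q a)"
proof -
  obtain \<alpha> \<beta> \<gamma> where l: "\<And>x. x \<in> T \<Longrightarrow> q x = \<alpha> + \<beta> * x $ 1 + \<gamma> * x $ 2"
    using Q_affine_cell[OF q T(1)] by blast
  note B = bary_sum[OF simplex2[OF T(1)], of x]
  have c: "(\<Sum>a\<in>verts T. bary T a x * a $ i) = x $ i" for i
  proof -
    have "(\<Sum>a\<in>verts T. bary T a x *\<^sub>R a) $ i = x $ i" unfolding B(2) ..
    then show ?thesis by simp
  qed
  have "(\<Sum>a\<in>verts T. bary T a x * q a) = (\<Sum>a\<in>verts T. \<alpha> * bary T a x + \<beta> * (bary T a x * a $ 1) + \<gamma> * (bary T a x * a $ 2))"
    by (rule sum.cong[OF refl]) (use l verts_subset in \<open>simp add: subset_iff algebra_simps\<close>)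
  also have "\<dots> = \<alpha> * (\<Sum>a\<in>verts T. bary T a x) + \<beta> * (\<Sum>a\<in>verts T. bary T a x * a $ 1) + \<gamma> * (\<Sum>a\<in>verts T. bary T a x * a $ 2)"
    by (simp add: sum.distrib sum_distrib_left)
  also have "\<dots> = q x" unfolding c B(1) using l[OF T(2)] by simp
  finally show ?thesis by simp
qed

lemma pw_C1_Q: "q \<in> Q_space \<Omega> \<T> \<Longrightarrow> pw_C1 q"
  by (rule pw_C1_poly[of 1]) (simp add: Q_space_def)

lemma dir_deriv_Q_edge:
  assumes q: "q \<in> Q_space \<Omega> \<T>" and T: "T \<in> \<T>" "x \<in> interior T" "a \<in> verts T" "b \<in> verts T"
  shows "dir_deriv (b - a) q x = q b - q a"
proof -
  obtain \<alpha> \<beta> \<gamma> where l: "\<And>x. x \<in> T \<Longrightarrow> q x = \<alpha> + \<beta> * x $ 1 + \<gamma> * x $ 2"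
    using Q_affine_cell[OF q T(1)] by blast
  define d where "d = b - a"
  have ab: "a \<in> T" "b \<in> T" using T verts_subset by blast+
  have "((\<lambda>t. q (x + t *\<^sub>R d)) has_real_derivative \<beta> * d $ 1 + \<gamma> * d $ 2) (at 0)"
  proof (rule has_field_derivative_transform_within_open)
    show "((\<lambda>t. \<alpha> + \<beta> * (x $ 1 + t * d $ 1) + \<gamma> * (x $ 2 + t * d $ 2)) has_real_derivative \<beta> * d $ 1 + \<gamma> * d $ 2) (at 0)"
      by (auto intro!: derivative_eq_intros)
    show "open ((\<lambda>t. x + t *\<^sub>R d) -` interior T)"
      by (intro open_vimage continuous_intros) auto
    show "\<alpha> + \<beta> * (x $ 1 + t * d $ 1) + \<gamma> * (x $ 2 + t * d $ 2) = q (x + t *\<^sub>R d)"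
      if "t \<in> (\<lambda>t. x + t *\<^sub>R d) -` interior T" for t
    proof -
      have "x + t *\<^sub>R d \<in> T" using that interior_subset by auto
      then show ?thesis using l by simp
    qed
  qed (use T in simp)
  then have "dir_deriv d q x = \<beta> * d $ 1 + \<gamma> * d $ 2" unfolding dir_deriv_def by (rule DERIV_imp_deriv)
  also have "\<dots> = q b - q a" using l[OF ab(1)] l[OF ab(2)] by (simp add: d_def algebra_simps)
  finally show ?thesis by (simp add: d_def)
qed

lemma scalar_V:
  assumes "continuous_on (closure \<Omega>) f" "\<And>T. T \<in> \<T> \<Longrightarrow> is_poly_on 2 T f"
  shows "(\<lambda>x. f x *\<^sub>R d) \<in> Vh"
proof -
  have "is_poly_on 2 T (\<lambda>x. (f x *\<^sub>R d) $ i)" if T: "T \<in> \<T>" for T i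
  proof -
    obtain c where "\<forall>x\<in>T. f x = quad_poly c x" using assms(2)[OF T] unfolding is_poly_on_2_iff by blast
    then have "\<forall>x\<in>T. (f x *\<^sub>R d) $ i = quad_poly ((d $ i) *\<^sub>R c) x" by (simp add: quad_poly_scale)
    then show ?thesis unfolding is_poly_on_2_iff by blast
  qed
  then show ?thesis using assms(1) by (simp add: V_space_def continuous_on_scaleR)
qed

lemma hat_affine:
  assumes "T \<in> \<T>" obtains \<alpha> \<beta> \<gamma> where "\<forall>x\<in>T. hat a x = \<alpha> + \<beta> * x $ 1 + \<gamma> * x $ 2"
proof (cases "a \<in> verts T")
  case True
  obtain \<alpha> \<beta> \<gamma> where "\<forall>y. bary T a y = \<alpha> + \<beta> * y $ 1 + \<gamma> * y $ 2"
    using bary_affine[OF simplex2[OF assms] True] by blast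
  then show ?thesis using hat_eq[OF assms] True by (intro that[of \<alpha> \<beta> \<gamma>]) simp
next
  case False
  then show ?thesis using hat_eq[OF assms] by (intro that[of 0 0 0]) simp
qed

lemma hat_mult_V: "(\<lambda>x. (hat a x * hat b x) *\<^sub>R d) \<in> Vh"
proof (rule scalar_V)
  show "continuous_on (closure \<Omega>) (\<lambda>x. hat a x * hat b x)"
    using continuous_on_hat unfolding Union_mesh by (intro continuous_on_mult) auto
  show "is_poly_on 2 T (\<lambda>x. hat a x * hat b x)" if T: "T \<in> \<T>" for T
  proof -
    obtain \<alpha> \<beta> \<gamma> where 1: "\<forall>x\<in>T. hat a x = \<alpha> + \<beta> * x $ 1 + \<gamma> * x $ 2" by (rule hat_affine[OF T])
    obtain \<alpha>' \<beta>' \<gamma>' where 2: "\<forall>x\<in>T. hat b x = \<alpha>' + \<beta>' * x $ 1 + \<gamma>' * x $ 2" by (rule hat_affine[OF T])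
    show ?thesis by (rule affine_mult_is_poly_on_2[OF 1 2])
  qed
qed

lemma bubble_frontier:
  assumes "a \<in> mesh_vertices \<T>" "a \<in> \<Omega>" "x \<in> frontier \<Omega>"
  shows "hat a x = 0"
proof (rule ccontr)
  assume "hat a x \<noteq> 0"
  then have "hat a x > 0" using hat_nonneg[of a x] by simp
  then have "x \<in> \<Omega>" using hat_pos_interior[OF assms(1,2)] assms(3) frontier_dom by blast
  then show False using assms(3) frontier_dom by blast
qed

text \<open>Testing the divergence with an edge bubble in the direction of the edge recovers the
  difference of the nodal pressures (the Taylor--Hood argument).\<close>

lemma bubble_form_b:
  assumes r: "r \<in> Q_space \<Omega> \<T>" and a: "a \<in> mesh_vertices \<T>" "a \<in> \<Omega>"
  shows "form_b \<Omega> (\<lambda>x. (hat a x * hat b x) *\<^sub>R (b - a)) r = (r b - r a) * intg (\<lambda>x. hat a x * hat b x)"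
proof -
  define \<phi> where "\<phi> x = hat a x * hat b x" for x
  define d where "d = b - a"
  let ?v = "\<lambda>x. \<phi> x *\<^sub>R d"
  have p: "pw_C1 \<phi>" unfolding \<phi>_def[abs_def] by (intro pw_C1_mult pw_C1_hat)
  note pr = pw_C1_Q[OF r]
  have V: "?v \<in> Vh" using hat_mult_V[of a b d] unfolding \<phi>_def[abs_def] .
  have div: "divergence ?v x = dir_deriv d \<phi> x" if x: "x \<in> cells" for x
    using dir_deriv_components[OF p x, of d] dir_deriv_cmult[OF p x, of "axis 1 1" "d $ 1"] dir_deriv_cmult[OF p x, of "axis 2 1" "d $ 2"]
    by (simp add: divergence_def sum_2 partial_eq_dir_deriv mult.commute)
  \<comment> \<open>Inside a triangle the bubble is nonzero only if \<open>a\<close> and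
    \<open>b\<close> are both vertices of it, and there the affine \<open>r\<close> has constant
    slope along the edge \<open>b - a\<close>.\<close>
  have edge: "\<phi> x * dir_deriv d r x = (r b - r a) * \<phi> x" if x: "x \<in> cells" for x
  proof (cases "\<phi> x = 0")
    case False
    obtain T where T: "T \<in> \<T>" "x \<in> interior T" using x by (auto simp: cells_def)
    have xT: "x \<in> T" using T interior_subset by blast
    have "a \<in> verts T" "b \<in> verts T"
      using False hat_eq[OF T(1) xT] by (auto simp: \<phi>_def split: if_splits)
    then have "dir_deriv d r x = r b - r a" unfolding d_def by (rule dir_deriv_Q_edge[OF r T])
    then show ?thesis by simp
  qed simp
  \<comment> \<open>One interior endpoint is enough to make the bubble vanish on the frontier;
    \<open>b\<close> may lie on the boundary.\<close>
  have "intg (dir_deriv d (\<lambda>x. \<phi> x * r x)) = 0"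
    by (rule intg_dir_deriv_eq_0[OF pw_C1_mult[OF p pr]]) (simp add: \<phi>_def bubble_frontier[OF a])
  moreover have "intg (dir_deriv d (\<lambda>x. \<phi> x * r x)) = intg (\<lambda>x. divergence ?v x * r x + (r b - r a) * \<phi> x)"
  proof (rule intg_cong)
    show "pw_cont (dir_deriv d (\<lambda>x. \<phi> x * r x))" by (intro pw_cont_dir_deriv pw_C1_mult p pr)
    show "pw_cont (\<lambda>x. divergence ?v x * r x + (r b - r a) * \<phi> x)"
      by (intro pw_cont_add pw_cont_mult pw_cont_const pw_cont_divergence pw_C1_pw_cont p pr V)
    show "dir_deriv d (\<lambda>x. \<phi> x * r x) x = divergence ?v x * r x + (r b - r a) * \<phi> x" if "x \<in> cells" for x
      using dir_deriv_mult[OF p pr that] div[OF that] edge[OF that] by simp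
  qed
  moreover have "intg (\<lambda>x. divergence ?v x * r x + (r b - r a) * \<phi> x)
    = intg (\<lambda>x. divergence ?v x * r x) + (r b - r a) * intg \<phi>"
    using intg_add[OF pw_cont_mult[OF pw_cont_divergence[OF V] pw_C1_pw_cont[OF pr]] pw_cont_cmult[OF pw_C1_pw_cont[OF p]], of "r b - r a"]
    by simp
  ultimately have "form_b \<Omega> ?v r = (r b - r a) * intg \<phi>" unfolding form_b_def by simp
  then show ?thesis by (simp add: \<phi>_def[abs_def] d_def)
qed

text \<open>Both hat functions are positive inside \<open>T\<close>, so a zero integral would make a
  nonempty open set negligible.\<close>

lemma bubble_intg_pos:
  assumes T: "T \<in> \<T>" "a \<in> verts T" "b \<in> verts T"
  shows "intg (\<lambda>x. hat a x * hat b x) > 0"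
proof (rule ccontr)
  assume "\<not> ?thesis"
  moreover have "intg (\<lambda>x. hat a x * hat b x) \<ge> 0" by (intro intg_nonneg mult_nonneg_nonneg hat_nonneg)
  ultimately have 0: "intg (\<lambda>x. hat a x * hat b x) = 0" by simp
  have p: "pw_cont (\<lambda>x. hat a x * hat b x)" by (intro pw_cont_mult pw_C1_pw_cont pw_C1_hat)
  have "AE x in lebesgue. indicator \<Omega> x *\<^sub>R (hat a x * hat b x) = 0"
  proof (subst integral_nonneg_eq_0_iff_AE[symmetric])
    show "integrable lebesgue (\<lambda>x. indicator \<Omega> x *\<^sub>R (hat a x * hat b x))"
      using pw_cont_integrable[OF p] unfolding set_integrable_def .
    show "AE x in lebesgue. 0 \<le> indicator \<Omega> x *\<^sub>R (hat a x * hat b x)"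
      using hat_nonneg by (intro AE_I2) simp
    show "(LINT x|lebesgue. indicator \<Omega> x *\<^sub>R (hat a x * hat b x)) = 0"
      using 0 unfolding set_lebesgue_integral_def .
  qed
  then have "AE x in lebesgue. x \<notin> interior T"
  proof (rule AE_mp, intro AE_I2 impI notI)
    fix x assume z: "indicator \<Omega> x *\<^sub>R (hat a x * hat b x) = 0" and x: "x \<in> interior T"
    have "x \<in> T" using x interior_subset by blast
    then have "hat a x > 0" "hat b x > 0"
      using hat_eq[OF T(1)] T(2,3) interior_simplex2_iff[OF simplex2[OF T(1)]] x by auto
    moreover have "x \<in> \<Omega>" using interior_cell_subset[OF T(1)] x by blast
    ultimately show False using z by auto
  qed
  then have "negligible (interior T)"
    unfolding negligible_iff_null_sets
    by (subst (asm) AE_iff_null_sets[symmetric]) (auto simp: borel_open sets_completionI_sets)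
  moreover have "interior T \<noteq> {}"
    using interior_convex_hull_eq_empty[of "verts T"] simplex2_verts[OF simplex2[OF T(1)]] by auto
  ultimately show False using open_not_negligible[OF open_interior] by blast
qed

text \<open>Topology takes the place of a walk through the mesh: triangles with \<open>P\<close> at
  all vertices and the remaining ones would be two disjoint closed sets covering the connected
  closure of \<Omega>.\<close>

lemma mesh_vertices_connected:
  assumes a: "a \<in> mesh_vertices \<T>" "P a" and b: "b \<in> mesh_vertices \<T>"
    and step: "\<And>T a b. T \<in> \<T> \<Longrightarrow> a \<in> verts T \<Longrightarrow> b \<in> verts T \<Longrightarrow> P a \<Longrightarrow> P b"
  shows "P b"
proof -
  define A where "A = {T\<in>\<T>. \<forall>v\<in>verts T. P v}"
  have A: "finite A" "finite (\<T> - A)" "A \<subseteq> \<T>" using finite_mesh by (auto simp: A_def)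
  have nA: "\<not> P v" if "T \<in> \<T> - A" "v \<in> verts T" for T v
    using that step unfolding A_def by blast
  have cl: "closed (\<Union>A)" "closed (\<Union>(\<T> - A))"
    using A closed_mesh_cell by (auto intro!: closed_Union)
  have disj: "\<Union>A \<inter> \<Union>(\<T> - A) = {}"
  proof (rule ccontr)
    assume "\<Union>A \<inter> \<Union>(\<T> - A) \<noteq> {}"
    then obtain T T' x where T: "T \<in> A" "T' \<in> \<T> - A" "x \<in> T" "x \<in> T'" by blast
    have TT: "T \<in> \<T>" "T' \<in> \<T>" using T A by auto
    have "compact (T \<inter> T')" "convex (T \<inter> T')"
      using compact_cell[OF TT(1)] compact_cell[OF TT(2)] convex_cell[OF TT(1)] convex_cell[OF TT(2)]
      by (auto intro: compact_Int convex_Int)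
    \<comment> \<open>Two touching triangles share a vertex, namely an extreme point of their
      nonempty common face.\<close>
    then obtain v where "v extreme_point_of (T \<inter> T')"
      using extreme_point_exists_convex[of "T \<inter> T'"] T by blast
    then have "v \<in> verts (T \<inter> T')" by (simp add: verts_def)
    then have v: "v \<in> verts T" "v \<in> T'" using verts_Int_face[OF TT] by auto
    then have "v \<in> verts T'" using vert_in_mesh[OF TT] by blast
    then show False using nA[OF T(2)] v(1) T(1) by (auto simp: A_def)
  qed
  have "connected (closure \<Omega>)" using connected_dom by (rule connected_imp_connected_closure)
  moreover have "closure \<Omega> \<subseteq> \<Union>A \<union> \<Union>(\<T> - A)" using Union_mesh by blast
  ultimately have "\<Union>A \<inter> closure \<Omega> = {} \<or> \<Union>(\<T> - A) \<inter> closure \<Omega> = {}"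
    using connected_closedD[of "closure \<Omega>" "\<Union>A" "\<Union>(\<T> - A)"] cl disj by blast
  moreover have "a \<in> \<Union>A \<inter> closure \<Omega>"
  proof -
    obtain T where T: "T \<in> \<T>" "a \<in> verts T" using a(1) unfolding mesh_vertices_eq by blast
    then have "T \<in> A" using step[OF T] a(2) by (auto simp: A_def)
    then show ?thesis using T verts_subset cell_subset by blast
  qed
  moreover obtain T where T: "T \<in> \<T>" "b \<in> verts T" using b unfolding mesh_vertices_eq by blast
  moreover have "b \<in> closure \<Omega>" "b \<in> T" using T verts_subset cell_subset by blast+
  ultimately have "T \<in> A" by blast
  then show ?thesis using T by (auto simp: A_def)
qed

end

section \<open>Uniform decay of the pressure error on a fixed mesh\<close>

context fem
begin

lemma zero_on_frontier_Vn:
  assumes "v \<in> Vh" "\<And>x. x \<in> frontier \<Omega> \<Longrightarrow> v x = 0"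
  shows "v \<in> Vn"
proof -
  have "v x = 0" if "x \<in> closure \<Gamma>0 \<or> x \<in> \<Gamma>1" for x
    using that assms(2) frontier_Un closure_subset[of \<Gamma>1] by blast
  then show ?thesis using assms(1) by (auto simp: Vn_space_def)
qed

lemma interior_vertex: "T \<in> \<T> \<Longrightarrow> \<exists>a\<in>verts T. a \<in> \<Omega>"
proof -
  assume T: "T \<in> \<T>"
  have "\<forall>T\<in>\<T>. \<exists>v. v extreme_point_of T \<and> v \<notin> frontier \<Omega>"
    using admissible unfolding admissible_mesh_def by (elim conjE)
  then obtain v where v: "v \<in> verts T" "v \<notin> frontier \<Omega>" using T by (auto simp: verts_def)
  then have "v \<in> closure \<Omega>" using verts_subset cell_subset[OF T] by blast
  then show ?thesis using v frontier_dom by blast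
qed

text \<open>Bubbles give the differences of nodal values along edges with an interior endpoint.
  These are chained over the connected mesh, and the zero mean fixes the constant that is
  left.\<close>

lemma pressure_tendsto_0:
  assumes r: "\<And>k. r k \<in> Q0_space \<Omega> \<T>"
    and lim: "\<And>v. v \<in> Vh \<Longrightarrow> (\<And>x. x \<in> frontier \<Omega> \<Longrightarrow> v x = 0) \<Longrightarrow> (\<lambda>k. form_b \<Omega> v (r k)) \<longlonglongrightarrow> 0"
  obtains \<epsilon> where "\<epsilon> \<longlonglongrightarrow> 0" "\<And>k x. x \<in> closure \<Omega> \<Longrightarrow> \<bar>r k x\<bar> \<le> \<epsilon> k"
proof -
  have rQ: "r k \<in> Q_space \<Omega> \<T>" and r0: "intg (r k) = 0" for k
    using r[of k] by (auto simp: Q0_space_def)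
  have edge: "(\<lambda>k. r k b - r k a) \<longlonglongrightarrow> 0" if T: "T \<in> \<T>" "a \<in> verts T" "b \<in> verts T" "a \<in> \<Omega>" for T a b
  proof -
    have av: "a \<in> mesh_vertices \<T>" using T mesh_vertices_eq by blast
    define c where "c = intg (\<lambda>x. hat a x * hat b x)"
    have c: "c > 0" unfolding c_def by (rule bubble_intg_pos[OF T(1-3)])
    have "(\<lambda>k. form_b \<Omega> (\<lambda>x. (hat a x * hat b x) *\<^sub>R (b - a)) (r k)) \<longlonglongrightarrow> 0"
      by (rule lim[OF hat_mult_V]) (simp add: bubble_frontier[OF av T(4)])
    then have "(\<lambda>k. (r k b - r k a) * c) \<longlonglongrightarrow> 0"
      unfolding bubble_form_b[OF rQ av T(4)] c_def .
    then have "(\<lambda>k. (r k b - r k a) * c / c) \<longlonglongrightarrow> 0 / c"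
      using c by (intro tendsto_divide tendsto_const) auto
    then show ?thesis using c by simp
  qed
  obtain a0 where a0: "a0 \<in> mesh_vertices \<T>" using M_in[of 1] by auto
  have step: "(\<lambda>k. r k b - r k a0) \<longlonglongrightarrow> 0"
    if T: "T \<in> \<T>" "a \<in> verts T" "b \<in> verts T" and a: "(\<lambda>k. r k a - r k a0) \<longlonglongrightarrow> 0" for T a b
  proof -
    \<comment> \<open>Every triangle has an interior vertex, through which two boundary vertices can
      be compared.\<close>
    obtain c where c: "c \<in> verts T" "c \<in> \<Omega>" using interior_vertex[OF T(1)] by blast
    have "(\<lambda>k. (r k a - r k a0) - (r k a - r k c) + (r k b - r k c)) \<longlonglongrightarrow> 0 - 0 + 0"
      by (intro tendsto_add tendsto_diff a edge[OF T(1) c(1) _ c(2)] T)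
    then show ?thesis by simp
  qed
  have all: "(\<lambda>k. r k b - r k a0) \<longlonglongrightarrow> 0" if "b \<in> mesh_vertices \<T>" for b
    by (rule mesh_vertices_connected[of a0 "\<lambda>b. (\<lambda>k. r k b - r k a0) \<longlonglongrightarrow> 0", OF a0 _ that step]) auto
  define \<eta> where "\<eta> k = (\<Sum>b\<in>mesh_vertices \<T>. \<bar>r k b - r k a0\<bar>)" for k
  have \<eta>: "\<eta> \<longlonglongrightarrow> 0"
    unfolding \<eta>_def using all by (intro tendsto_null_sum tendsto_rabs_zero)
  have dev: "\<bar>r k x - r k a0\<bar> \<le> \<eta> k" if x: "x \<in> closure \<Omega>" for k x
  proof -
    obtain T where T: "T \<in> \<T>" "x \<in> T" using x Union_mesh by blast
    note s = simplex2[OF T(1)]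
    have vT: "verts T \<subseteq> mesh_vertices \<T>" using T mesh_vertices_eq by blast
    have "r k x - r k a0 = (\<Sum>a\<in>verts T. bary T a x * r k a) - (\<Sum>a\<in>verts T. bary T a x) * r k a0"
      using Q_bary[OF rQ T] bary_sum(1)[OF s] by simp
    also have "\<dots> = (\<Sum>a\<in>verts T. bary T a x * (r k a - r k a0))"
      by (simp add: sum_distrib_right sum_subtractf right_diff_distrib)
    finally have "\<bar>r k x - r k a0\<bar> \<le> (\<Sum>a\<in>verts T. \<bar>bary T a x * (r k a - r k a0)\<bar>)" by simp
    also have "\<dots> \<le> (\<Sum>a\<in>verts T. \<bar>r k a - r k a0\<bar>)"
    proof (rule sum_mono)
      fix a assume a: "a \<in> verts T"
      have "0 \<le> bary T a x" "bary T a x \<le> 1"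
        using hat_nonneg[of a x] hat_le_1[of a x] hat_eq[OF T, of a] a by auto
      then show "\<bar>bary T a x * (r k a - r k a0)\<bar> \<le> \<bar>r k a - r k a0\<bar>"
        by (simp add: abs_mult mult_left_le_one_le)
    qed
    also have "\<dots> \<le> \<eta> k"
      unfolding \<eta>_def using vT finite_mesh_vertices by (intro sum_mono2) auto
    finally show ?thesis .
  qed
  \<comment> \<open>Zero mean: the integral of \<open>r k a0 - r k x\<close> is
    \<open>r k a0\<close> times the area, while the integrand stays within \<open>\<eta> k\<close>
    of zero.\<close>
  have base: "\<bar>r k a0\<bar> \<le> \<eta> k" for k
  proof -
    define vol where "vol = intg (\<lambda>x. 1)"
    have vol: "vol > 0"
    proof -
      obtain T where T: "T \<in> \<T>" "a0 \<in> verts T" using a0 unfolding mesh_vertices_eq by blast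
      have "0 < intg (\<lambda>x. hat a0 x * hat a0 x)" by (rule bubble_intg_pos[OF T T(2)])
      also have "\<dots> \<le> vol" unfolding vol_def
        by (rule intg_mono) (intro pw_cont_mult pw_C1_pw_cont pw_C1_hat pw_cont_const mult_le_one hat_le_1 hat_nonneg)+
      finally show ?thesis .
    qed
    note p = pw_C1_pw_cont[OF pw_C1_Q[OF rQ]]
    have dev': "\<bar>r k x - r k a0\<bar> \<le> \<eta> k" if "x \<in> cells" for x
      using that cells_subset closure_subset[of \<Omega>] by (intro dev) blast
    have "intg (\<lambda>x. r k a0 * 1 - r k x) = r k a0 * vol"
      using intg_diff[OF pw_cont_cmult[OF pw_cont_const[of 1], of "r k a0"] p[of k]] r0[of k]
      unfolding intg_cmult vol_def by simp
    moreover have "intg (\<lambda>x. r k a0 * 1 - r k x) \<le> intg (\<lambda>x. \<eta> k * 1)"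
      by (rule intg_mono[OF pw_cont_diff[OF pw_cont_cmult[OF pw_cont_const] p] pw_cont_cmult[OF pw_cont_const]])
        (use dev' in \<open>simp add: abs_le_iff algebra_simps\<close>)
    moreover have "intg (\<lambda>x. - \<eta> k * 1) \<le> intg (\<lambda>x. r k a0 * 1 - r k x)"
      by (rule intg_mono[OF pw_cont_cmult[OF pw_cont_const] pw_cont_diff[OF pw_cont_cmult[OF pw_cont_const] p]])
        (use dev' in \<open>simp add: abs_le_iff algebra_simps\<close>)
    ultimately have "r k a0 * vol \<le> \<eta> k * vol" "(- \<eta> k) * vol \<le> r k a0 * vol"
      unfolding intg_cmult vol_def by simp_all
    then have "r k a0 \<le> \<eta> k" "- \<eta> k \<le> r k a0" using vol by (simp_all only: mult_le_cancel_right_pos)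
    then show ?thesis by simp
  qed
  show ?thesis
  proof (rule that[of "\<lambda>k. 2 * \<eta> k"])
    show "(\<lambda>k. 2 * \<eta> k) \<longlonglongrightarrow> 0" using tendsto_mult_left[OF \<eta>, of 2] by simp
    show "\<bar>r k x\<bar> \<le> 2 * \<eta> k" if "x \<in> closure \<Omega>" for k x
      using dev[OF that, of k] base[of k] by linarith
  qed
qed

end

section \<open>Convergence of the iteration\<close>

lemma telescoping_tendsto_0:
  fixes N E :: "nat \<Rightarrow> real"
  assumes "\<And>k. N k \<ge> 0" "\<And>k. E k \<ge> 0" "c > 0" "\<And>k. N (Suc k) \<le> N k - c * E k"
  shows "E \<longlonglongrightarrow> 0"
proof -
  have "(\<Sum>k<j. c * E k) \<le> N 0 - N j" for j
  proof (induction j)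
    case (Suc j)
    then show ?case using assms(4)[of j] by simp
  qed simp
  then have "(\<Sum>k<j. c * E k) \<le> N 0" for j
    using assms(1)[of j] by (smt (verit))
  then have "summable (\<lambda>k. c * E k)"
    using assms(2,3) by (intro summableI_nonneg_bounded[of _ "N 0"]) auto
  then have "(\<lambda>k. c * E k) \<longlonglongrightarrow> 0" by (rule summable_LIMSEQ_zero)
  then have "(\<lambda>k. c * E k / c) \<longlonglongrightarrow> 0 / c" using assms(3) by (intro tendsto_divide) auto
  then show ?thesis using assms(3) by simp
qed

lemma Q0_space_diff:
  assumes p: "p \<in> Q0_space \<Omega> \<T>" "q \<in> Q0_space \<Omega> \<T>"
    and i: "set_integrable lebesgue \<Omega> p" "set_integrable lebesgue \<Omega> q"
  shows "(\<lambda>x. p x - q x) \<in> Q0_space \<Omega> \<T>"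
proof -
  have "is_poly_on 1 T (\<lambda>x. p x - q x)" if T: "T \<in> \<T>" for T
  proof -
    have "is_poly_on 1 T p" "is_poly_on 1 T q"
      using p T by (auto simp: Q0_space_def Q_space_def)
    then obtain a b c a' b' c' where
      "\<forall>x\<in>T. p x = a + b * x $ 1 + c * x $ 2" "\<forall>x\<in>T. q x = a' + b' * x $ 1 + c' * x $ 2"
      unfolding is_poly_on_1_iff by blast
    then have "\<forall>x\<in>T. p x - q x = (a - a') + (b - b') * x $ 1 + (c - c') * x $ 2"
      by (simp add: algebra_simps)
    then show ?thesis unfolding is_poly_on_1_iff by blast
  qed
  then show ?thesis
    using p i by (auto simp: Q0_space_def Q_space_def set_integral_diff intro!: continuous_intros)
qed

context meshed_domain
begin

text \<open>One constant per triangle and their sum for the mesh. The result depends on the mesh,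
  which is enough for convergence in \<open>H1_norm\<close> at fixed h.\<close>

lemma partial_estimate:
  assumes ball: "\<And>T. T \<in> \<T> \<Longrightarrow> \<exists>c r. r > 0 \<and> cball c r \<subseteq> T"
  obtains D where "\<And>v i j. v \<in> Vh \<Longrightarrow> intg (\<lambda>x. (partial v i j x)\<^sup>2) \<le> D * intg (\<lambda>x. (norm (v x))\<^sup>2)"
proof -
  have "\<exists>C\<ge>0. \<forall>w x j. is_poly_on 2 T w \<longrightarrow> x \<in> interior T \<longrightarrow>
      (dir_deriv (axis j 1) w x)\<^sup>2 \<le> C * (LINT x:T|lebesgue. (w x)\<^sup>2)" if T: "T \<in> \<T>" for T
  proof -
    obtain c r where "r > 0" "cball c r \<subseteq> T" using ball[OF T] by blast
    then show ?thesis using grad_estimate[OF compact_cell[OF T]] by metis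
  qed
  then have "\<forall>T\<in>\<T>. \<exists>C. C \<ge> 0 \<and> (\<forall>w x j. is_poly_on 2 T w \<longrightarrow> x \<in> interior T \<longrightarrow>
      (dir_deriv (axis j 1) w x)\<^sup>2 \<le> C * (LINT x:T|lebesgue. (w x)\<^sup>2))" by blast
  from bchoice[OF this] obtain C where C0: "\<And>T. T \<in> \<T> \<Longrightarrow> C T \<ge> 0"
    and C: "\<And>T w x j. T \<in> \<T> \<Longrightarrow> is_poly_on 2 T w \<Longrightarrow> x \<in> interior T \<Longrightarrow>
      (dir_deriv (axis j 1) w x)\<^sup>2 \<le> C T * (LINT x:T|lebesgue. (w x)\<^sup>2)"
    by blast
  define vol where "vol = intg (\<lambda>x. 1)"
  define S where "S = (\<Sum>T\<in>\<T>. C T)"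
  show ?thesis
  proof (rule that[of "S * vol"])
    fix v i j assume v: "v \<in> Vh"
    define I where "I = intg (\<lambda>x. (norm (v x))\<^sup>2)"
    have I0: "I \<ge> 0" unfolding I_def by (intro intg_nonneg) simp
    have pi: "pw_cont (\<lambda>x. (v x $ i)\<^sup>2)" for i by (intro pw_cont_power pw_C1_pw_cont pw_C1_V v)
    have pn: "pw_cont (\<lambda>x. (norm (v x))\<^sup>2)"
    proof -
      have "(norm (v x))\<^sup>2 = (v x $ 1)\<^sup>2 + (v x $ 2)\<^sup>2" for x
        unfolding power2_norm_eq_inner inner_pt by (simp add: power2_eq_square)
      then show ?thesis using pw_cont_add[OF pi[of 1] pi[of 2]] by simp
    qed
    have pt: "(partial v i j x)\<^sup>2 \<le> S * I * 1" if x: "x \<in> cells" for x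
    proof -
      obtain T where T: "T \<in> \<T>" "x \<in> interior T" using x by (auto simp: cells_def)
      have "(partial v i j x)\<^sup>2 \<le> C T * (LINT x:T|lebesgue. (v x $ i)\<^sup>2)"
        unfolding partial_eq_dir_deriv by (rule C[OF T(1) V_poly[OF v T(1)] T(2)])
      also have "\<dots> \<le> S * I"
      proof (rule mult_mono)
        show "C T \<le> S" unfolding S_def using C0 by (intro member_le_sum[OF T(1)] finite_mesh) blast
        show "0 \<le> S" unfolding S_def using C0 by (intro sum_nonneg)
        have "(\<Sum>T\<in>{T}. LINT x:T|lebesgue. (v x $ i)\<^sup>2) \<le> intg (\<lambda>x. (v x $ i)\<^sup>2)"
          by (rule sum_cells_le[OF pi]) (use T in auto)
        also have "\<dots> \<le> I"
          unfolding I_def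
        proof (rule intg_mono[OF pi pn])
          have "\<bar>v x $ i\<bar>\<^sup>2 \<le> (norm (v x))\<^sup>2" for x
            by (intro power_mono component_le_norm_cart) simp
          then show "(v x $ i)\<^sup>2 \<le> (norm (v x))\<^sup>2" for x by simp
        qed
        finally show "(LINT x:T|lebesgue. (v x $ i)\<^sup>2) \<le> I" by simp
        show "0 \<le> (LINT x:T|lebesgue. (v x $ i)\<^sup>2)"
          unfolding set_lebesgue_integral_def by (intro integral_nonneg_AE) simp
      qed
      finally show ?thesis by simp
    qed
    have "intg (\<lambda>x. (partial v i j x)\<^sup>2) \<le> intg (\<lambda>x. S * I * 1)"
      by (rule intg_mono[OF pw_cont_power[OF pw_cont_partial[OF v]] pw_cont_cmult[OF pw_cont_const] pt])
    also have "\<dots> = S * vol * I" unfolding intg_cmult vol_def by simp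
    finally show "intg (\<lambda>x. (partial v i j x)\<^sup>2) \<le> S * vol * intg (\<lambda>x. (norm (v x))\<^sup>2)"
      unfolding I_def .
  qed
qed

end

section \<open>Projection inequality, and recovery of the multiplier from test functions\<close>

context fem
begin

lemma tangent_props: "tangent n \<bullet> tangent n = 1" "tangent n \<bullet> n = 0"
  using unit_normal by (simp_all add: inner_pt tangent_nth)

lemma Lam_inner_nonneg: "Lam_inner g m M \<mu> \<mu> \<ge> 0"
proof -
  have nn: "0 \<le> dist (M i) (M (i+1)) * (let c = cmid i in
         g (M i) * \<mu> (M i) * \<mu> (M i) + 4 * g c * \<mu> c * \<mu> c
         + g (M (i+1)) * \<mu> (M (i+1)) * \<mu> (M (i+1)))" if i: "i \<in> {1..m}" for i
  proof -
    have gg: "g (M i) \<ge> 0" "g (cmid i) \<ge> 0" "g (M (i+1)) \<ge> 0"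
      using g_nonneg cmid(1)[OF i] M_in[of i] M_in[of "i+1"] i by auto
    have q: "g x * \<mu> x * \<mu> x \<ge> 0" if "g x \<ge> 0" for x
      using that by (simp add: mult.assoc)
    have "0 \<le> g (M i) * \<mu> (M i) * \<mu> (M i) + 4 * g (cmid i) * \<mu> (cmid i) * \<mu> (cmid i)
         + g (M (i+1)) * \<mu> (M (i+1)) * \<mu> (M (i+1))"
      using q[OF gg(1)] q[OF gg(2)] q[OF gg(3)] by (simp add: mult.assoc)
    then show ?thesis unfolding Let_def by (intro mult_nonneg_nonneg zero_le_dist)
  qed
  show ?thesis unfolding Lam_inner_def by (rule mult_nonneg_nonneg[OF _ sum_nonneg[OF nn]]) simp
qed

text \<open>Variational form of the nearest-point property: \<open>\<pi>\<close> is compared with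
  points of the segment towards \<open>\<mu>\<close>, which stays in the convex set.\<close>

lemma Lam_proj_ineq:
  assumes proj: "is_Lam_proj \<Gamma>1 g \<T> m M \<xi> \<pi>" and \<mu>: "\<mu> \<in> Lam_tilde \<Gamma>1 \<T> m M"
  shows "Lam_inner g m M (\<lambda>x. \<xi> x - \<pi> x) (\<lambda>x. \<mu> x - \<pi> x) \<le> 0"
proof (rule ccontr)
  assume neg: "\<not> ?thesis"
  let ?I = "Lam_inner g m M"
  define a where "a x = \<xi> x - \<pi> x" for x
  define b where "b x = \<mu> x - \<pi> x" for x
  define B where "B = ?I a b"
  define D where "D = ?I b b"
  have B: "B > 0" using neg unfolding B_def a_def[abs_def] b_def[abs_def] by simp
  have D: "D \<ge> 0" unfolding D_def by (rule Lam_inner_nonneg)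
  \<comment> \<open>Minimality will force \<open>2 * B \<le> t * D\<close>, so \<open>t\<close> is
    taken small enough for \<open>t * D\<close> to stay below \<open>B\<close>; the
    \<open>+ 1\<close> covers \<open>D = 0\<close>.\<close>
  define t where "t = min 1 (B / (D + 1))"
  have t: "0 < t" "t \<le> 1" using B D by (auto simp: t_def)
  have "\<pi> \<in> Lam_tilde \<Gamma>1 \<T> m M" using proj by (simp add: is_Lam_proj_def)
  then have "(\<lambda>x. \<pi> x + t * (\<mu> x - \<pi> x)) \<in> Lam_tilde \<Gamma>1 \<T> m M"
    using \<mu> t by (intro Lam_tilde_convex) auto
  then have "Lam_norm g m M (\<lambda>x. \<xi> x - \<pi> x) \<le> Lam_norm g m M (\<lambda>x. \<xi> x - (\<pi> x + t * (\<mu> x - \<pi> x)))"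
    using proj by (simp add: is_Lam_proj_def)
  moreover have "(\<lambda>x. \<xi> x - (\<pi> x + t * (\<mu> x - \<pi> x))) = (\<lambda>x. a x - t * b x)"
    by (simp add: a_def b_def algebra_simps)
  ultimately have "?I a a \<le> ?I (\<lambda>x. a x - t * b x) (\<lambda>x. a x - t * b x)"
    unfolding Lam_norm_def a_def[abs_def] by simp
  also have "\<dots> = ?I a a - 2 * t * B + t * t * D"
    unfolding Lam_inner_linear B_def D_def using Lam_inner_commute[of g m M b a] by (simp add: algebra_simps)
  finally have "t * (2 * B) \<le> t * (t * D)" by (simp add: algebra_simps)
  then have "2 * B \<le> t * D" using t by simp
  also have "\<dots> \<le> B / (D + 1) * D" using D by (intro mult_right_mono) (auto simp: t_def)
  also have "\<dots> = B * (D / (D + 1))" by simp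
  also have "\<dots> \<le> B * 1" using B D by (intro mult_left_mono) auto
  finally show False using B by simp
qed

lemma node_values:
  assumes i: "i \<in> {1..m+1}"
  shows "\<And>j. j \<in> {1..m+1} \<Longrightarrow> hat (M i) (M j) = (if i = j then 1 else 0)"
    and "\<And>j. j \<in> {1..m} \<Longrightarrow> hat (M i) (cmid j) = ((if i = j then 1 else 0) + (if i = j + 1 then 1 else 0)) / 2"
proof -
  show *: "hat (M i) (M j) = (if i = j then 1 else 0)" if j: "j \<in> {1..m+1}" for j
    using hat_vert[of "M i" "M j"] M_in[OF i] M_in[OF j] M_inj[OF i j] by simp
  show "hat (M i) (cmid j) = ((if i = j then 1 else 0) + (if i = j + 1 then 1 else 0)) / 2" if j: "j \<in> {1..m}" for j
  proof -
    have "hat (M i) (cmid j) = (hat (M i) (M j) + hat (M i) (M (j+1))) / 2"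
      using btri[OF j] M_in[OF i] by (intro hat_midpoint) auto
    then show ?thesis using *[of j] *[of "j+1"] j by simp
  qed
qed

text \<open>The edge bubble times the tangent vanishes at every mesh node except
  \<open>cmid i\<close>, so the pairing reads off a single value of \<open>\<delta>\<close>.\<close>

lemma cmid_test:
  assumes i: "i \<in> {1..m}"
  obtains v where "v \<in> Vn"
    "\<And>\<delta>. Lam_inner g m M (\<lambda>x. v x \<bullet> tangent n) \<delta> = dist (M i) (M (i+1)) / 6 * g (cmid i) * \<delta> (cmid i)"
proof -
  define \<phi> where "\<phi> x = hat (M i) x * hat (M (i+1)) x" for x
  define v where "v x = \<phi> x *\<^sub>R tangent n" for x
  have ii: "i \<in> {1..m+1}" "i+1 \<in> {1..m+1}" using i by auto
  have V: "v \<in> Vh" using hat_mult_V unfolding v_def[abs_def] \<phi>_def[abs_def] .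
  have vert: "\<phi> x = 0" if "x \<in> mesh_vertices \<T>" for x
    using hat_vert[OF _ that, of "M i"] hat_vert[OF _ that, of "M (i+1)"] M_in[OF ii(1)] M_in[OF ii(2)] M_inj[OF ii]
    by (auto simp: \<phi>_def)
  have mid: "x = cmid i" if T: "T \<in> \<T>" "a \<in> verts T" "b \<in> verts T" "a \<noteq> b" "x = midpoint a b" and ne: "\<phi> x \<noteq> 0"
    for x T a b
  proof -
    have ab: "a \<in> mesh_vertices \<T>" "b \<in> mesh_vertices \<T>" using T mesh_vertices_eq by blast+
    have 1: "M i \<in> mesh_vertices \<T>" "M (i+1) \<in> mesh_vertices \<T>" using M_in[OF ii(1)] M_in[OF ii(2)] by auto
    have "hat (M i) x \<noteq> 0" "hat (M (i+1)) x \<noteq> 0" using ne by (auto simp: \<phi>_def)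
    then have "M i = a \<or> M i = b" "M (i+1) = a \<or> M (i+1) = b"
      unfolding T(5) using hat_midpoint[OF 1(1) T(1-3)] hat_midpoint[OF 1(2) T(1-3)]
        hat_vert[OF 1(1) ab(1)] hat_vert[OF 1(1) ab(2)] hat_vert[OF 1(2) ab(1)] hat_vert[OF 1(2) ab(2)]
      by (auto split: if_splits)
    moreover have "M i \<noteq> M (i+1)" using M_inj[OF ii] by simp
    ultimately show ?thesis unfolding T(5) by (metis midpoint_sym)
  qed
  have "v x = 0" if "x \<in> closure \<Gamma>0" "x \<in> mesh_nodes \<T>" for x
  proof (rule ccontr)
    assume "v x \<noteq> 0"
    then have "\<phi> x \<noteq> 0" by (auto simp: v_def)
    then have "x = cmid i" using that(2) vert mid unfolding mesh_nodes_iff by blast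
    then show False using cmid(3)[OF i] that(1) by simp
  qed
  then have "v \<in> Vn" using V tangent_props by (auto simp: Vn_space_def v_def)
  moreover have "Lam_inner g m M (\<lambda>x. v x \<bullet> tangent n) \<delta> = dist (M i) (M (i+1)) / 6 * g (cmid i) * \<delta> (cmid i)" for \<delta>
  proof -
    have vt: "v x \<bullet> tangent n = \<phi> x" for x using tangent_props by (simp add: v_def)
    have "dist (M j) (M (j+1)) * (let c = cmid j in
         g (M j) * (v (M j) \<bullet> tangent n) * \<delta> (M j) + 4 * g c * (v c \<bullet> tangent n) * \<delta> c
         + g (M (j+1)) * (v (M (j+1)) \<bullet> tangent n) * \<delta> (M (j+1)))
      = (if j = i then dist (M i) (M (i+1)) * (g (cmid i) * \<delta> (cmid i)) else 0)" if j: "j \<in> {1..m}" for j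
    proof -
      have "\<phi> (M j) = 0" "\<phi> (M (j+1)) = 0" using vert M_in[of j] M_in[of "j+1"] j by auto
      \<comment> \<open>The bubble takes the value \<open>1/2 * 1/2\<close> at its midpoint, which
        cancels the Simpson weight 4.\<close>
      moreover have "\<phi> (cmid j) = (if j = i then 1/4 else 0)"
        unfolding \<phi>_def node_values(2)[OF ii(1) j] node_values(2)[OF ii(2) j] by auto
      ultimately show ?thesis by (simp add: vt Let_def)
    qed
    then have "Lam_inner g m M (\<lambda>x. v x \<bullet> tangent n) \<delta>
      = 1/6 * (\<Sum>j=1..m. if j = i then dist (M i) (M (i+1)) * (g (cmid i) * \<delta> (cmid i)) else 0)"
      unfolding Lam_inner_def by (intro arg_cong[where f="(*) (1/6)"] sum.cong refl)
    also have "\<dots> = dist (M i) (M (i+1)) / 6 * g (cmid i) * \<delta> (cmid i)"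
      using i by (simp add: sum.delta)
    finally show ?thesis .
  qed
  ultimately show ?thesis by (rule that)
qed

text \<open>\<open>\<phi>\<close> is the quadratic nodal function of \<open>M i\<close>: 1 there, 0
  at the other vertices and at all midpoints. The range \<open>{2..m}\<close> leaves out the ends of
  the side, which may belong to \<open>closure \<Gamma>0\<close>.\<close>

lemma vertex_test:
  assumes i: "i \<in> {2..m}"
  obtains v where "v \<in> Vn"
    "\<And>\<delta>. Lam_inner g m M (\<lambda>x. v x \<bullet> tangent n) \<delta>
      = (dist (M i) (M (i+1)) + dist (M (i-1)) (M i)) / 6 * g (M i) * \<delta> (M i)"
proof -
  define \<phi> where "\<phi> x = hat (M i) x * (2 * hat (M i) x - 1)" for x
  define v where "v x = \<phi> x *\<^sub>R tangent n" for x
  have ii: "i \<in> {1..m+1}" using i by auto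
  have 1: "M i \<in> mesh_vertices \<T>" using M_in[OF ii] by simp
  have V: "v \<in> Vh"
    unfolding v_def[abs_def]
  proof (rule scalar_V)
    show "continuous_on (closure \<Omega>) \<phi>"
      unfolding \<phi>_def[abs_def] using continuous_on_hat unfolding Union_mesh by (intro continuous_intros) auto
    show "is_poly_on 2 T \<phi>" if T: "T \<in> \<T>" for T
    proof -
      obtain \<alpha> \<beta> \<gamma> where h: "\<forall>x\<in>T. hat (M i) x = \<alpha> + \<beta> * x $ 1 + \<gamma> * x $ 2" by (rule hat_affine[OF T])
      then have "\<forall>x\<in>T. 2 * hat (M i) x - 1 = (2 * \<alpha> - 1) + (2 * \<beta>) * x $ 1 + (2 * \<gamma>) * x $ 2" by simp
      then show ?thesis unfolding \<phi>_def[abs_def] by (rule affine_mult_is_poly_on_2[OF h])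
    qed
  qed
  have vert: "\<phi> x = (if x = M i then 1 else 0)" if "x \<in> mesh_vertices \<T>" for x
    using hat_vert[OF 1 that] by (auto simp: \<phi>_def)
  have mid: "\<phi> x = 0" if T: "T \<in> \<T>" "a \<in> verts T" "b \<in> verts T" "a \<noteq> b" "x = midpoint a b" for x T a b
  proof -
    have ab: "a \<in> mesh_vertices \<T>" "b \<in> mesh_vertices \<T>" using T mesh_vertices_eq by blast+
    show ?thesis
      unfolding \<phi>_def T(5) hat_midpoint[OF 1 T(1-3)] hat_vert[OF 1 ab(1)] hat_vert[OF 1 ab(2)]
      using T(4) by auto
  qed
  have "v x = 0" if "x \<in> closure \<Gamma>0" "x \<in> mesh_nodes \<T>" for x
  proof -
    have "x \<noteq> M i" using M_not_closure_\<Gamma>0[OF i] that(1) by blast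
    then have "\<phi> x = 0" using that(2) vert mid unfolding mesh_nodes_iff by auto
    then show ?thesis by (simp add: v_def)
  qed
  then have "v \<in> Vn" using V tangent_props by (auto simp: Vn_space_def v_def)
  moreover have "Lam_inner g m M (\<lambda>x. v x \<bullet> tangent n) \<delta>
      = (dist (M i) (M (i+1)) + dist (M (i-1)) (M i)) / 6 * g (M i) * \<delta> (M i)" for \<delta>
  proof -
    have vt: "v x \<bullet> tangent n = \<phi> x" for x using tangent_props by (simp add: v_def)
    \<comment> \<open>The vertex \<open>M i\<close> is the left end of edge \<open>i\<close> and the
      right end of edge \<open>i - 1\<close>, hence two contributions.\<close>
    have "dist (M j) (M (j+1)) * (let c = cmid j in
         g (M j) * (v (M j) \<bullet> tangent n) * \<delta> (M j) + 4 * g c * (v c \<bullet> tangent n) * \<delta> c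
         + g (M (j+1)) * (v (M (j+1)) \<bullet> tangent n) * \<delta> (M (j+1)))
      = (if j = i then dist (M i) (M (i+1)) * (g (M i) * \<delta> (M i)) else 0)
        + (if j = i - 1 then dist (M (i-1)) (M i) * (g (M i) * \<delta> (M i)) else 0)" if j: "j \<in> {1..m}" for j
    proof -
      have jj: "j \<in> {1..m+1}" "j+1 \<in> {1..m+1}" using j by auto
      have "\<phi> (M j) = (if j = i then 1 else 0)" "\<phi> (M (j+1)) = (if j + 1 = i then 1 else 0)"
        using vert M_in[OF jj(1)] M_in[OF jj(2)] M_inj[OF jj(1) ii] M_inj[OF jj(2) ii] by auto
      moreover have "\<phi> (cmid j) = 0"
        unfolding \<phi>_def node_values(2)[OF ii j] by auto
      moreover have "j + 1 = i \<longleftrightarrow> j = i - 1" using i by auto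
      ultimately show ?thesis using i by (auto simp: vt Let_def)
    qed
    then have "Lam_inner g m M (\<lambda>x. v x \<bullet> tangent n) \<delta>
      = 1/6 * (\<Sum>j=1..m. (if j = i then dist (M i) (M (i+1)) * (g (M i) * \<delta> (M i)) else 0)
        + (if j = i - 1 then dist (M (i-1)) (M i) * (g (M i) * \<delta> (M i)) else 0))"
      unfolding Lam_inner_def by (intro arg_cong[where f="(*) (1/6)"] sum.cong refl)
    also have "\<dots> = 1/6 * (dist (M i) (M (i+1)) * (g (M i) * \<delta> (M i)) + dist (M (i-1)) (M i) * (g (M i) * \<delta> (M i)))"
    proof -
      have "i \<in> {1..m}" "i - 1 \<in> {1..m}" using i by auto
      then show ?thesis by (simp only: sum.distrib sum.delta finite_atLeastAtMost if_True)
    qed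
    also have "\<dots> = (dist (M i) (M (i+1)) + dist (M (i-1)) (M i)) / 6 * g (M i) * \<delta> (M i)"
      by (simp add: algebra_simps)
    finally show ?thesis .
  qed
  ultimately show ?thesis by (rule that)
qed

text \<open>Each test function isolates the product of \<open>g\<close> and
  \<open>\<delta> k\<close> at one node; the two ends of the side have no test function and are
  covered by \<open>ends\<close>.\<close>

lemma Lam_norm_tendsto_0:
  assumes lim: "\<And>v. v \<in> Vn \<Longrightarrow> (\<lambda>k. Lam_inner g m M (\<lambda>x. v x \<bullet> tangent n) (\<delta> k)) \<longlonglongrightarrow> 0"
    and ends: "\<And>k. \<delta> k (M 1) = 0" "\<And>k. \<delta> k (M (m+1)) = 0"
  shows "(\<lambda>k. Lam_norm g m M (\<delta> k)) \<longlonglongrightarrow> 0"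
proof -
  \<comment> \<open>\<open>\<Gamma>1\<close> may omit points of the side, and \<open>g\<close> may vanish there: the norm is only a seminorm.\<close>
  have scale: "(\<lambda>k. g x * \<delta> k x * \<delta> k x) \<longlonglongrightarrow> 0" if c: "c > 0" and l: "(\<lambda>k. c * g x * \<delta> k x) \<longlonglongrightarrow> 0" for c x
  proof (cases "g x = 0")
    case False
    have "(\<lambda>k. c * g x * \<delta> k x / (c * g x)) \<longlonglongrightarrow> 0 / (c * g x)"
      using l c False by (intro tendsto_divide) auto
    then have d: "(\<lambda>k. \<delta> k x) \<longlonglongrightarrow> 0" using c False by simp
    have "(\<lambda>k. g x * \<delta> k x * \<delta> k x) \<longlonglongrightarrow> g x * 0 * 0" by (intro tendsto_mult tendsto_const d)
    then show ?thesis by simp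
  qed simp
  have mids: "(\<lambda>k. g (cmid i) * \<delta> k (cmid i) * \<delta> k (cmid i)) \<longlonglongrightarrow> 0" if i: "i \<in> {1..m}" for i
  proof -
    obtain v where v: "v \<in> Vn" "\<And>\<delta>. Lam_inner g m M (\<lambda>x. v x \<bullet> tangent n) \<delta> = dist (M i) (M (i+1)) / 6 * g (cmid i) * \<delta> (cmid i)"
      using cmid_test[OF i] by blast
    have "dist (M i) (M (i+1)) / 6 > 0" using M_inj[of i "i+1"] i by simp
    then show ?thesis using lim[OF v(1)] unfolding v(2) by (rule scale)
  qed
  have verts: "(\<lambda>k. g (M i) * \<delta> k (M i) * \<delta> k (M i)) \<longlonglongrightarrow> 0" if i: "i \<in> {1..m+1}" for i
  proof -
    consider "i = 1" | "i = m + 1" | "i \<in> {2..m}" using i by fastforce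
    then show ?thesis
    proof cases
      case 3
      obtain v where v: "v \<in> Vn" "\<And>\<delta>. Lam_inner g m M (\<lambda>x. v x \<bullet> tangent n) \<delta>
          = (dist (M i) (M (i+1)) + dist (M (i-1)) (M i)) / 6 * g (M i) * \<delta> (M i)"
        using vertex_test[OF 3] by blast
      have "M i \<noteq> M (i+1)" using M_inj[of i "i+1"] 3 by simp
      then have "dist (M i) (M (i+1)) + dist (M (i-1)) (M i) > 0" by (intro add_pos_nonneg) auto
      then have "(dist (M i) (M (i+1)) + dist (M (i-1)) (M i)) / 6 > 0" by simp
      then show ?thesis using lim[OF v(1)] unfolding v(2) by (rule scale)
    qed (simp_all only: ends mult_zero_right tendsto_const)
  qed
  have "(\<lambda>k. Lam_inner g m M (\<delta> k) (\<delta> k)) \<longlonglongrightarrow> 1/6 * (\<Sum>i=1..m. dist (M i) (M (i+1)) * (0 + 4 * 0 + 0))"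
    unfolding Lam_inner_def Let_def mult.assoc[of 4]
    by (intro tendsto_mult tendsto_const tendsto_sum tendsto_add mids verts) auto
  then have "(\<lambda>k. Lam_inner g m M (\<delta> k) (\<delta> k)) \<longlonglongrightarrow> 0" by simp
  then have "(\<lambda>k. sqrt (Lam_inner g m M (\<delta> k) (\<delta> k))) \<longlonglongrightarrow> sqrt 0" by (rule tendsto_real_sqrt)
  then show ?thesis unfolding Lam_norm_def by simp
qed

end

section \<open>The error recursion of the iteration and its three limits\<close>

context fem
begin

lemma Lam_inner_zero_nodes:
  assumes "\<And>x. x \<in> closure \<Gamma>1 \<Longrightarrow> \<mu> x = 0"
  shows "Lam_inner g m M \<mu> \<delta> = 0"
proof -
  have "\<mu> (M i) = 0" "\<mu> (M (i+1)) = 0" "\<mu> (cmid i) = 0" if i: "i \<in> {1..m}" for i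
    using assms cmid(1)[OF i] M_in[of i] M_in[of "i+1"] i by auto
  then show ?thesis unfolding Lam_inner_def Let_def by (simp add: sum.neutral)
qed

text \<open>The squared \<open>Lam_norm\<close> of the multiplier error is a Lyapunov function: a
  step lowers it by at least \<open>\<rho> * (4 * \<nu> - \<rho> * B)\<close> times the energy of
  the velocity error. The condition on \<open>\<rho>\<close> makes this factor positive.\<close>

lemma uzawa_convergence:
  assumes B: "B \<ge> 0" "\<And>v. v \<in> Vn \<Longrightarrow>
      Lam_inner g m M (\<lambda>x. v x \<bullet> tangent n) (\<lambda>x. v x \<bullet> tangent n) \<le> B * energy v"
    and poincare: "\<And>v. v \<in> Vn \<Longrightarrow> intg (\<lambda>x. (norm (v x))\<^sup>2) \<le> A * energy v"
    and \<rho>: "0 < \<rho>" "\<rho> * B < 4 * \<nu>"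
    and sol: "VE_solution \<Omega> \<Gamma>0 \<Gamma>1 n \<nu> f g \<T> m M u p l"
    and init: "L 1 \<in> Lam_tilde \<Gamma>1 \<T> m M"
    and step1: "\<And>k. k \<ge> 1 \<Longrightarrow> uzawa_step1 \<Omega> \<Gamma>0 \<Gamma>1 n \<nu> f g \<T> m M (L k) (U k) (P k)"
    and step2: "\<And>k. k \<ge> 1 \<Longrightarrow> uzawa_step2 \<Gamma>1 n g \<T> m M \<rho> (U k) (L k) (L (k + 1))"
  shows "(\<lambda>k. H1_norm \<Omega> (\<lambda>x. U k x - u x)) \<longlonglongrightarrow> 0"
    and "(\<lambda>k. L2_norm_on \<Omega> (\<lambda>x. P k x - p x)) \<longlonglongrightarrow> 0"
    and "(\<lambda>k. Lam_norm g m M (\<lambda>x. L k x - l x)) \<longlonglongrightarrow> 0"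
proof -
  let ?I = "Lam_inner g m M" and ?\<tau> = "tangent n"
  \<comment> \<open>Index shift: the iteration starts at 1, the error sequences at 0.\<close>
  define w where "w k x = U (Suc k) x - u x" for k x
  define r where "r k x = P (Suc k) x - p x" for k x
  define \<delta> where "\<delta> k x = L (Suc k) x - l x" for k x
  define w\<tau> where "w\<tau> k x = w k x \<bullet> ?\<tau>" for k x
  have Lt: "L (Suc k) \<in> Lam_tilde \<Gamma>1 \<T> m M" for k
  proof (cases k)
    case 0
    then show ?thesis using init by simp
  next
    case (Suc j)
    then show ?thesis using step2[of "Suc j"] by (simp add: uzawa_step2_def is_Lam_proj_def)
  qed
  have s1: "U (Suc k) \<in> Vn" "P (Suc k) \<in> Q0_space \<Omega> \<T>"
    "\<And>v. v \<in> Vn \<Longrightarrow> form_a \<Omega> \<nu> (U (Suc k)) v + form_b \<Omega> v (P (Suc k))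
        = L2_inner \<Omega> f v - ?I (\<lambda>x. v x \<bullet> ?\<tau>) (L (Suc k))"
    "\<And>q. q \<in> Q0_space \<Omega> \<T> \<Longrightarrow> form_b \<Omega> (U (Suc k)) q = 0" for k
    using step1[of "Suc k"] unfolding uzawa_step1_def by simp_all
  have s0: "u \<in> Vn" "p \<in> Q0_space \<Omega> \<T>" "l \<in> Lam_tilde \<Gamma>1 \<T> m M"
    "\<And>v. v \<in> Vn \<Longrightarrow> form_a \<Omega> \<nu> u v + form_b \<Omega> v p + ?I (\<lambda>x. v x \<bullet> ?\<tau>) l = L2_inner \<Omega> f v"
    "\<And>q. q \<in> Q0_space \<Omega> \<T> \<Longrightarrow> form_b \<Omega> u q = 0"
    "\<And>\<mu>. \<mu> \<in> Lam_tilde \<Gamma>1 \<T> m M \<Longrightarrow> ?I (\<lambda>x. u x \<bullet> ?\<tau>) (\<lambda>x. \<mu> x - l x) \<le> 0"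
    using sol unfolding VE_solution_def by simp_all
  have pQ: "pw_cont q" if "q \<in> Q0_space \<Omega> \<T>" for q
    using that by (intro pw_C1_pw_cont pw_C1_Q) (simp add: Q0_space_def)
  have wV: "w k \<in> Vn" for k unfolding w_def[abs_def] by (rule Vn_space_diff[OF s1(1) s0(1)])
  have wVh: "w k \<in> Vh" for k using wV by (rule Vn_V)
  have rQ: "r k \<in> Q0_space \<Omega> \<T>" for k
    unfolding r_def[abs_def]
    by (rule Q0_space_diff[OF s1(2) s0(2) pw_cont_integrable[OF pQ[OF s1(2)]] pw_cont_integrable[OF pQ[OF s0(2)]]])
  have bw: "form_b \<Omega> (w k) q = 0" if q: "q \<in> Q0_space \<Omega> \<T>" for k q
    unfolding w_def[abs_def] form_b_diff_left[OF Vn_V[OF s1(1)] Vn_V[OF s0(1)] pQ[OF q]]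
    using s1(4)[OF q] s0(5)[OF q] by simp
  have err: "form_a \<Omega> \<nu> (w k) v + form_b \<Omega> v (r k) + ?I (\<lambda>x. v x \<bullet> ?\<tau>) (\<delta> k) = 0" if v: "v \<in> Vn" for k v
    unfolding w_def[abs_def] r_def[abs_def] \<delta>_def[abs_def]
      form_a_diff_left[OF Vn_V[OF s1(1)] Vn_V[OF s0(1)] Vn_V[OF v]]
      form_b_diff_right[OF Vn_V[OF v] pQ[OF s1(2)] pQ[OF s0(2)]] Lam_inner_diff_right
    using s1(3)[OF v, of k] s0(4)[OF v] by simp
  define E where "E k = energy (w k)" for k
  have E0: "E k \<ge> 0" for k unfolding E_def by (rule energy_nonneg)
  \<comment> \<open>The error equation is tested with \<open>w k\<close> itself. The pressure term
    drops because \<open>w k\<close> is discretely divergence-free and \<open>r k\<close> is an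
    admissible test function in \<open>bw\<close>.\<close>
  have energy_eq: "?I (w\<tau> k) (\<delta> k) = - (2 * \<nu> * E k)" for k
    using err[OF wV, of k k] bw[OF rQ, of k k] form_a_self[OF wVh, of \<nu> k]
    unfolding w\<tau>_def[abs_def] E_def by simp
  define N where "N k = ?I (\<delta> k) (\<delta> k)" for k
  have N0: "N k \<ge> 0" for k unfolding N_def by (rule Lam_inner_nonneg)
  have decr: "N (Suc k) \<le> N k - \<rho> * (4 * \<nu> - \<rho> * B) * E k" for k
  proof -
    define a where "a x = \<delta> k x + \<rho> * w\<tau> k x" for x
    define u\<tau> where "u\<tau> x = u x \<bullet> ?\<tau>" for x
    define \<delta>' where "\<delta>' = \<delta> (Suc k)"
    have "is_Lam_proj \<Gamma>1 g \<T> m M (\<lambda>x. L (Suc k) x + \<rho> * (U (Suc k) x \<bullet> ?\<tau>)) (L (Suc (Suc k)))"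
      using step2[of "Suc k"] by (simp add: uzawa_step2_def)
    \<comment> \<open>The projection is compared with \<open>l\<close>. In terms of errors, the
      projected point minus its projection is \<open>a + \<rho> * u\<tau> - \<delta>'\<close>, and
      \<open>l\<close> minus the projection is \<open>- \<delta>'\<close>.\<close>
    from Lam_proj_ineq[OF this s0(3)]
    have "?I (\<lambda>x. (a x + \<rho> * u\<tau> x) - \<delta>' x) (\<lambda>x. (-1) * \<delta>' x) \<le> 0"
      by (simp add: a_def u\<tau>_def \<delta>'_def \<delta>_def w\<tau>_def w_def inner_diff_left algebra_simps)
    then have "?I \<delta>' \<delta>' \<le> ?I a \<delta>' + \<rho> * ?I u\<tau> \<delta>'"
      unfolding Lam_inner_linear by simp
    \<comment> \<open>The inequality of the exact solution, tested with the new iterate, gives the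
      \<open>u\<tau>\<close> term the sign that lets it be dropped.\<close>
    moreover have "?I u\<tau> \<delta>' \<le> 0"
      using s0(6)[OF Lt[of "Suc k"]] unfolding u\<tau>_def[abs_def] \<delta>'_def \<delta>_def[abs_def] .
    then have "\<rho> * ?I u\<tau> \<delta>' \<le> 0" using \<rho> by (simp add: mult_nonneg_nonpos)
    ultimately have 1: "?I \<delta>' \<delta>' \<le> ?I a \<delta>'" by simp
    \<comment> \<open>Expanding this square replaces the mixed product by \<open>?I a a\<close>:
      nonexpansiveness, which holds even though \<open>?I\<close> is only known to be
      semidefinite.\<close>
    have "0 \<le> ?I (\<lambda>x. a x - \<delta>' x) (\<lambda>x. a x - \<delta>' x)" by (rule Lam_inner_nonneg)
    also have "\<dots> = ?I a a - 2 * ?I a \<delta>' + ?I \<delta>' \<delta>'"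
      unfolding Lam_inner_linear using Lam_inner_commute[of g m M \<delta>' a] by simp
    finally have "?I \<delta>' \<delta>' \<le> ?I a a" using 1 by simp
    also have "?I a a = N k + 2 * \<rho> * ?I (w\<tau> k) (\<delta> k) + \<rho> * \<rho> * ?I (w\<tau> k) (w\<tau> k)"
      unfolding a_def[abs_def] Lam_inner_linear N_def using Lam_inner_commute[of g m M "\<delta> k" "w\<tau> k"]
      by (simp add: algebra_simps)
    also have "\<dots> \<le> N k + 2 * \<rho> * (- (2 * \<nu> * E k)) + \<rho> * \<rho> * (B * E k)"
    proof -
      have "\<rho> * \<rho> * ?I (w\<tau> k) (w\<tau> k) \<le> \<rho> * \<rho> * (B * E k)"
        using B(2)[OF wV] \<rho> unfolding w\<tau>_def[abs_def] E_def by (intro mult_left_mono) auto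
      then show ?thesis unfolding energy_eq by simp
    qed
    finally show ?thesis unfolding N_def \<delta>'_def by (simp add: algebra_simps)
  qed
  have E_lim: "E \<longlonglongrightarrow> 0"
    by (rule telescoping_tendsto_0[where N=N and c="\<rho> * (4 * \<nu> - \<rho> * B)", OF N0 E0 _ decr])
      (use \<rho> in simp)

  have norm_lim: "(\<lambda>k. intg (\<lambda>x. (norm (w k x))\<^sup>2)) \<longlonglongrightarrow> 0"
  proof (rule tendsto_sandwich[OF always_eventually always_eventually tendsto_const])
    show "\<forall>k. 0 \<le> intg (\<lambda>x. (norm (w k x))\<^sup>2)" by (auto intro: intg_nonneg)
    show "\<forall>k. intg (\<lambda>x. (norm (w k x))\<^sup>2) \<le> A * E k" using poincare[OF wV] by (simp add: E_def)
    show "(\<lambda>k. A * E k) \<longlonglongrightarrow> 0" using tendsto_mult_left[OF E_lim, of A] by simp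
  qed
  have ball: "\<exists>c r. r > 0 \<and> cball c r \<subseteq> T" if T: "T \<in> \<T>" for T
  proof -
    obtain c0 c1 where "cball c0 (K * h) \<subseteq> T" "T \<subseteq> cball c1 (K' * h)" by (rule cell_balls[OF T])
    moreover have "K * h > 0" using K_pos h_pos by simp
    ultimately show ?thesis by blast
  qed
  obtain D where D: "\<And>v i j. v \<in> Vh \<Longrightarrow> intg (\<lambda>x. (partial v i j x)\<^sup>2) \<le> D * intg (\<lambda>x. (norm (v x))\<^sup>2)"
    using partial_estimate[OF ball] by blast
  have partial_lim: "(\<lambda>k. intg (\<lambda>x. (partial (w k) i j x)\<^sup>2)) \<longlonglongrightarrow> 0" for i j
  proof (rule tendsto_sandwich[OF always_eventually always_eventually tendsto_const])
    show "\<forall>k. 0 \<le> intg (\<lambda>x. (partial (w k) i j x)\<^sup>2)" by (auto intro: intg_nonneg)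
    show "\<forall>k. intg (\<lambda>x. (partial (w k) i j x)\<^sup>2) \<le> D * intg (\<lambda>x. (norm (w k x))\<^sup>2)"
      using D[OF wVh] by blast
    show "(\<lambda>k. D * intg (\<lambda>x. (norm (w k x))\<^sup>2)) \<longlonglongrightarrow> 0" using tendsto_mult_left[OF norm_lim, of D] by simp
  qed
  have "(\<lambda>k. H1_norm \<Omega> (w k)) \<longlonglongrightarrow> sqrt (0 + (\<Sum>i\<in>(UNIV::2 set). \<Sum>j\<in>(UNIV::2 set). 0))"
    unfolding H1_norm_def
    by (intro tendsto_real_sqrt tendsto_add tendsto_sum norm_lim partial_lim)
  then have "(\<lambda>k. H1_norm \<Omega> (\<lambda>x. U (Suc k) x - u x)) \<longlonglongrightarrow> 0" unfolding w_def[abs_def] by simp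
  then show "(\<lambda>k. H1_norm \<Omega> (\<lambda>x. U k x - u x)) \<longlonglongrightarrow> 0"
    by (rule filterlim_sequentially_Suc[THEN iffD1])

  have a_lim: "(\<lambda>k. form_a \<Omega> \<nu> (w k) v) \<longlonglongrightarrow> 0" if v: "v \<in> Vh" for v
  proof (rule LIMSEQ_I)
    fix e :: real assume e: "e > 0"
    \<comment> \<open>The \<open>+ 1\<close> keeps \<open>y\<close> positive and strictly above
      \<open>energy v\<close>; \<open>\<theta>\<close> is then chosen so that the fixed part of
      \<open>form_a_bound\<close> stays below \<open>e / 2\<close>.\<close>
    define y where "y = energy v + 1"
    have y: "y > 0" "energy v < y" using energy_nonneg[of v] by (simp_all add: y_def)
    define \<theta> where "\<theta> = 2 * \<nu> * y / e"
    have \<theta>: "\<theta> > 0" using \<nu>_pos e y by (simp add: \<theta>_def)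
    have "\<nu> * (energy v / \<theta>) = e / 2 * (energy v / y)"
      using \<nu>_pos e y by (simp add: \<theta>_def)
    also have "\<dots> < e / 2 * 1"
      using e y by (intro mult_strict_left_mono) auto
    finally have small: "\<nu> * (energy v / \<theta>) < e / 2" by simp
    have "(\<lambda>k. \<nu> * \<theta> * E k) \<longlonglongrightarrow> 0" using tendsto_mult_left[OF E_lim, of "\<nu> * \<theta>"] by simp
    then obtain k0 where k0: "\<And>k. k \<ge> k0 \<Longrightarrow> norm (\<nu> * \<theta> * E k - 0) < e / 2"
      using LIMSEQ_D[of _ 0 "e/2"] e by (metis half_gt_zero)
    show "\<exists>no. \<forall>k\<ge>no. norm (form_a \<Omega> \<nu> (w k) v - 0) < e"
    proof (intro exI allI impI)
      fix k assume k: "k \<ge> k0"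
      have "\<bar>form_a \<Omega> \<nu> (w k) v\<bar> \<le> \<nu> * (\<theta> * E k + energy v / \<theta>)"
        unfolding E_def by (rule form_a_bound[OF wVh v \<theta> \<nu>_pos])
      also have "\<dots> = \<nu> * \<theta> * E k + \<nu> * (energy v / \<theta>)" by (simp add: distrib_left)
      also have "\<dots> < e"
      proof -
        have half: "norm (s - 0) < e / 2 \<Longrightarrow> t < e / 2 \<Longrightarrow> s + t < e" for s t :: real by auto
        show ?thesis by (rule half[OF k0[OF k] small])
      qed
      finally show "norm (form_a \<Omega> \<nu> (w k) v - 0) < e" by simp
    qed
  qed
  have b_lim0: "(\<lambda>k. form_b \<Omega> v (r k)) \<longlonglongrightarrow> 0"
    if v: "v \<in> Vh" and z: "\<And>x. x \<in> frontier \<Omega> \<Longrightarrow> v x = 0" for v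
  proof -
    have "?I (\<lambda>x. v x \<bullet> ?\<tau>) (\<delta> k) = 0" for k
      by (rule Lam_inner_zero_nodes) (use z side_subset in auto)
    then have "form_b \<Omega> v (r k) = - form_a \<Omega> \<nu> (w k) v" for k
      using err[OF zero_on_frontier_Vn[OF v z], of k] by simp
    then show ?thesis using tendsto_minus[OF a_lim[OF v]] by simp
  qed
  obtain \<epsilon> where \<epsilon>: "\<epsilon> \<longlonglongrightarrow> 0" "\<And>k x. x \<in> closure \<Omega> \<Longrightarrow> \<bar>r k x\<bar> \<le> \<epsilon> k"
    using pressure_tendsto_0[of r, OF rQ b_lim0] by blast
  have \<epsilon>': "\<bar>r k x\<bar> \<le> \<epsilon> k" if "x \<in> cells" for k x
    using that cells_subset closure_subset[of \<Omega>] by (intro \<epsilon>(2)) blast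
  have "(\<lambda>k. intg (\<lambda>x. (r k x)\<^sup>2)) \<longlonglongrightarrow> 0"
  proof (rule tendsto_sandwich[OF always_eventually always_eventually tendsto_const])
    show "\<forall>k. 0 \<le> intg (\<lambda>x. (r k x)\<^sup>2)" by (auto intro: intg_nonneg)
    show "\<forall>k. intg (\<lambda>x. (r k x)\<^sup>2) \<le> (\<epsilon> k)\<^sup>2 * intg (\<lambda>x. 1)"
    proof
      fix k
      have "intg (\<lambda>x. (r k x)\<^sup>2) \<le> intg (\<lambda>x. (\<epsilon> k)\<^sup>2 * 1)"
      proof (rule intg_mono[OF pw_cont_power[OF pQ[OF rQ]] pw_cont_cmult[OF pw_cont_const]])
        fix x assume "x \<in> cells"
        then have "\<bar>r k x\<bar>\<^sup>2 \<le> (\<epsilon> k)\<^sup>2" by (intro power_mono \<epsilon>') auto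
        then show "(r k x)\<^sup>2 \<le> (\<epsilon> k)\<^sup>2 * 1" by simp
      qed
      then show "intg (\<lambda>x. (r k x)\<^sup>2) \<le> (\<epsilon> k)\<^sup>2 * intg (\<lambda>x. 1)" unfolding intg_cmult .
    qed
    have "(\<lambda>k. (\<epsilon> k)\<^sup>2 * intg (\<lambda>x. 1)) \<longlonglongrightarrow> 0\<^sup>2 * intg (\<lambda>x. 1)"
      by (intro tendsto_mult tendsto_power tendsto_const \<epsilon>(1))
    then show "(\<lambda>k. (\<epsilon> k)\<^sup>2 * intg (\<lambda>x. 1)) \<longlonglongrightarrow> 0" by simp
  qed
  then have "(\<lambda>k. L2_norm_on \<Omega> (r k)) \<longlonglongrightarrow> sqrt 0"
    unfolding L2_norm_on_def by (rule tendsto_real_sqrt)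
  then have "(\<lambda>k. L2_norm_on \<Omega> (\<lambda>x. P (Suc k) x - p x)) \<longlonglongrightarrow> 0" unfolding r_def[abs_def] by simp
  then show "(\<lambda>k. L2_norm_on \<Omega> (\<lambda>x. P k x - p x)) \<longlonglongrightarrow> 0"
    by (rule filterlim_sequentially_Suc[THEN iffD1])

  \<comment> \<open>With the pressure error uniformly small, \<open>form_b\<close> vanishes in the
    limit for every velocity, including the test functions for the multiplier, which do not vanish
    on the side.\<close>
  have b_lim: "(\<lambda>k. form_b \<Omega> v (r k)) \<longlonglongrightarrow> 0" if v: "v \<in> Vh" for v
  proof (rule Lim_null_comparison[OF always_eventually])
    define c where "c = intg (\<lambda>x. \<bar>divergence v x\<bar>)"
    note pd = pw_cont_divergence[OF v]
    show "\<forall>k. norm (form_b \<Omega> v (r k)) \<le> \<epsilon> k * c"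
    proof
      fix k
      have le: "\<bar>divergence v x * r k x\<bar> \<le> \<epsilon> k * \<bar>divergence v x\<bar>" if "x \<in> cells" for x
        using mult_left_mono[OF \<epsilon>'[OF that, of k], of "\<bar>divergence v x\<bar>"] by (simp add: abs_mult mult.commute)
      have "intg (\<lambda>x. divergence v x * r k x) \<le> intg (\<lambda>x. \<epsilon> k * \<bar>divergence v x\<bar>)"
        by (rule intg_mono[OF pw_cont_mult[OF pd pQ[OF rQ]] pw_cont_cmult[OF pw_cont_abs[OF pd]]])
          (rule abs_le_D1[OF le])
      moreover have "intg (\<lambda>x. (-1) * (divergence v x * r k x)) \<le> intg (\<lambda>x. \<epsilon> k * \<bar>divergence v x\<bar>)"
        by (rule intg_mono[OF pw_cont_cmult[OF pw_cont_mult[OF pd pQ[OF rQ]]] pw_cont_cmult[OF pw_cont_abs[OF pd]]])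
          (use abs_le_D2[OF le] in simp)
      ultimately show "norm (form_b \<Omega> v (r k)) \<le> \<epsilon> k * c"
        unfolding form_b_def c_def intg_cmult by (simp add: abs_le_iff)
    qed
    have "(\<lambda>k. \<epsilon> k * c) \<longlonglongrightarrow> 0 * c" by (intro tendsto_mult tendsto_const \<epsilon>(1))
    then show "(\<lambda>k. \<epsilon> k * c) \<longlonglongrightarrow> 0" by simp
  qed
  have "(\<lambda>k. Lam_norm g m M (\<delta> k)) \<longlonglongrightarrow> 0"
  proof (rule Lam_norm_tendsto_0)
    fix v assume v: "v \<in> Vn"
    have "?I (\<lambda>x. v x \<bullet> ?\<tau>) (\<delta> k) = - (form_a \<Omega> \<nu> (w k) v + form_b \<Omega> v (r k))" for k
      using err[OF v, of k] by simp
    moreover have "(\<lambda>k. - (form_a \<Omega> \<nu> (w k) v + form_b \<Omega> v (r k))) \<longlonglongrightarrow> - (0 + 0)"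
      by (intro tendsto_minus tendsto_add a_lim b_lim Vn_V v)
    ultimately show "(\<lambda>k. ?I (\<lambda>x. v x \<bullet> ?\<tau>) (\<delta> k)) \<longlonglongrightarrow> 0" by simp
  next
    show "\<delta> k (M 1) = 0" "\<delta> k (M (m+1)) = 0" for k
      using Lt[of k] s0(3) unfolding \<delta>_def Lam_tilde_def Lam_space_def by simp_all
  qed
  then have "(\<lambda>k. Lam_norm g m M (\<lambda>x. L (Suc k) x - l x)) \<longlonglongrightarrow> 0" unfolding \<delta>_def[abs_def] .
  then show "(\<lambda>k. Lam_norm g m M (\<lambda>x. L k x - l x)) \<longlonglongrightarrow> 0"
    by (rule filterlim_sequentially_Suc[THEN iffD1])
qed

end

theorem theorem4p4:
  fixes \<Omega> \<Gamma>0 \<Gamma>1 :: "(real ^ 2) set" and SS :: "(real ^ 2) set set" and n :: "real ^ 2"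
    and \<nu> K K' :: real and f :: "real ^ 2 \<Rightarrow> real ^ 2" and g :: "real ^ 2 \<Rightarrow> real"
    and H :: "real set" and \<T> :: "real \<Rightarrow> (real ^ 2) set set"
    and m :: "real \<Rightarrow> nat" and M :: "real \<Rightarrow> nat \<Rightarrow> real ^ 2"
  assumes "polygonal_domain \<Omega> SS"
    and "frontier \<Omega> = closure \<Gamma>0 \<union> closure \<Gamma>1" and "\<Gamma>0 \<inter> \<Gamma>1 = {}"
    and "\<Gamma>0 \<noteq> {}" and "\<Gamma>1 \<noteq> {}"
    and "openin (top_of_set (frontier \<Omega>)) \<Gamma>0" and "openin (top_of_set (frontier \<Omega>)) \<Gamma>1"
    and "closure \<Gamma>1 \<in> SS"
    and "outer_unit_normal \<Omega> \<Gamma>1 n"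
    and "\<nu> > 0" and "f \<in> L2_vector_fields \<Omega>"
    and "continuous_on (closure \<Gamma>1) g" and "\<And>x. x \<in> \<Gamma>1 \<Longrightarrow> g x > 0"
    and "K > 0" and "K' > 0"
    and "\<And>h. h \<in> H \<Longrightarrow> admissible_mesh \<Omega> K K' h (\<T> h)"
    and "\<And>h. h \<in> H \<Longrightarrow> boundary_enumeration \<Gamma>1 (\<T> h) (m h) (M h)"
  shows "\<exists>\<rho>0>0. \<forall>h\<in>H. \<forall>u p l \<rho> U P L.
     VE_solution \<Omega> \<Gamma>0 \<Gamma>1 n \<nu> f g (\<T> h) (m h) (M h) u p l \<longrightarrow>
     0 < \<rho> \<longrightarrow> \<rho> < \<rho>0 \<longrightarrow>
     L (1::nat) \<in> Lam_tilde \<Gamma>1 (\<T> h) (m h) (M h) \<longrightarrow>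
     (\<forall>k\<ge>1. uzawa_step1 \<Omega> \<Gamma>0 \<Gamma>1 n \<nu> f g (\<T> h) (m h) (M h) (L k) (U k) (P k) \<and>
            uzawa_step2 \<Gamma>1 n g (\<T> h) (m h) (M h) \<rho> (U k) (L k) (L (k + 1))) \<longrightarrow>
     (\<lambda>k. H1_norm \<Omega> (\<lambda>x. U k x - u x)) \<longlonglongrightarrow> 0 \<and>
     (\<lambda>k. L2_norm_on \<Omega> (\<lambda>x. P k x - p x)) \<longlonglongrightarrow> 0 \<and>
     (\<lambda>k. Lam_norm g (m h) (M h) (\<lambda>x. L k x - l x)) \<longlonglongrightarrow> 0"
proof -
  have "bounded \<Omega>" using assms(1) unfolding polygonal_domain_def by (elim conjE)
  then have bd: "bounded (closure \<Omega>)" by (rule bounded_closure)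
  obtain R where R: "\<And>x y. x \<in> closure \<Omega> \<Longrightarrow> y \<in> closure \<Omega> \<Longrightarrow> norm (x - y) \<le> R"
    using diameter_bounded(1)[OF bd] unfolding dist_norm by blast
  have "closure \<Gamma>1 \<subseteq> closure \<Omega>" using assms(2) unfolding frontier_def by blast
  then have "compact (closure \<Gamma>1)" using bounded_subset[OF bd] by (simp add: compact_eq_bounded_closed)
  then have "bounded (g ` closure \<Gamma>1)"
    using compact_continuous_image[OF assms(12)] compact_imp_bounded by blast
  then obtain G where G: "G > 0" "\<And>x. x \<in> closure \<Gamma>1 \<Longrightarrow> \<bar>g x\<bar> \<le> G"
    unfolding bounded_pos by auto
  obtain C where C: "C > 0"
    "\<And>h T w c0 c1 x. h > 0 \<Longrightarrow> compact T \<Longrightarrow> cball c0 (K * h) \<subseteq> T \<Longrightarrow> T \<subseteq> cball c1 (K' * h) \<Longrightarrow>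
      is_poly_on 2 T w \<Longrightarrow> x \<in> T \<Longrightarrow> (w x)\<^sup>2 \<le> C / h\<^sup>2 * (LINT x:T|lebesgue. (w x)\<^sup>2)"
    using inverse_estimate[OF assms(14,15)] by blast
  \<comment> \<open>The constants of \<open>Lam_bound\<close> multiplied together. All of them are
    fixed before any \<open>h\<close> is taken from \<open>H\<close>, which is the required
    independence of \<open>h\<close>.\<close>
  define B where "B = 2 * K' * G * C * (1 + 4 * K'\<^sup>2) * ((8 * R\<^sup>2 + 2) * 4)"
  have B: "B \<ge> 0"
    unfolding B_def using assms(15) G(1) C(1) by (intro mult_nonneg_nonneg add_nonneg_nonneg) auto
  have main: "(\<lambda>k. H1_norm \<Omega> (\<lambda>x. U k x - u x)) \<longlonglongrightarrow> 0 \<and>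
     (\<lambda>k. L2_norm_on \<Omega> (\<lambda>x. P k x - p x)) \<longlonglongrightarrow> 0 \<and>
     (\<lambda>k. Lam_norm g (m h) (M h) (\<lambda>x. L k x - l x)) \<longlonglongrightarrow> 0"
    if h: "h \<in> H" and sol: "VE_solution \<Omega> \<Gamma>0 \<Gamma>1 n \<nu> f g (\<T> h) (m h) (M h) u p l"
      and \<rho>: "0 < \<rho>" "\<rho> < 4 * \<nu> / (B + 1)"
      and L: "L (1::nat) \<in> Lam_tilde \<Gamma>1 (\<T> h) (m h) (M h)"
      and steps: "\<forall>k\<ge>1. uzawa_step1 \<Omega> \<Gamma>0 \<Gamma>1 n \<nu> f g (\<T> h) (m h) (M h) (L k) (U k) (P k) \<and>
            uzawa_step2 \<Gamma>1 n g (\<T> h) (m h) (M h) \<rho> (U k) (L k) (L (k + 1))"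
    for h u p l \<rho> U P L
  proof -
    interpret fem \<Omega> \<Gamma>0 \<Gamma>1 SS n \<nu> K K' h g "\<T> h" "m h" "M h"
      using assms(1-3,6,8-10,12-15) assms(16,17)[OF h] by unfold_locales
    have trace: "Lam_inner g (m h) (M h) (\<lambda>x. v x \<bullet> tangent n) (\<lambda>x. v x \<bullet> tangent n) \<le> B * energy v"
      if "v \<in> Vn" for v
      using Lam_bound[OF R that less_imp_le[OF G(1)] abs_le_D1[OF G(2)] C]
      unfolding B_def by (simp only: mult.assoc)
    have "\<rho> * (B + 1) < 4 * \<nu>" using \<rho>(2) B by (simp add: pos_less_divide_eq)
    then have \<rho>B: "\<rho> * B < 4 * \<nu>" using \<rho>(1) by (simp add: distrib_left)
    have poincare: "intg (\<lambda>x. (norm (v x))\<^sup>2) \<le> 16 * R\<^sup>2 * energy v" if "v \<in> Vn" for v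
      by (rule L2_bound[OF R that])
    have s: "uzawa_step1 \<Omega> \<Gamma>0 \<Gamma>1 n \<nu> f g (\<T> h) (m h) (M h) (L k) (U k) (P k)"
      "uzawa_step2 \<Gamma>1 n g (\<T> h) (m h) (M h) \<rho> (U k) (L k) (L (k + 1))" if "k \<ge> 1" for k
      using steps that by blast+
    note conv = uzawa_convergence[where B=B and A="16 * R\<^sup>2" and L=L and U=U and P=P,
        OF B trace poincare \<rho>(1) \<rho>B sol L s]
    show ?thesis
      by (intro conjI conv)
  qed
  show ?thesis
  \<comment> \<open>Energy decreases as long as \<open>\<rho> * B < 4 * \<nu>\<close>; only
    \<open>B \<ge> 0\<close> has been recorded, and the \<open>+ 1\<close> keeps the denominator
    positive.\<close>
  proof (intro exI[of _ "4 * \<nu> / (B + 1)"] conjI)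
    show "0 < 4 * \<nu> / (B + 1)" using assms(10) B by simp
  qed (use main in blast)
qed

end
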